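(* Let $(R,\mathfrak m)\to (S,\mathfrak n)$ be a surjection of noetherian local rings such that $\operatorname{ld}_R S=0$. Then for every finitely generated $S$-module $N$ there is an equality $$\operatorname{ld}_R N=\operatorname{ld}_S N.$$ In particular, $\operatorname{gl\,ld} S\le \operatorname{gl\,ld} R$. If $R$ is absolutely Koszul, then so is $S$.
   Context: Rings are commutative noetherian local rings; statements are also meant to cover, with the obvious changes, the graded situation (standard graded algebras over a field $k$, graded modules, degree-preserving maps). Linearity defect: for a finitely generated module $M$ over $(R,\mathfrak m)$ with minimal free resolution $F$, filter $F$ by the subcomplexes $\mathcal G^nF$ with $(\mathcal G^nF)_i=\mathfrak m^{n-i}F_i$ (where $\mathfrak m^j=R$ for $j\le 0$), with differential induced by that of $F$. The associated graded complex of this filtration is the linear part $\operatorname{lin}^R F$. The linearity defect is $\operatorname{ld}_R M=\sup\{i: H_i(\operatorname{lin}^R F)\ne 0\}\in\{0,1,\dots\}\cup\{\infty\}$ for $M\neq 0$, and $\operatorname{ld}_R 0=0$. The global linearity defect is $\operatorname{gl\,ld} R=\sup\{\operatorname{ld}_R M: M \text{ a finitely generated } R\text{-module}\}$. $R$ is absolutely Koszul if every finitely generated $R$-module has finite linearity defect. *)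

theory Defs
  imports "HOL-Algebra.Module" "HOL-Algebra.Ring_Divisibility" "HOL-Algebra.Ideal_Product" "HOL-Library.Extended_Nat"
begin

section \<open>Noetherian local rings\<close>

locale noetherian_local_ring = cring R + noetherian_ring R for R (structure) +
  assumes unique_maximalideal: "\<exists>!I. maximalideal I R"

definition max_ideal :: "('a, 'r) ring_scheme \<Rightarrow> 'a set"
  where "max_ideal R = (THE I. maximalideal I R)"


section \<open>Modules\<close>

text \<open>In the record type \<^typ>\<open>('a, 'b) module\<close> the fields \<^const>\<open>monoid.mult\<close> and \<^const>\<open>one\<close> carry
  no information about the module; they are left undefined where no natural value is available.\<close>

definition ring_as_module :: "('a, 'r) ring_scheme \<Rightarrow> ('a, 'a) module"
  where "ring_as_module R =
    \<lparr>carrier = carrier R, monoid.mult = monoid.mult R, one = \<one>\<^bsub>R\<^esub>, zero = \<zero>\<^bsub>R\<^esub>, add = add R, smult = monoid.mult R\<rparr>"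

definition restrict_scalars :: "('a \<Rightarrow> 'b) \<Rightarrow> ('b, 'm) module \<Rightarrow> ('a, 'm) module"
  where "restrict_scalars \<phi> M =
    \<lparr>carrier = carrier M, monoid.mult = monoid.mult M, one = \<one>\<^bsub>M\<^esub>, zero = \<zero>\<^bsub>M\<^esub>, add = add M,
      smult = (\<lambda>r x. \<phi> r \<odot>\<^bsub>M\<^esub> x)\<rparr>"

definition finitely_generated :: "('a, 'r) ring_scheme \<Rightarrow> ('a, 'm) module \<Rightarrow> bool"
  where "finitely_generated R M \<longleftrightarrow>
    (\<exists>A. finite A \<and> A \<subseteq> carrier M \<and>
      (\<forall>x \<in> carrier M. \<exists>c \<in> A \<rightarrow> carrier R. x = (\<Oplus>\<^bsub>M\<^esub>a\<in>A. c a \<odot>\<^bsub>M\<^esub> a)))"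

definition free_of_finite_rank :: "('a, 'r) ring_scheme \<Rightarrow> ('a, 'm) module \<Rightarrow> bool"
  where "free_of_finite_rank R M \<longleftrightarrow>
    (\<exists>B. finite B \<and> B \<subseteq> carrier M \<and>
      (\<forall>x \<in> carrier M. \<exists>!c. c \<in> B \<rightarrow>\<^sub>E carrier R \<and> x = (\<Oplus>\<^bsub>M\<^esub>b\<in>B. c b \<odot>\<^bsub>M\<^esub> b)))"

definition module_hom ::
    "('a, 'r) ring_scheme \<Rightarrow> ('a, 'm) module \<Rightarrow> ('a, 'n) module \<Rightarrow> ('m \<Rightarrow> 'n) set"
  where "module_hom R M N =
    {f \<in> carrier M \<rightarrow> carrier N.
      (\<forall>x \<in> carrier M. \<forall>y \<in> carrier M. f (x \<oplus>\<^bsub>M\<^esub> y) = f x \<oplus>\<^bsub>N\<^esub> f y) \<and>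
      (\<forall>r \<in> carrier R. \<forall>x \<in> carrier M. f (r \<odot>\<^bsub>M\<^esub> x) = r \<odot>\<^bsub>N\<^esub> f x)}"

text \<open>The submodule \<open>I M\<close>, in the style of \<^const>\<open>ideal_prod\<close>.\<close>

inductive_set ideal_smult :: "'a set \<Rightarrow> ('a, 'm) module \<Rightarrow> 'm set"
  for I and M where
    smult: "\<lbrakk>a \<in> I; x \<in> carrier M\<rbrakk> \<Longrightarrow> a \<odot>\<^bsub>M\<^esub> x \<in> ideal_smult I M"
  | sum: "\<lbrakk>x \<in> ideal_smult I M; y \<in> ideal_smult I M\<rbrakk> \<Longrightarrow> x \<oplus>\<^bsub>M\<^esub> y \<in> ideal_smult I M"

text \<open>The module analogue of \<^const>\<open>FactRing\<close>.\<close>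

definition quot_module :: "('a, 'm) module \<Rightarrow> 'm set \<Rightarrow> ('a, 'm set) module"
  where "quot_module M H =
    \<lparr>carrier = a_rcosets\<^bsub>M\<^esub> H, monoid.mult = undefined, one = undefined, zero = H, add = set_add M,
      smult = (\<lambda>r X. \<Union>x\<in>X. H +>\<^bsub>M\<^esub> (r \<odot>\<^bsub>M\<^esub> x))\<rparr>"

definition direct_sum :: "(nat \<Rightarrow> ('a, 'm) module) \<Rightarrow> ('a, nat \<Rightarrow> 'm) module"
  where "direct_sum M =
    \<lparr>carrier = {x. (\<forall>n. x n \<in> carrier (M n)) \<and> finite {n. x n \<noteq> \<zero>\<^bsub>M n\<^esub>}},
      monoid.mult = undefined, one = undefined,
      zero = (\<lambda>n. \<zero>\<^bsub>M n\<^esub>),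
      add = (\<lambda>x y n. x n \<oplus>\<^bsub>M n\<^esub> y n),
      smult = (\<lambda>r x n. r \<odot>\<^bsub>M n\<^esub> x n)\<rparr>"


section \<open>Complexes and minimal free resolutions\<close>

text \<open>A complex \<open>\<dots> \<rightarrow> F 2 \<rightarrow> F 1 \<rightarrow> F 0 \<rightarrow> 0\<close> is given by modules \<open>F i\<close> and differentials
  \<open>d i : F i \<rightarrow> F (i - 1)\<close> for \<open>i \<ge> 1\<close>. The map \<open>d 0\<close> is never used.\<close>

definition cycles :: "(nat \<Rightarrow> ('a, 'm) module) \<Rightarrow> (nat \<Rightarrow> 'm \<Rightarrow> 'm) \<Rightarrow> nat \<Rightarrow> 'm set"
  where "cycles F d i = (if i = 0 then carrier (F 0) else a_kernel (F i) (F (i - 1)) (d i))"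

definition boundaries :: "(nat \<Rightarrow> ('a, 'm) module) \<Rightarrow> (nat \<Rightarrow> 'm \<Rightarrow> 'm) \<Rightarrow> nat \<Rightarrow> 'm set"
  where "boundaries F d i = d (i + 1) ` carrier (F (i + 1))"

definition homology ::
    "(nat \<Rightarrow> ('a, 'm) module) \<Rightarrow> (nat \<Rightarrow> 'm \<Rightarrow> 'm) \<Rightarrow> nat \<Rightarrow> ('a, 'm set) module"
  where "homology F d i = quot_module ((F i)\<lparr>carrier := cycles F d i\<rparr>) (boundaries F d i)"

definition minimal_free_resolution ::
    "('a, 'r) ring_scheme \<Rightarrow> ('a, 'm) module \<Rightarrow>
      (nat \<Rightarrow> ('a, 'f) module) \<Rightarrow> (nat \<Rightarrow> 'f \<Rightarrow> 'f) \<Rightarrow> ('f \<Rightarrow> 'm) \<Rightarrow> bool"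
  where "minimal_free_resolution R M F d \<epsilon> \<longleftrightarrow>
    (\<forall>i. module R (F i) \<and> free_of_finite_rank R (F i)) \<and>
    (\<forall>i \<ge> 1. d i \<in> module_hom R (F i) (F (i - 1))) \<and>
    \<epsilon> \<in> module_hom R (F 0) M \<and>
    \<epsilon> ` carrier (F 0) = carrier M \<and>
    boundaries F d 0 = a_kernel (F 0) M \<epsilon> \<and>
    (\<forall>i \<ge> 1. boundaries F d i = cycles F d i) \<and>
    (\<forall>i \<ge> 1. d i ` carrier (F i) \<subseteq> ideal_smult (max_ideal R) (F (i - 1)))"


section \<open>The linear part and the linearity defect\<close>

text \<open>The set \<open>filt R F n i\<close> is \<open>(\<G>\<^sup>nF)\<^sub>i = \<mm>\<^sup>n\<^sup>-\<^sup>iF\<^sub>i\<close>, and \<open>lin R F i\<close> is the direct sum over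
  \<open>n\<close> of the quotients \<open>gr R F n i = (\<G>\<^sup>nF)\<^sub>i / (\<G>\<^sup>n\<^sup>+\<^sup>1F)\<^sub>i\<close>. The indices \<open>n < 0\<close> contribute
  nothing because \<open>\<G>\<^sup>nF = F\<close> for \<open>n \<le> 0\<close>. The subtraction \<open>n - i\<close> is truncated and the
  zeroth power is the whole ring, which is the convention \<open>\<mm>\<^sup>j = R\<close> for \<open>j \<le> 0\<close>.
  Powers of the maximal ideal are taken in the monoid \<^const>\<open>ideals_set\<close> of ideals.\<close>

definition filt :: "('a, 'r) ring_scheme \<Rightarrow> (nat \<Rightarrow> ('a, 'f) module) \<Rightarrow> nat \<Rightarrow> nat \<Rightarrow> 'f set"
  where "filt R F n i = ideal_smult (max_ideal R [^]\<^bsub>ideals_set R\<^esub> (n - i)) (F i)"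

definition gr ::
    "('a, 'r) ring_scheme \<Rightarrow> (nat \<Rightarrow> ('a, 'f) module) \<Rightarrow> nat \<Rightarrow> nat \<Rightarrow> ('a, 'f set) module"
  where "gr R F n i = quot_module ((F i)\<lparr>carrier := filt R F n i\<rparr>) (filt R F (n + 1) i)"

definition gr_diff ::
    "('a, 'r) ring_scheme \<Rightarrow> (nat \<Rightarrow> ('a, 'f) module) \<Rightarrow> (nat \<Rightarrow> 'f \<Rightarrow> 'f) \<Rightarrow>
      nat \<Rightarrow> nat \<Rightarrow> 'f set \<Rightarrow> 'f set"
  where "gr_diff R F d n i X = (\<Union>x\<in>X. filt R F (n + 1) (i - 1) +>\<^bsub>F (i - 1)\<^esub> d i x)"

definition lin ::
    "('a, 'r) ring_scheme \<Rightarrow> (nat \<Rightarrow> ('a, 'f) module) \<Rightarrow> nat \<Rightarrow> ('a, nat \<Rightarrow> 'f set) module"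
  where "lin R F i = direct_sum (\<lambda>n. gr R F n i)"

definition lin_diff ::
    "('a, 'r) ring_scheme \<Rightarrow> (nat \<Rightarrow> ('a, 'f) module) \<Rightarrow> (nat \<Rightarrow> 'f \<Rightarrow> 'f) \<Rightarrow>
      nat \<Rightarrow> (nat \<Rightarrow> 'f set) \<Rightarrow> (nat \<Rightarrow> 'f set)"
  where "lin_diff R F d i x = (\<lambda>n. gr_diff R F d n i (x n))"

text \<open>Minimal free resolutions are unique up to isomorphism. Every finite free module has
  an isomorphic copy of functions \<^typ>\<open>nat \<Rightarrow> 'a\<close> vanishing outside an initial segment, so that
  fixing this carrier type in the choice below loses nothing.\<close>

definition ld :: "('a, 'r) ring_scheme \<Rightarrow> ('a, 'm) module \<Rightarrow> enat"
  where "ld R M =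
    (if carrier M = {\<zero>\<^bsub>M\<^esub>} then 0
     else let (F, d, \<epsilon>) =
         (SOME (F :: nat \<Rightarrow> ('a, nat \<Rightarrow> 'a) module, d, \<epsilon>). minimal_free_resolution R M F d \<epsilon>)
       in Sup {enat i | i. carrier (homology (lin R F) (lin_diff R F d) i)
                           \<noteq> {\<zero>\<^bsub>homology (lin R F) (lin_diff R F d) i\<^esub>}})"

text \<open>A finitely generated module is isomorphic to a quotient of some \<open>R\<^sup>n\<close>, whose elements
  are sets of functions \<^typ>\<open>nat \<Rightarrow> 'a\<close>. As \<^const>\<open>ld\<close> is invariant under isomorphism, the
  modules with this carrier type suffice to quantify over all finitely generated modules.\<close>

definition gl_ld :: "('a, 'r) ring_scheme \<Rightarrow> enat"
  where "gl_ld R =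
    Sup {ld R M | M :: ('a, (nat \<Rightarrow> 'a) set) module. module R M \<and> finitely_generated R M}"

definition absolutely_koszul :: "('a, 'r) ring_scheme \<Rightarrow> bool"
  where "absolutely_koszul R \<longleftrightarrow>
    (\<forall>M :: ('a, (nat \<Rightarrow> 'a) set) module.
      module R M \<and> finitely_generated R M \<longrightarrow> ld R M < \<infinity>)"

end

theory Submission
  imports Defs
begin

text \<open>
  Let \<open>\<mm>\<close> and \<open>\<nn>\<close> be the maximal ideals of \<open>R\<close> and \<open>S\<close>. For an \<open>R\<close>-module \<open>M\<close> and \<open>i \<ge> 1\<close>, let
  \<open>T\<^sub>i(M)\<close> be the assertion that the natural maps from \<open>Tor\<^sub>i(M, R/\<mm>\<^sup>q\<^sup>+\<^sup>1)\<close> to \<open>Tor\<^sub>i(M, R/\<mm>\<^sup>q)\<close> vanish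
  for all \<open>q\<close>. On a free resolution \<open>F\<close> of \<open>M\<close> it reads: if \<open>x \<in> F\<^sub>i\<close> and \<open>d x \<in> \<mm>\<^sup>q\<^sup>+\<^sup>1 F\<^sub>i\<^sub>-\<^sub>1\<close>, then
  \<open>x \<in> d F\<^sub>i\<^sub>+\<^sub>1 + \<mm>\<^sup>q F\<^sub>i\<close> (\<open>tor_maps_zero\<close>). If \<open>F\<close> is minimal, then \<open>H\<^sub>i(lin F) = 0\<close> implies \<open>T\<^sub>i(M)\<close>, by
  successive approximation, and \<open>T\<^sub>i(M)\<close> together with \<open>T\<^sub>i\<^sub>+\<^sub>1(M)\<close> implies \<open>H\<^sub>i(lin F) = 0\<close>. Hence
  \<open>ld M \<le> e\<close> if and only if \<open>T\<^sub>i(M)\<close> holds for all \<open>i > e\<close> (\<open>ld_le_iff\<close>). The gain is that \<open>T\<^sub>i(M)\<close> can be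
  tested on any resolution (\<open>tor_maps_zero_independent\<close>), so that a resolution may be built for the
  purpose.

  The hypothesis says that \<open>T\<^sub>i(S)\<close> holds over \<open>R\<close> for all \<open>i \<ge> 1\<close>, and this passes to finite free
  \<open>S\<close>-modules. Let \<open>L\<close> be the first term of the minimal \<open>S\<close>-resolution of \<open>N\<close> and \<open>K\<close> the kernel of
  \<open>L \<rightarrow> N\<close>, so that \<open>K \<subseteq> \<nn> L = \<mm> L\<close>. Take minimal \<open>R\<close>-resolutions \<open>P\<close> of \<open>K\<close> and \<open>G\<close> of \<open>L\<close>. Since
  \<open>T\<^sub>i(L)\<close> holds for all \<open>i \<ge> 1\<close>, boundaries of \<open>G\<close> that lie in \<open>\<mm>\<^sup>2 G\<close> come from \<open>\<mm> G\<close>; as \<open>P\<close> is minimal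
  and \<open>K \<subseteq> \<mm> L\<close>, the inclusion of \<open>K\<close> lifts to a chain map \<open>\<alpha>\<close> from \<open>P\<close> to \<open>G\<close> with values in \<open>\<mm> G\<close>
  (\<open>comparison_map\<close>). Its mapping cone is therefore a minimal \<open>R\<close>-resolution of \<open>N\<close>. Because \<open>\<alpha>\<close> gains
  one power of \<open>\<mm>\<close>, the two components of the cone can be treated separately, and the result is
  (\<open>resolution_of_quotient\<close>) that \<open>T\<^sub>i\<^sub>+\<^sub>1(N)\<close> is equivalent to \<open>T\<^sub>i(K)\<close> for \<open>i \<ge> 1\<close>, while \<open>T\<^sub>1(N)\<close> is
  equivalent to \<open>K \<inter> \<mm>\<^sup>q\<^sup>+\<^sup>1 L \<subseteq> \<mm>\<^sup>q K\<close> for all \<open>q\<close>.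

  The same two equivalences hold over \<open>S\<close>: the first because \<open>K\<close> is the first syzygy of \<open>N\<close>, the second
  by \<open>first_syzygy\<close>. The condition in the second is the same over both rings, because \<open>\<mm>\<^sup>q\<close> and \<open>\<nn>\<^sup>q\<close>
  generate the same submodules of \<open>S\<close>-modules. By induction on \<open>i\<close>, the assertion \<open>T\<^sub>i(N)\<close> holds over
  \<open>R\<close> if and only if it holds over \<open>S\<close>, and so the two linearity defects of \<open>N\<close> agree. The claims on the
  global linearity defect and on absolute Koszulness follow, since every finitely generated
  \<open>S\<close>-module is a finitely generated \<open>R\<close>-module.
\<close>

section \<open>Homomorphisms, submodules and finite sums\<close>

lemma (in abelian_group) minus_eq_iff:
  "x \<in> carrier G \<Longrightarrow> y \<in> carrier G \<Longrightarrow> z \<in> carrier G \<Longrightarrow> x \<ominus> y = z \<longleftrightarrow> x = y \<oplus> z"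
  using add.inv_solve_right[of z x y] by (auto simp: a_minus_def a_comm)

lemma (in abelian_group) minus_zero_iff:
  "x \<in> carrier G \<Longrightarrow> y \<in> carrier G \<Longrightarrow> x \<ominus> y = \<zero> \<longleftrightarrow> x = y"
  using minus_eq_iff[of x y \<zero>] by simp

lemma (in abelian_group) minus_minus_cancel:
  assumes "x \<in> carrier G" "y \<in> carrier G"
  shows "x \<ominus> (x \<ominus> y) = y" "y \<oplus> (x \<ominus> y) = x" "x \<ominus> y \<oplus> y = x" "x \<oplus> y \<ominus> y = x" "x \<oplus> y \<ominus> x = y"
proof -
  show 2: "y \<oplus> (x \<ominus> y) = x" using minus_eq_iff[of x y "x \<ominus> y"] assms by simp
  thus "x \<ominus> y \<oplus> y = x" using assms by (simp add: a_comm)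
  show "x \<ominus> (x \<ominus> y) = y" using minus_eq_iff[of x "x \<ominus> y" y] assms 2 by (simp add: a_comm)
  show "x \<oplus> y \<ominus> y = x" using minus_eq_iff[of "x \<oplus> y" y x] assms by (simp add: a_comm)
  show "x \<oplus> y \<ominus> x = y" using minus_eq_iff[of "x \<oplus> y" x y] assms by (simp add: a_comm)
qed

lemma (in abelian_group) minus_add_minus:
  assumes "x \<in> carrier G" "y \<in> carrier G" "u \<in> carrier G" "v \<in> carrier G"
  shows "(x \<oplus> u) \<ominus> (y \<oplus> v) = (x \<ominus> y) \<oplus> (u \<ominus> v)"
  using assms by (simp add: a_minus_def minus_add a_ac)

lemma (in abelian_group) minus_zero_right: "x \<in> carrier G \<Longrightarrow> x \<ominus> \<zero> = x"
  by (metis minus_eq_iff l_zero zero_closed)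

lemma submoduleD:
  assumes "module R M" "submodule H R M"
  shows "H \<subseteq> carrier M" "\<zero>\<^bsub>M\<^esub> \<in> H" "\<And>x. x \<in> H \<Longrightarrow> \<ominus>\<^bsub>M\<^esub> x \<in> H"
    "\<And>r x. r \<in> carrier R \<Longrightarrow> x \<in> H \<Longrightarrow> r \<odot>\<^bsub>M\<^esub> x \<in> H"
    "\<And>x y. x \<in> H \<Longrightarrow> y \<in> H \<Longrightarrow> x \<oplus>\<^bsub>M\<^esub> y \<in> H"
    "\<And>x y. x \<in> H \<Longrightarrow> y \<in> H \<Longrightarrow> x \<ominus>\<^bsub>M\<^esub> y \<in> H"
    "\<And>x. x \<in> H \<Longrightarrow> x \<in> carrier M"
proof -
  interpret module R M by fact
  note e = submoduleE[OF assms(2)]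
  show "H \<subseteq> carrier M" "\<And>x. x \<in> H \<Longrightarrow> \<ominus>\<^bsub>M\<^esub> x \<in> H"
    "\<And>r x. r \<in> carrier R \<Longrightarrow> x \<in> H \<Longrightarrow> r \<odot>\<^bsub>M\<^esub> x \<in> H"
    "\<And>x y. x \<in> H \<Longrightarrow> y \<in> H \<Longrightarrow> x \<oplus>\<^bsub>M\<^esub> y \<in> H" "\<And>x. x \<in> H \<Longrightarrow> x \<in> carrier M" using e by auto
  show "\<zero>\<^bsub>M\<^esub> \<in> H" using submodule.axioms(1)[OF assms(2)] subgroup.one_closed by fastforce
  show "\<And>x y. x \<in> H \<Longrightarrow> y \<in> H \<Longrightarrow> x \<ominus>\<^bsub>M\<^esub> y \<in> H" using e by (simp add: a_minus_def)
qed

lemma submodule_closedI: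
  assumes "module R M" "H \<subseteq> carrier M" "\<zero>\<^bsub>M\<^esub> \<in> H"
    "\<And>x y. x \<in> H \<Longrightarrow> y \<in> H \<Longrightarrow> x \<oplus>\<^bsub>M\<^esub> y \<in> H"
    "\<And>r x. r \<in> carrier R \<Longrightarrow> x \<in> H \<Longrightarrow> r \<odot>\<^bsub>M\<^esub> x \<in> H"
  shows "submodule H R M"
proof -
  interpret module R M by fact
  have "\<ominus>\<^bsub>M\<^esub> x \<in> H" if "x \<in> H" for x
  proof -
    have "(\<ominus>\<^bsub>R\<^esub> \<one>\<^bsub>R\<^esub>) \<odot>\<^bsub>M\<^esub> x \<in> H" using that assms(5) by simp
    thus ?thesis using that assms(2) by (simp add: smult_l_minus subset_iff)
  qed
  thus ?thesis using assms by (intro submoduleI) auto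
qed

lemma homD:
  assumes "f \<in> module_hom R M N"
  shows "\<And>x. x \<in> carrier M \<Longrightarrow> f x \<in> carrier N"
    "\<And>x y. x \<in> carrier M \<Longrightarrow> y \<in> carrier M \<Longrightarrow> f (x \<oplus>\<^bsub>M\<^esub> y) = f x \<oplus>\<^bsub>N\<^esub> f y"
    "\<And>r x. r \<in> carrier R \<Longrightarrow> x \<in> carrier M \<Longrightarrow> f (r \<odot>\<^bsub>M\<^esub> x) = r \<odot>\<^bsub>N\<^esub> f x"
  using assms by (auto simp: module_hom_def)

lemma homI:
  assumes "\<And>x. x \<in> carrier M \<Longrightarrow> f x \<in> carrier N"
    "\<And>x y. x \<in> carrier M \<Longrightarrow> y \<in> carrier M \<Longrightarrow> f (x \<oplus>\<^bsub>M\<^esub> y) = f x \<oplus>\<^bsub>N\<^esub> f y"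
    "\<And>r x. r \<in> carrier R \<Longrightarrow> x \<in> carrier M \<Longrightarrow> f (r \<odot>\<^bsub>M\<^esub> x) = r \<odot>\<^bsub>N\<^esub> f x"
  shows "f \<in> module_hom R M N"
  using assms by (auto simp: module_hom_def)

lemma hom_arith:
  assumes "module R M" "module R N" "f \<in> module_hom R M N"
  shows "f \<zero>\<^bsub>M\<^esub> = \<zero>\<^bsub>N\<^esub>"
    "\<And>x. x \<in> carrier M \<Longrightarrow> f (\<ominus>\<^bsub>M\<^esub> x) = \<ominus>\<^bsub>N\<^esub> f x"
    "\<And>x y. x \<in> carrier M \<Longrightarrow> y \<in> carrier M \<Longrightarrow> f (x \<ominus>\<^bsub>M\<^esub> y) = f x \<ominus>\<^bsub>N\<^esub> f y"
proof -
  interpret M: module R M by fact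
  interpret N: module R N by fact
  note h = homD[OF assms(3)]
  show 0: "f \<zero>\<^bsub>M\<^esub> = \<zero>\<^bsub>N\<^esub>"
    using h(3)[of "\<zero>\<^bsub>R\<^esub>" "\<zero>\<^bsub>M\<^esub>"] h(1)[of "\<zero>\<^bsub>M\<^esub>"] by simp
  show 1: "f (\<ominus>\<^bsub>M\<^esub> x) = \<ominus>\<^bsub>N\<^esub> f x" if "x \<in> carrier M" for x
    using h(3)[of "\<ominus>\<^bsub>R\<^esub> \<one>\<^bsub>R\<^esub>" x] that h(1)[OF that]
    by (simp add: M.smult_l_minus N.smult_l_minus)
  show "f (x \<ominus>\<^bsub>M\<^esub> y) = f x \<ominus>\<^bsub>N\<^esub> f y" if "x \<in> carrier M" "y \<in> carrier M" for x y
    using that by (simp add: a_minus_def h 1)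
qed

lemma hom_id: "(\<lambda>x. x) \<in> module_hom R N N"
  by (rule homI) auto

lemma hom_compose:
  assumes "f \<in> module_hom R M N" "g \<in> module_hom R N P"
  shows "(\<lambda>x. g (f x)) \<in> module_hom R M P"
  using homD[OF assms(1)] homD[OF assms(2)] by (intro homI) auto

lemma hom_minus:
  assumes "module R M" "module R N" "f \<in> module_hom R M N" "g \<in> module_hom R M N"
  shows "(\<lambda>x. f x \<ominus>\<^bsub>N\<^esub> g x) \<in> module_hom R M N"
proof -
  interpret M: module R M by fact
  interpret N: module R N by fact
  note h = homD[OF assms(3)] homD[OF assms(4)]
  show ?thesis
    by (rule homI)
       (simp_all add: h a_minus_def N.smult_r_distr N.smult_r_minus N.minus_add N.M.add.m_ac)
qed

lemma hom_add:
  assumes "module R M" "module R N" "f \<in> module_hom R M N" "g \<in> module_hom R M N"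
  shows "(\<lambda>x. f x \<oplus>\<^bsub>N\<^esub> g x) \<in> module_hom R M N"
proof -
  interpret M: module R M by fact
  interpret N: module R N by fact
  note h = homD[OF assms(3)] homD[OF assms(4)]
  show ?thesis
    by (rule homI) (simp_all add: h N.smult_r_distr N.M.add.m_ac)
qed

lemma hom_zero:
  assumes "module R N"
  shows "(\<lambda>x. \<zero>\<^bsub>N\<^esub>) \<in> module_hom R M N"
proof -
  interpret N: module R N by fact
  show ?thesis by (rule homI) simp_all
qed

lemma submodule_image:
  assumes "module R M" "module R N" "f \<in> module_hom R M N" "submodule H R M"
  shows "submodule (f ` H) R N"
proof -
  note h = homD[OF assms(3)] and s = submoduleD[OF assms(1,4)]
  show ?thesis
  proof (rule submodule_closedI[OF assms(2)])
    show "f ` H \<subseteq> carrier N" using h(1) s(1) by auto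
    show "\<zero>\<^bsub>N\<^esub> \<in> f ` H" using s(2) hom_arith(1)[OF assms(1-3)] by force
    show "x \<oplus>\<^bsub>N\<^esub> y \<in> f ` H" if xy: "x \<in> f ` H" "y \<in> f ` H" for x y
    proof -
      from xy obtain a b where ab: "a \<in> H" "b \<in> H" "x = f a" "y = f b" by auto
      hence "x \<oplus>\<^bsub>N\<^esub> y = f (a \<oplus>\<^bsub>M\<^esub> b)" using h(2) s(7) by auto
      thus ?thesis using ab s(5) by auto
    qed
    show "r \<odot>\<^bsub>N\<^esub> x \<in> f ` H" if rx: "r \<in> carrier R" "x \<in> f ` H" for r x
    proof -
      from rx obtain a where ab: "a \<in> H" "x = f a" by auto
      hence "r \<odot>\<^bsub>N\<^esub> x = f (r \<odot>\<^bsub>M\<^esub> a)" using h(3) s(7) rx by auto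
      thus ?thesis using ab s(4) rx by auto
    qed
  qed
qed

lemma a_kernel_iff: "x \<in> a_kernel M N f \<longleftrightarrow> x \<in> carrier M \<and> f x = \<zero>\<^bsub>N\<^esub>"
  by (auto simp: a_kernel_def kernel_def)

lemma submodule_kernel:
  assumes "module R M" "module R N" "f \<in> module_hom R M N"
  shows "submodule (a_kernel M N f) R M"
proof -
  interpret M: module R M by fact
  interpret N: module R N by fact
  note h = homD[OF assms(3)] hom_arith[OF assms]
  show ?thesis
    by (rule submodule_closedI[OF assms(1)]) (auto simp: a_kernel_iff h)
qed

lemma hom_finsum:
  assumes "module R M" "module R N" "f \<in> module_hom R M N" "g \<in> A \<rightarrow> carrier M"
  shows "f (\<Oplus>\<^bsub>M\<^esub>a\<in>A. g a) = (\<Oplus>\<^bsub>N\<^esub>a\<in>A. f (g a))"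
proof -
  interpret M: module R M by fact
  interpret N: module R N by fact
  note h = homD[OF assms(3)] hom_arith[OF assms(1-3)]
  show ?thesis using assms(4)
  proof (induction A rule: infinite_finite_induct)
    case (insert x F)
    have "g \<in> F \<rightarrow> carrier M" "g x \<in> carrier M" using insert by auto
    moreover from this have "(\<lambda>a. f (g a)) \<in> F \<rightarrow> carrier N" using h(1) by auto
    ultimately show ?case using insert h by simp
  qed (simp_all add: h)
qed

lemma submodule_finsum:
  assumes "module R M" "submodule H R M" "g \<in> A \<rightarrow> H"
  shows "(\<Oplus>\<^bsub>M\<^esub>a\<in>A. g a) \<in> H"
proof -
  interpret M: module R M by fact
  note s = submoduleD[OF assms(1,2)]
  show ?thesis using assms(3)
  proof (induction A rule: infinite_finite_induct)
    case (insert x F)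
    have "g \<in> F \<rightarrow> H" "g x \<in> H" using insert by auto
    moreover from this have "g \<in> F \<rightarrow> carrier M" "g x \<in> carrier M" using s(1) by auto
    ultimately show ?case using insert s by simp
  qed (simp_all add: s)
qed

section \<open>Products and powers of modules\<close>

definition prod_module :: "('a, 'm) module \<Rightarrow> ('a, 'n) module \<Rightarrow> ('a, 'm \<times> 'n) module"
  where "prod_module M N = \<lparr>carrier = carrier M \<times> carrier N, monoid.mult = undefined, one = undefined,
    zero = (\<zero>\<^bsub>M\<^esub>, \<zero>\<^bsub>N\<^esub>), add = (\<lambda>x y. (fst x \<oplus>\<^bsub>M\<^esub> fst y, snd x \<oplus>\<^bsub>N\<^esub> snd y)),
    smult = (\<lambda>r x. (r \<odot>\<^bsub>M\<^esub> fst x, r \<odot>\<^bsub>N\<^esub> snd x))\<rparr>"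

text \<open>Families indexed by \<open>J\<close>, extended by \<^const>\<open>undefined\<close>, so that a family is determined by its
  components.\<close>

definition power_module :: "'i set \<Rightarrow> ('a, 'm) module \<Rightarrow> ('a, 'i \<Rightarrow> 'm) module"
  where "power_module J M = \<lparr>carrier = J \<rightarrow>\<^sub>E carrier M, monoid.mult = undefined, one = undefined,
    zero = (\<lambda>j\<in>J. \<zero>\<^bsub>M\<^esub>), add = (\<lambda>x y. \<lambda>j\<in>J. x j \<oplus>\<^bsub>M\<^esub> y j),
    smult = (\<lambda>r x. \<lambda>j\<in>J. r \<odot>\<^bsub>M\<^esub> x j)\<rparr>"

lemma prod_module_simps [simp]:
  "carrier (prod_module M N) = carrier M \<times> carrier N"
  "\<zero>\<^bsub>prod_module M N\<^esub> = (\<zero>\<^bsub>M\<^esub>, \<zero>\<^bsub>N\<^esub>)"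
  "x \<oplus>\<^bsub>prod_module M N\<^esub> y = (fst x \<oplus>\<^bsub>M\<^esub> fst y, snd x \<oplus>\<^bsub>N\<^esub> snd y)"
  "r \<odot>\<^bsub>prod_module M N\<^esub> x = (r \<odot>\<^bsub>M\<^esub> fst x, r \<odot>\<^bsub>N\<^esub> snd x)"
  by (simp_all add: prod_module_def)

lemma power_module_simps:
  "carrier (power_module J M) = J \<rightarrow>\<^sub>E carrier M"
  "\<zero>\<^bsub>power_module J M\<^esub> = (\<lambda>j\<in>J. \<zero>\<^bsub>M\<^esub>)"
  "x \<oplus>\<^bsub>power_module J M\<^esub> y = (\<lambda>j\<in>J. x j \<oplus>\<^bsub>M\<^esub> y j)"
  "r \<odot>\<^bsub>power_module J M\<^esub> x = (\<lambda>j\<in>J. r \<odot>\<^bsub>M\<^esub> x j)"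
  by (simp_all add: power_module_def)

lemma prod_module_module:
  assumes "module R M" "module R N"
  shows "module R (prod_module M N)"
proof -
  interpret M: module R M by fact
  interpret N: module R N by fact
  have "abelian_group (prod_module M N)"
  proof (rule abelian_groupI)
    fix x assume x: "x \<in> carrier (prod_module M N)"
    show "\<exists>y\<in>carrier (prod_module M N). y \<oplus>\<^bsub>prod_module M N\<^esub> x = \<zero>\<^bsub>prod_module M N\<^esub>"
      using x by (intro bexI[of _ "(\<ominus>\<^bsub>M\<^esub> fst x, \<ominus>\<^bsub>N\<^esub> snd x)"]) (auto simp: M.l_neg N.l_neg)
  qed (auto simp: M.a_ac N.a_ac)
  thus ?thesis
    by (rule moduleI[OF M.is_cring])
       (auto simp: M.smult_l_distr N.smult_l_distr M.smult_r_distr N.smult_r_distr M.smult_assoc1 N.smult_assoc1)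
qed

lemma prod_module_homs:
  assumes "module R M" "module R N"
  shows "fst \<in> module_hom R (prod_module M N) M" "snd \<in> module_hom R (prod_module M N) N"
    "(\<lambda>x. (x, \<zero>\<^bsub>N\<^esub>)) \<in> module_hom R M (prod_module M N)"
    "(\<lambda>y. (\<zero>\<^bsub>M\<^esub>, y)) \<in> module_hom R N (prod_module M N)"
proof -
  interpret M: module R M by fact
  interpret N: module R N by fact
  show "fst \<in> module_hom R (prod_module M N) M" "snd \<in> module_hom R (prod_module M N) N"
    "(\<lambda>x. (x, \<zero>\<^bsub>N\<^esub>)) \<in> module_hom R M (prod_module M N)"
    "(\<lambda>y. (\<zero>\<^bsub>M\<^esub>, y)) \<in> module_hom R N (prod_module M N)"
    by (auto intro!: homI)
qed

lemma hom_pair: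
  assumes "f \<in> module_hom R M N" "g \<in> module_hom R M N'"
  shows "(\<lambda>x. (f x, g x)) \<in> module_hom R M (prod_module N N')"
  using homD[OF assms(1)] homD[OF assms(2)] by (intro homI) auto

lemma power_module_module:
  assumes "module R M"
  shows "module R (power_module J M)"
proof -
  interpret M: module R M by fact
  have "abelian_group (power_module J M)"
  proof (rule abelian_groupI)
    fix x assume x: "x \<in> carrier (power_module J M)"
    show "\<exists>y\<in>carrier (power_module J M). y \<oplus>\<^bsub>power_module J M\<^esub> x = \<zero>\<^bsub>power_module J M\<^esub>"
      using x by (intro bexI[of _ "\<lambda>j\<in>J. \<ominus>\<^bsub>M\<^esub> x j"]) (auto simp: power_module_simps M.l_neg PiE_iff intro!: restrict_ext)
    show "\<zero>\<^bsub>power_module J M\<^esub> \<oplus>\<^bsub>power_module J M\<^esub> x = x"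
      using x by (auto simp: power_module_simps PiE_iff extensional_def fun_eq_iff)
  qed (auto simp: power_module_simps PiE_iff M.a_ac intro!: restrict_ext)
  thus ?thesis
    by (rule moduleI[OF M.is_cring])
       (auto simp: power_module_simps PiE_iff M.smult_l_distr M.smult_r_distr M.smult_assoc1
         fun_eq_iff extensional_def)
qed

lemma power_module_homs:
  assumes "module R M" "j \<in> J"
  shows "(\<lambda>x. x j) \<in> module_hom R (power_module J M) M"
    "(\<lambda>x. \<lambda>k\<in>J. if k = j then x else \<zero>\<^bsub>M\<^esub>) \<in> module_hom R M (power_module J M)"
proof -
  interpret M: module R M by fact
  show "(\<lambda>x. x j) \<in> module_hom R (power_module J M) M"
    using assms(2) by (auto intro!: homI simp: power_module_simps)
  show "(\<lambda>x. \<lambda>k\<in>J. if k = j then x else \<zero>\<^bsub>M\<^esub>) \<in> module_hom R M (power_module J M)"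
    by (intro homI) (auto simp: power_module_simps intro!: restrict_ext)
qed

lemma power_module_sum:
  assumes "module R M" "finite J" "x \<in> carrier (power_module J M)"
  shows "(\<Oplus>\<^bsub>power_module J M\<^esub>j\<in>J. (\<lambda>k\<in>J. if k = j then x j else \<zero>\<^bsub>M\<^esub>)) = x"
proof -
  interpret M: module R M by fact
  note pm = power_module_module[OF assms(1), of J]
  interpret P: module R "power_module J M" by (rule pm)
  let ?g = "\<lambda>j. \<lambda>k\<in>J. if k = j then x j else \<zero>\<^bsub>M\<^esub>"
  have g: "?g \<in> J \<rightarrow> carrier (power_module J M)" using assms(3) by (auto simp: power_module_simps)
  have xj: "x \<in> J \<rightarrow> carrier M" using assms(3) by (auto simp: power_module_simps)
  have "(\<Oplus>\<^bsub>power_module J M\<^esub>j\<in>J. ?g j) \<in> carrier (power_module J M)"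
    using g by (rule P.finsum_closed)
  moreover have "(\<Oplus>\<^bsub>power_module J M\<^esub>j\<in>J. ?g j) k = x k" if "k \<in> J" for k
  proof -
    have "(\<Oplus>\<^bsub>power_module J M\<^esub>j\<in>J. ?g j) k = (\<Oplus>\<^bsub>M\<^esub>j\<in>J. ?g j k)"
      by (rule hom_finsum[OF pm assms(1) power_module_homs(1)[OF assms(1) that] g])
    also have "\<dots> = (\<Oplus>\<^bsub>M\<^esub>j\<in>J. if k = j then x j else \<zero>\<^bsub>M\<^esub>)"
      using xj that by (intro M.M.add.finprod_cong') auto
    also have "\<dots> = x k" using M.finsum_singleton[OF that assms(2) xj] .
    finally show ?thesis .
  qed
  ultimately show ?thesis using assms(3) unfolding power_module_simps by (intro PiE_ext)
qed

section \<open>Free modules of finite rank\<close>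

lemma ring_as_module_simps:
  "carrier (ring_as_module R) = carrier R" "\<zero>\<^bsub>ring_as_module R\<^esub> = \<zero>\<^bsub>R\<^esub>"
  "x \<oplus>\<^bsub>ring_as_module R\<^esub> y = x \<oplus>\<^bsub>R\<^esub> y" "r \<odot>\<^bsub>ring_as_module R\<^esub> x = r \<otimes>\<^bsub>R\<^esub> x"
  by (simp_all add: ring_as_module_def)

lemma ring_as_module_module:
  assumes "cring R"
  shows "module R (ring_as_module R)"
proof -
  interpret cring R by fact
  have "abelian_group (ring_as_module R)"
  proof (rule abelian_groupI)
    fix x assume x: "x \<in> carrier (ring_as_module R)"
    show "\<exists>y\<in>carrier (ring_as_module R). y \<oplus>\<^bsub>ring_as_module R\<^esub> x = \<zero>\<^bsub>ring_as_module R\<^esub>"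
      using x by (intro bexI[of _ "\<ominus>\<^bsub>R\<^esub> x"]) (auto simp: ring_as_module_simps l_neg)
  qed (auto simp: ring_as_module_simps a_ac)
  thus ?thesis
    by (rule moduleI[OF is_cring]) (auto simp: ring_as_module_simps l_distr r_distr m_assoc)
qed

definition free_module :: "('a, 'r) ring_scheme \<Rightarrow> 'i set \<Rightarrow> ('a, 'i \<Rightarrow> 'a) module"
  where "free_module R J = power_module J (ring_as_module R)"

definition unit_vec :: "('a, 'r) ring_scheme \<Rightarrow> 'i set \<Rightarrow> 'i \<Rightarrow> 'i \<Rightarrow> 'a"
  where "unit_vec R J i = (\<lambda>j\<in>J. if i = j then \<one>\<^bsub>R\<^esub> else \<zero>\<^bsub>R\<^esub>)"

definition lincomb :: "('a, 'm) module \<Rightarrow> 'i set \<Rightarrow> ('i \<Rightarrow> 'm) \<Rightarrow> ('i \<Rightarrow> 'a) \<Rightarrow> 'm"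
  where "lincomb M J h x = (\<Oplus>\<^bsub>M\<^esub>j\<in>J. x j \<odot>\<^bsub>M\<^esub> h j)"

lemma free_module_simps:
  "carrier (free_module R J) = J \<rightarrow>\<^sub>E carrier R" "\<zero>\<^bsub>free_module R J\<^esub> = (\<lambda>j\<in>J. \<zero>\<^bsub>R\<^esub>)"
  "x \<oplus>\<^bsub>free_module R J\<^esub> y = (\<lambda>j\<in>J. x j \<oplus>\<^bsub>R\<^esub> y j)" "r \<odot>\<^bsub>free_module R J\<^esub> x = (\<lambda>j\<in>J. r \<otimes>\<^bsub>R\<^esub> x j)"
  by (simp_all add: free_module_def power_module_simps ring_as_module_simps)

lemma free_module_module: "cring R \<Longrightarrow> module R (free_module R J)"
  unfolding free_module_def by (rule power_module_module[OF ring_as_module_module])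

lemma unit_vec_carrier: "cring R \<Longrightarrow> unit_vec R J i \<in> carrier (free_module R J)"
proof -
  assume "cring R"
  then interpret cring R .
  show ?thesis by (auto simp: unit_vec_def free_module_simps)
qed

lemma lincomb_hom:
  assumes M: "module R M" and J: "finite J" and h: "\<And>j. j \<in> J \<Longrightarrow> h j \<in> carrier M"
  shows "lincomb M J h \<in> module_hom R (free_module R J) M"
proof (rule homI)
  interpret M: module R M by fact
  fix x assume "x \<in> carrier (free_module R J)"
  hence x: "\<And>j. j \<in> J \<Longrightarrow> x j \<in> carrier R" by (auto simp: free_module_simps)
  show "lincomb M J h x \<in> carrier M"
    unfolding lincomb_def using x h by (intro M.finsum_closed) auto
  fix r assume r: "r \<in> carrier R"
  have "lincomb M J h (r \<odot>\<^bsub>free_module R J\<^esub> x) = (\<Oplus>\<^bsub>M\<^esub>j\<in>J. r \<odot>\<^bsub>M\<^esub> (x j \<odot>\<^bsub>M\<^esub> h j))"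
    unfolding lincomb_def using x h r
    by (intro M.M.add.finprod_cong') (auto simp: free_module_simps M.smult_assoc1)
  also have "\<dots> = r \<odot>\<^bsub>M\<^esub> lincomb M J h x"
    unfolding lincomb_def using x h r J by (intro M.finsum_smult_ldistr[symmetric]) auto
  finally show "lincomb M J h (r \<odot>\<^bsub>free_module R J\<^esub> x) = r \<odot>\<^bsub>M\<^esub> lincomb M J h x" .
next
  interpret M: module R M by fact
  fix x y assume "x \<in> carrier (free_module R J)" "y \<in> carrier (free_module R J)"
  hence xy: "\<And>j. j \<in> J \<Longrightarrow> x j \<in> carrier R" "\<And>j. j \<in> J \<Longrightarrow> y j \<in> carrier R"
    by (auto simp: free_module_simps)
  have "lincomb M J h (x \<oplus>\<^bsub>free_module R J\<^esub> y) = (\<Oplus>\<^bsub>M\<^esub>j\<in>J. x j \<odot>\<^bsub>M\<^esub> h j \<oplus>\<^bsub>M\<^esub> y j \<odot>\<^bsub>M\<^esub> h j)"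
    unfolding lincomb_def using xy h
    by (intro M.M.add.finprod_cong') (auto simp: free_module_simps M.smult_l_distr)
  also have "\<dots> = lincomb M J h x \<oplus>\<^bsub>M\<^esub> lincomb M J h y"
    unfolding lincomb_def using xy h by (intro M.finsum_addf) auto
  finally show "lincomb M J h (x \<oplus>\<^bsub>free_module R J\<^esub> y) = lincomb M J h x \<oplus>\<^bsub>M\<^esub> lincomb M J h y" .
qed

lemma lincomb_cong:
  assumes M: "module R M" and "\<And>j. j \<in> J \<Longrightarrow> g j \<in> carrier M" "x \<in> J \<rightarrow> carrier R"
    "\<And>j. j \<in> J \<Longrightarrow> h j = g j" "\<And>j. j \<in> J \<Longrightarrow> y j = x j"
  shows "lincomb M J h y = lincomb M J g x"
proof -
  interpret M: module R M by fact
  show ?thesis unfolding lincomb_def using assms(2-) by (intro M.M.add.finprod_cong') auto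
qed

lemma lincomb_unit_vec:
  assumes M: "module R M" and J: "finite J" and h: "\<And>j. j \<in> J \<Longrightarrow> h j \<in> carrier M" and i: "i \<in> J"
  shows "lincomb M J h (unit_vec R J i) = h i"
proof -
  interpret M: module R M by fact
  have "lincomb M J h (unit_vec R J i) = (\<Oplus>\<^bsub>M\<^esub>j\<in>J. if i = j then h j else \<zero>\<^bsub>M\<^esub>)"
    unfolding lincomb_def using h by (intro M.M.add.finprod_cong') (auto simp: unit_vec_def)
  thus ?thesis using M.finsum_singleton[OF i J, of h] h by auto
qed

text \<open>Homomorphisms out of a finite free module are compared on unit vectors by means of this formula.\<close>

lemma hom_free_module_eq_lincomb:
  assumes X: "module R X" and J: "finite J" and f: "f \<in> module_hom R (free_module R J) X"
    and x: "x \<in> carrier (free_module R J)"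
  shows "f x = lincomb X J (\<lambda>j. f (unit_vec R J j)) x"
proof -
  interpret X: module R X by fact
  let ?F = "free_module R J"
  have F: "module R ?F" by (rule free_module_module[OF X.is_cring])
  interpret F: module R ?F by (rule F)
  note u = unit_vec_carrier[OF X.is_cring, of J]
  have xR: "\<And>j. j \<in> J \<Longrightarrow> x j \<in> carrier R" using x by (auto simp: free_module_simps)
  have "(\<Oplus>\<^bsub>?F\<^esub>j\<in>J. x j \<odot>\<^bsub>?F\<^esub> unit_vec R J j) = (\<Oplus>\<^bsub>?F\<^esub>j\<in>J. (\<lambda>k\<in>J. if k = j then x j else \<zero>\<^bsub>R\<^esub>))"
    using xR by (intro F.M.add.finprod_cong') (auto simp: unit_vec_def free_module_simps intro!: restrict_ext)
  also have "\<dots> = x"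
    using power_module_sum[OF ring_as_module_module[OF X.is_cring] J, unfolded ring_as_module_simps] x
    by (simp add: free_module_def)
  finally have "f x = f (\<Oplus>\<^bsub>?F\<^esub>j\<in>J. x j \<odot>\<^bsub>?F\<^esub> unit_vec R J j)" by simp
  also have "\<dots> = (\<Oplus>\<^bsub>X\<^esub>j\<in>J. f (x j \<odot>\<^bsub>?F\<^esub> unit_vec R J j))"
    using xR u by (intro hom_finsum[OF F X f]) auto
  also have "\<dots> = lincomb X J (\<lambda>j. f (unit_vec R J j)) x"
    unfolding lincomb_def using xR u homD[OF f] by (intro X.M.add.finprod_cong') auto
  finally show ?thesis .
qed

lemma inverse_hom:
  assumes M: "module R M" and \<theta>: "\<theta> \<in> module_hom R M N" "bij_betw \<theta> (carrier M) (carrier N)"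
  obtains \<rho> where "\<rho> \<in> module_hom R N M" "\<And>x. x \<in> carrier M \<Longrightarrow> \<rho> (\<theta> x) = x"
    "\<And>y. y \<in> carrier N \<Longrightarrow> \<theta> (\<rho> y) = y"
proof -
  interpret M: module R M by fact
  let ?\<rho> = "the_inv_into (carrier M) \<theta>"
  have inj: "inj_on \<theta> (carrier M)" and im: "\<theta> ` carrier M = carrier N"
    using \<theta>(2) by (auto simp: bij_betw_def)
  have 1: "?\<rho> (\<theta> x) = x" if "x \<in> carrier M" for x by (rule the_inv_into_f_f[OF inj that])
  have 2: "\<theta> (?\<rho> y) = y" "?\<rho> y \<in> carrier M" if "y \<in> carrier N" for y
    using f_the_inv_into_f[OF inj] the_inv_into_into[OF inj _ subset_refl] that im by auto
  have "?\<rho> \<in> module_hom R N M"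
  proof (rule homI)
    fix y assume y: "y \<in> carrier N"
    show "?\<rho> y \<in> carrier M" by (rule 2[OF y])
    show "?\<rho> (y \<oplus>\<^bsub>N\<^esub> z) = ?\<rho> y \<oplus>\<^bsub>M\<^esub> ?\<rho> z" if "z \<in> carrier N" for z
      using 1[of "?\<rho> y \<oplus>\<^bsub>M\<^esub> ?\<rho> z"] 2[OF y] 2[OF that] homD(2)[OF \<theta>(1)] by simp
    show "?\<rho> (r \<odot>\<^bsub>N\<^esub> y) = r \<odot>\<^bsub>M\<^esub> ?\<rho> y" if "r \<in> carrier R" for r
      using 1[of "r \<odot>\<^bsub>M\<^esub> ?\<rho> y"] 2[OF y] homD(3)[OF \<theta>(1)] that by simp
  qed
  thus thesis using 1 2(1) by (rule that)
qed

text \<open>Unique coordinates with respect to a basis mean that forming linear combinations is bijective.\<close>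

lemma free_iso_free_module:
  assumes F: "module R F" "free_of_finite_rank R F"
  obtains B \<theta> where "finite B" "B \<subseteq> carrier F" "\<theta> \<in> module_hom R (free_module R B) F"
    "bij_betw \<theta> (carrier (free_module R B)) (carrier F)"
proof -
  from F(2) obtain B where B: "finite B \<and> B \<subseteq> carrier F \<and>
      (\<forall>x\<in>carrier F. \<exists>!c. c \<in> B \<rightarrow>\<^sub>E carrier R \<and> x = (\<Oplus>\<^bsub>F\<^esub>b\<in>B. c b \<odot>\<^bsub>F\<^esub> b))"
    unfolding free_of_finite_rank_def ..
  define \<theta> where "\<theta> = lincomb F B (\<lambda>b. b)"
  have ex: "\<exists>!c. c \<in> carrier (free_module R B) \<and> x = \<theta> c" if "x \<in> carrier F" for x
    using B that unfolding free_module_simps \<theta>_def lincomb_def by (elim conjE) (erule bspec)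
  have \<theta>: "\<theta> \<in> module_hom R (free_module R B) F"
    unfolding \<theta>_def using B by (intro lincomb_hom[OF F(1)]) auto
  have "inj_on \<theta> (carrier (free_module R B))"
    using ex homD(1)[OF \<theta>] by (intro inj_onI) metis
  moreover have "\<theta> ` carrier (free_module R B) = carrier F"
    using ex homD(1)[OF \<theta>] by blast
  ultimately have "bij_betw \<theta> (carrier (free_module R B)) (carrier F)" by (simp add: bij_betw_def)
  thus thesis using B \<theta> by (intro that[of B \<theta>]) auto
qed

text \<open>Projectivity, for lifts with values in a submodule \<open>Y\<close>: the images of basis elements are lifted one
  by one. The choice \<open>Y = \<mm>\<^sup>k H\<close> keeps track of the \<open>\<mm>\<close>-adic size of a lift.\<close>

lemma free_lift:
  assumes F: "module R F" "free_of_finite_rank R F" and H: "module R H" and X: "module R X"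
    and \<beta>: "\<beta> \<in> module_hom R F X" and \<pi>: "\<pi> \<in> module_hom R H X"
    and Y: "submodule Y R H" and sub: "\<And>x. x \<in> carrier F \<Longrightarrow> \<beta> x \<in> \<pi> ` Y"
  shows "\<exists>\<gamma>\<in>module_hom R F H. (\<forall>x\<in>carrier F. \<gamma> x \<in> Y \<and> \<pi> (\<gamma> x) = \<beta> x)"
proof -
  interpret H: module R H by fact
  obtain B \<theta> where B: "finite B" "B \<subseteq> carrier F" and \<theta>: "\<theta> \<in> module_hom R (free_module R B) F"
    "bij_betw \<theta> (carrier (free_module R B)) (carrier F)"
    by (rule free_iso_free_module[OF F]) (rule that)
  note B = B(1)
  note P = free_module_module[OF H.is_cring, of B] and u = unit_vec_carrier[OF H.is_cring, of B]
  obtain \<rho> where \<rho>: "\<rho> \<in> module_hom R F (free_module R B)" "\<And>x. x \<in> carrier F \<Longrightarrow> \<theta> (\<rho> x) = x"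
    using inverse_hom[OF P \<theta>] by metis
  have "\<exists>y\<in>Y. \<pi> y = \<beta> (\<theta> (unit_vec R B b))" for b
    using sub[OF homD(1)[OF \<theta>(1) u]] by (metis imageE)
  then obtain y where y: "\<And>b. y b \<in> Y" "\<And>b. \<pi> (y b) = \<beta> (\<theta> (unit_vec R B b))" by metis
  have yH: "y b \<in> carrier H" for b using submoduleD(7)[OF H Y] y by auto
  define \<gamma> where "\<gamma> = lincomb H B y"
  have \<gamma>: "\<gamma> \<in> module_hom R (free_module R B) H" unfolding \<gamma>_def by (rule lincomb_hom[OF H B yH])
  have "\<gamma> c \<in> Y" if "c \<in> carrier (free_module R B)" for c
    unfolding \<gamma>_def lincomb_def using that y submoduleD(4)[OF H Y]
    by (intro submodule_finsum[OF H Y] Pi_I) (metis PiE_mem free_module_simps(1))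
  moreover have "\<pi> (\<gamma> c) = \<beta> (\<theta> c)" if c: "c \<in> carrier (free_module R B)" for c
  proof -
    have "\<pi> (\<gamma> (unit_vec R B b)) = \<beta> (\<theta> (unit_vec R B b))" if "b \<in> B" for b
      unfolding \<gamma>_def using lincomb_unit_vec[OF H B yH that] y by simp
    hence "lincomb X B (\<lambda>b. \<pi> (\<gamma> (unit_vec R B b))) c = lincomb X B (\<lambda>b. \<beta> (\<theta> (unit_vec R B b))) c"
      using c homD(1)[OF \<beta> homD(1)[OF \<theta>(1) u]] by (intro lincomb_cong[OF X]) (auto simp: free_module_simps)
    thus ?thesis
      using hom_free_module_eq_lincomb[OF X B hom_compose[OF \<gamma> \<pi>] c]
        hom_free_module_eq_lincomb[OF X B hom_compose[OF \<theta>(1) \<beta>] c] by simp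
  qed
  ultimately show ?thesis
    using hom_compose[OF \<rho>(1) \<gamma>] homD(1)[OF \<rho>(1)] \<rho>(2) by (intro bexI[of _ "\<lambda>x. \<gamma> (\<rho> x)"]) auto
qed

section \<open>The maximal ideal and the submodules \<open>\<mm>\<^sup>q M\<close>\<close>

definition mpow :: "('a, 'r) ring_scheme \<Rightarrow> nat \<Rightarrow> ('a, 'm) module \<Rightarrow> 'm set"
  where "mpow R q M = ideal_smult (max_ideal R [^]\<^bsub>ideals_set R\<^esub> q) M"

lemma ideal_smult_submodule:
  assumes "module R M" "ideal I R"
  shows "submodule (ideal_smult I M) R M"
proof -
  interpret M: module R M by fact
  interpret I: ideal I R by fact
  have sub: "x \<in> carrier M" if "x \<in> ideal_smult I M" for x
    using that by induct (auto intro: I.a_Hcarr)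
  show ?thesis
  proof (rule submodule_closedI[OF assms(1)])
    show "\<zero>\<^bsub>M\<^esub> \<in> ideal_smult I M"
      using ideal_smult.smult[of "\<zero>\<^bsub>R\<^esub>" I "\<zero>\<^bsub>M\<^esub>" M] by simp
    show "r \<odot>\<^bsub>M\<^esub> x \<in> ideal_smult I M" if "r \<in> carrier R" "x \<in> ideal_smult I M" for r x
      using that(2)
    proof induct
      case (smult a x)
      have "r \<odot>\<^bsub>M\<^esub> (a \<odot>\<^bsub>M\<^esub> x) = (r \<otimes>\<^bsub>R\<^esub> a) \<odot>\<^bsub>M\<^esub> x"
        using smult that by (simp add: M.smult_assoc1 I.a_Hcarr)
      thus ?case using smult that by (auto intro: ideal_smult.smult I.I_l_closed)
    next
      case (sum x y)
      thus ?case using sub that by (simp add: M.smult_r_distr ideal_smult.sum)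
    qed
  qed (auto intro: sub ideal_smult.sum)
qed

lemma ideal_smult_carrier:
  assumes "module R M"
  shows "ideal_smult (carrier R) M = carrier M"
proof -
  interpret M: module R M by fact
  have "x \<in> ideal_smult (carrier R) M" if "x \<in> carrier M" for x
    using ideal_smult.smult[of "\<one>\<^bsub>R\<^esub>" "carrier R" x M] that by simp
  moreover have "x \<in> carrier M" if "x \<in> ideal_smult (carrier R) M" for x
    using that by induct auto
  ultimately show ?thesis by auto
qed

context noetherian_local_ring
begin

abbreviation \<mm> :: "'a set" where "\<mm> \<equiv> max_ideal R"

lemma max_ideal_maximal: "maximalideal \<mm> R"
  unfolding max_ideal_def using theI'[OF unique_maximalideal] .

lemma max_ideal_unique: "maximalideal I R \<Longrightarrow> I = \<mm>"
  using unique_maximalideal max_ideal_maximal by auto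

lemma max_ideal_ideal: "ideal \<mm> R"
  using max_ideal_maximal by (rule maximalideal.axioms)

lemma max_ideal_carrier: "a \<in> \<mm> \<Longrightarrow> a \<in> carrier R"
  using max_ideal_ideal by (rule ideal.Icarr)

lemma max_ideal_power_ideal: "ideal (\<mm> [^]\<^bsub>ideals_set R\<^esub> (q::nat)) R"
proof -
  interpret I: comm_monoid "ideals_set R" by (rule ideals_set_is_comm_monoid)
  have "\<mm> [^]\<^bsub>ideals_set R\<^esub> q \<in> carrier (ideals_set R)"
    using max_ideal_ideal by (intro I.nat_pow_closed) (simp add: ideals_set_def)
  thus ?thesis by (simp add: ideals_set_def)
qed

lemma mpow_submodule: "module R M \<Longrightarrow> submodule (mpow R q M) R M"
  unfolding mpow_def by (rule ideal_smult_submodule[OF _ max_ideal_power_ideal])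

lemma mpowD:
  assumes M: "module R M"
  shows "mpow R q M \<subseteq> carrier M" "\<zero>\<^bsub>M\<^esub> \<in> mpow R q M"
    "\<And>x. x \<in> mpow R q M \<Longrightarrow> \<ominus>\<^bsub>M\<^esub> x \<in> mpow R q M"
    "\<And>r x. r \<in> carrier R \<Longrightarrow> x \<in> mpow R q M \<Longrightarrow> r \<odot>\<^bsub>M\<^esub> x \<in> mpow R q M"
    "\<And>x y. x \<in> mpow R q M \<Longrightarrow> y \<in> mpow R q M \<Longrightarrow> x \<oplus>\<^bsub>M\<^esub> y \<in> mpow R q M"
    "\<And>x y. x \<in> mpow R q M \<Longrightarrow> y \<in> mpow R q M \<Longrightarrow> x \<ominus>\<^bsub>M\<^esub> y \<in> mpow R q M"
    "\<And>x. x \<in> mpow R q M \<Longrightarrow> x \<in> carrier M"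
  using submoduleD[OF M mpow_submodule[OF M]] by auto

lemma mpow_0: "module R M \<Longrightarrow> mpow R 0 M = carrier M"
  by (simp add: mpow_def ideals_set_def ideal_smult_carrier)

lemma max_ideal_power_Suc:
  "\<mm> [^]\<^bsub>ideals_set R\<^esub> Suc q = (\<mm> [^]\<^bsub>ideals_set R\<^esub> q) \<cdot>\<^bsub>R\<^esub> \<mm>"
  by (simp add: ideals_set_def)

lemma mpow_1: "mpow R (Suc 0) M = ideal_smult \<mm> M"
proof -
  interpret I: comm_monoid "ideals_set R" by (rule ideals_set_is_comm_monoid)
  have "\<mm> [^]\<^bsub>ideals_set R\<^esub> Suc 0 = \<mm>"
    using I.nat_pow_Suc[of \<mm> 0] I.l_one[of \<mm>] max_ideal_ideal by (simp add: ideals_set_def)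
  thus ?thesis by (simp add: mpow_def)
qed

lemma mpow_SucI:
  assumes M: "module R M" and a: "a \<in> \<mm>" and x: "x \<in> mpow R q M"
  shows "a \<odot>\<^bsub>M\<^esub> x \<in> mpow R (Suc q) M"
  using x unfolding mpow_def
proof induct
  interpret M: module R M by fact
  case (smult b y)
  have b: "b \<in> carrier R" using ideal.Icarr[OF max_ideal_power_ideal smult(1)] .
  have "a \<odot>\<^bsub>M\<^esub> (b \<odot>\<^bsub>M\<^esub> y) = (b \<otimes> a) \<odot>\<^bsub>M\<^esub> y"
    using b max_ideal_carrier[OF a] smult by (simp add: M.smult_assoc1[symmetric] m_comm)
  moreover have "b \<otimes> a \<in> \<mm> [^]\<^bsub>ideals_set R\<^esub> Suc q"
    unfolding max_ideal_power_Suc using smult a by (intro ideal_prod.prod)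
  ultimately show ?case using smult by (metis ideal_smult.smult)
next
  interpret M: module R M by fact
  case (sum y z)
  hence "y \<in> carrier M" "z \<in> carrier M"
    using mpowD(7)[OF M, of _ q] unfolding mpow_def by auto
  thus ?case using sum max_ideal_carrier[OF a] by (simp add: M.smult_r_distr ideal_smult.sum)
qed

text \<open>This least-set property is the form in which most inclusions between these submodules are
  proved: it expresses \<open>\<mm>\<^sup>q\<^sup>+\<^sup>1 M = \<mm> (\<mm>\<^sup>q M)\<close> without mentioning products of ideals.\<close>

lemma mpow_Suc_subset:
  assumes M: "module R M" and H: "\<And>x y. x \<in> H \<Longrightarrow> y \<in> H \<Longrightarrow> x \<oplus>\<^bsub>M\<^esub> y \<in> H"
    and a: "\<And>a x. a \<in> \<mm> \<Longrightarrow> x \<in> mpow R q M \<Longrightarrow> a \<odot>\<^bsub>M\<^esub> x \<in> H"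
  shows "mpow R (Suc q) M \<subseteq> H"
proof
  interpret M: module R M by fact
  have *: "c \<odot>\<^bsub>M\<^esub> y \<in> H" if "c \<in> \<mm> [^]\<^bsub>ideals_set R\<^esub> Suc q" "y \<in> carrier M" for c y
    using that(1) unfolding max_ideal_power_Suc
  proof (induct rule: ideal_prod.induct)
    case (prod i j)
    have "i \<in> carrier R" using ideal.Icarr[OF max_ideal_power_ideal prod(1)] .
    hence "(i \<otimes> j) \<odot>\<^bsub>M\<^esub> y = j \<odot>\<^bsub>M\<^esub> (i \<odot>\<^bsub>M\<^esub> y)"
      using prod that max_ideal_carrier by (simp add: M.smult_assoc1[symmetric] m_comm)
    moreover have "i \<odot>\<^bsub>M\<^esub> y \<in> mpow R q M"
      unfolding mpow_def using prod that by (intro ideal_smult.smult)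
    ultimately show ?case using a prod by simp
  next
    case (sum s t)
    have "s \<in> carrier R" "t \<in> carrier R"
      using sum ideal.Icarr[OF max_ideal_power_ideal[of "Suc q"]] unfolding max_ideal_power_Suc by auto
    thus ?case using sum H that by (simp add: M.smult_l_distr)
  qed
  show "x \<in> H" if "x \<in> mpow R (Suc q) M" for x
    using that unfolding mpow_def by induct (auto intro: * H)
qed

text \<open>The case \<open>k = 0\<close> is naturality; the case \<open>k = 1\<close> applies to differentials of minimal complexes and to
  maps between them that vanish modulo \<open>\<mm>\<close>.\<close>

lemma mpow_hom:
  assumes M: "module R M" and N: "module R N" and f: "f \<in> module_hom R M N"
    and k: "\<And>x. x \<in> carrier M \<Longrightarrow> f x \<in> mpow R k N" and x: "x \<in> mpow R q M"
  shows "f x \<in> mpow R (q + k) N"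
  using x
proof (induction q arbitrary: x)
  case 0 thus ?case using k by (simp add: mpow_0[OF M])
next
  case (Suc q)
  note h = homD[OF f]
  have "mpow R (Suc q) M \<subseteq> {x \<in> carrier M. f x \<in> mpow R (Suc q + k) N}"
  proof (rule mpow_Suc_subset[OF M], goal_cases)
    case (1 x y)
    interpret M: module R M by fact
    from 1 show ?case using mpowD(5)[OF N, of "f x" "Suc q + k" "f y"] h by auto
  next
    case (2 a x)
    interpret M: module R M by fact
    have "x \<in> carrier M" using 2 mpowD(7)[OF M] by auto
    moreover from this have "f (a \<odot>\<^bsub>M\<^esub> x) = a \<odot>\<^bsub>N\<^esub> f x" using h 2 max_ideal_carrier by auto
    ultimately show ?case using Suc.IH[OF 2(2)] mpow_SucI[OF N 2(1)] max_ideal_carrier[OF 2(1)] by auto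
  qed
  thus ?case using Suc.prems by blast
qed

lemma mpow_hom_0:
  assumes M: "module R M" and N: "module R N" and f: "f \<in> module_hom R M N"
    and x: "x \<in> mpow R q M"
  shows "f x \<in> mpow R q N"
  using mpow_hom[OF M N f, of 0 x q] x homD[OF f] by (simp add: mpow_0[OF N])

lemma mpow_Suc_antimono: "module R M \<Longrightarrow> mpow R (Suc q) M \<subseteq> mpow R q M"
  by (rule mpow_Suc_subset) (auto intro: mpowD max_ideal_carrier)

lemma mpow_antimono: "module R M \<Longrightarrow> p \<le> q \<Longrightarrow> mpow R q M \<subseteq> mpow R p M"
  by (rule lift_Suc_antimono_le[of "\<lambda>q. mpow R q M"]) (auto simp: mpow_Suc_antimono[THEN subsetD])

lemma mpow_surj:
  assumes M: "module R M" and N: "module R N" and f: "f \<in> module_hom R M N"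
    and surj: "f ` carrier M = carrier N"
  shows "f ` mpow R q M = mpow R q N"
proof
  show "f ` mpow R q M \<subseteq> mpow R q N" using mpow_hom_0[OF M N f] by auto
  show "mpow R q N \<subseteq> f ` mpow R q M"
  proof (induction q)
    case 0 thus ?case using surj by (simp add: mpow_0 M N)
  next
    case (Suc q)
    note im = submodule_image[OF M N f mpow_submodule[OF M, of "Suc q"]]
    show ?case
    proof (rule mpow_Suc_subset[OF N])
      show "x \<oplus>\<^bsub>N\<^esub> y \<in> f ` mpow R (Suc q) M"
        if "x \<in> f ` mpow R (Suc q) M" "y \<in> f ` mpow R (Suc q) M" for x y
        using submoduleD(5)[OF N im that] .
      fix a y assume a: "a \<in> \<mm>" "y \<in> mpow R q N"
      then obtain x where x: "x \<in> mpow R q M" "y = f x" using Suc by auto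
      have "a \<odot>\<^bsub>N\<^esub> y = f (a \<odot>\<^bsub>M\<^esub> x)"
        using homD(3)[OF f, of a x] mpowD(7)[OF M x(1)] max_ideal_carrier[OF a(1)] x by simp
      thus "a \<odot>\<^bsub>N\<^esub> y \<in> f ` mpow R (Suc q) M" using mpow_SucI[OF M a(1) x(1)] by auto
    qed
  qed
qed

text \<open>By noetherianity a chain of ideals contains its union, so that Zorn's lemma gives a maximal
  ideal above \<open>I\<close>; it can only be \<open>\<mm>\<close>.\<close>

lemma proper_ideal_subset:
  assumes I: "ideal I R" "I \<noteq> carrier R"
  shows "I \<subseteq> \<mm>"
proof -
  define A where "A = {J. ideal J R \<and> I \<subseteq> J \<and> J \<noteq> carrier R}"
  have "\<exists>J\<in>A. \<forall>K\<in>A. J \<subseteq> K \<longrightarrow> K = J"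
  proof (rule subset_Zorn)
    fix C assume C: "subset.chain A C"
    show "\<exists>U\<in>A. \<forall>X\<in>C. X \<subseteq> U"
    proof (cases "C = {}")
      case True thus ?thesis using I by (auto simp: A_def)
    next
      case False
      have "subset.chain {I. ideal I R} C" using C by (auto simp: subset.chain_def A_def)
      hence "\<Union>C \<in> C" by (rule ideal_chain_is_trivial[OF False])
      thus ?thesis using C by (auto simp: subset.chain_def)
    qed
  qed
  then obtain J where J: "J \<in> A" "\<And>K. K \<in> A \<Longrightarrow> J \<subseteq> K \<Longrightarrow> K = J" by blast
  have "maximalideal J R"
  proof (rule maximalidealI)
    show "ideal J R" using J by (auto simp: A_def)
    show "carrier R \<noteq> J" using J by (auto simp: A_def)
    fix K assume "ideal K R" "J \<subseteq> K" "K \<subseteq> carrier R"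
    thus "K = J \<or> K = carrier R" using J(1) J(2)[of K] unfolding A_def by blast
  qed
  thus ?thesis using max_ideal_unique J by (auto simp: A_def)
qed

lemma Units_outside_max_ideal:
  assumes "a \<in> carrier R" "a \<notin> \<mm>"
  shows "a \<in> Units R"
proof -
  have "PIdl a = carrier R"
    using proper_ideal_subset[OF cgenideal_ideal[OF assms(1)]] cgenideal_self[OF assms(1)] assms(2) by auto
  hence "\<one> \<in> PIdl a" by simp
  then obtain x where "x \<in> carrier R" "\<one> = x \<otimes> a" unfolding cgenideal_def by auto
  thus ?thesis using assms(1) unfolding Units_def by (auto simp: m_comm) (metis m_comm)
qed

end

section \<open>Minimal free resolutions and comparison maps\<close>

context noetherian_local_ring
begin

lemma minimal_free_resolutionD:
  assumes "minimal_free_resolution R M F d \<epsilon>" and M: "module R M"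
  shows "\<And>i. module R (F i)" "\<And>i. free_of_finite_rank R (F i)"
    "\<And>i. d (Suc i) \<in> module_hom R (F (Suc i)) (F i)"
    "\<epsilon> \<in> module_hom R (F 0) M" "\<epsilon> ` carrier (F 0) = carrier M"
    "\<And>x. x \<in> carrier (F 0) \<Longrightarrow> \<epsilon> x = \<zero>\<^bsub>M\<^esub> \<Longrightarrow> x \<in> d (Suc 0) ` carrier (F (Suc 0))"
    "\<And>x. x \<in> carrier (F (Suc 0)) \<Longrightarrow> \<epsilon> (d (Suc 0) x) = \<zero>\<^bsub>M\<^esub>"
    "\<And>i x. x \<in> carrier (F (Suc i)) \<Longrightarrow> d (Suc i) x = \<zero>\<^bsub>F i\<^esub>
       \<Longrightarrow> x \<in> d (Suc (Suc i)) ` carrier (F (Suc (Suc i)))"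
    "\<And>i x. x \<in> carrier (F (Suc (Suc i))) \<Longrightarrow> d (Suc i) (d (Suc (Suc i)) x) = \<zero>\<^bsub>F i\<^esub>"
    "\<And>i x. x \<in> carrier (F (Suc i)) \<Longrightarrow> d (Suc i) x \<in> mpow R (Suc 0) (F i)"
proof -
  note a = assms(1)[unfolded minimal_free_resolution_def]
  show 1: "\<And>i. module R (F i)" "\<And>i. free_of_finite_rank R (F i)"
    "\<epsilon> \<in> module_hom R (F 0) M" "\<epsilon> ` carrier (F 0) = carrier M"
    using a by auto
  show "d (Suc i) \<in> module_hom R (F (Suc i)) (F i)" for i
    using a[THEN conjunct2, THEN conjunct1, rule_format, of "Suc i"] by simp
  show "d (Suc i) x \<in> mpow R (Suc 0) (F i)" if "x \<in> carrier (F (Suc i))" for i x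
  proof -
    have "\<forall>i\<ge>1. d i ` carrier (F i) \<subseteq> ideal_smult \<mm> (F (i - 1))" using a by auto
    from this[rule_format, of "Suc i"] show ?thesis using that unfolding mpow_1 by auto
  qed
  have 0: "d (Suc 0) ` carrier (F (Suc 0)) = a_kernel (F 0) M \<epsilon>"
    using a by (simp add: boundaries_def)
  show "x \<in> d (Suc 0) ` carrier (F (Suc 0))" if "x \<in> carrier (F 0)" "\<epsilon> x = \<zero>\<^bsub>M\<^esub>" for x
    using that unfolding 0 by (simp add: a_kernel_iff)
  show "\<epsilon> (d (Suc 0) x) = \<zero>\<^bsub>M\<^esub>" if "x \<in> carrier (F (Suc 0))" for x
  proof -
    have "d (Suc 0) x \<in> a_kernel (F 0) M \<epsilon>" unfolding 0[symmetric] using that by auto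
    thus ?thesis by (simp add: a_kernel_iff)
  qed
  have S: "d (Suc (Suc i)) ` carrier (F (Suc (Suc i))) = a_kernel (F (Suc i)) (F i) (d (Suc i))" for i
  proof -
    have "\<forall>i\<ge>1. boundaries F d i = cycles F d i" using a by auto
    from this[rule_format, of "Suc i"] show ?thesis by (simp add: boundaries_def cycles_def)
  qed
  show "x \<in> d (Suc (Suc i)) ` carrier (F (Suc (Suc i)))"
    if "x \<in> carrier (F (Suc i))" "d (Suc i) x = \<zero>\<^bsub>F i\<^esub>" for i x
    using that unfolding S by (simp add: a_kernel_iff)
  show "d (Suc i) (d (Suc (Suc i)) x) = \<zero>\<^bsub>F i\<^esub>" if "x \<in> carrier (F (Suc (Suc i)))" for i x
  proof -
    have "d (Suc (Suc i)) x \<in> a_kernel (F (Suc i)) (F i) (d (Suc i))" unfolding S[symmetric] using that by auto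
    thus ?thesis by (simp add: a_kernel_iff)
  qed
qed

lemma minimal_free_resolutionI:
  assumes "\<And>i. module R (F i)" "\<And>i. free_of_finite_rank R (F i)"
    "\<And>i. d (Suc i) \<in> module_hom R (F (Suc i)) (F i)"
    "\<epsilon> \<in> module_hom R (F 0) M" "\<epsilon> ` carrier (F 0) = carrier M"
    "\<And>x. x \<in> carrier (F 0) \<Longrightarrow> \<epsilon> x = \<zero>\<^bsub>M\<^esub> \<Longrightarrow> x \<in> d (Suc 0) ` carrier (F (Suc 0))"
    "\<And>x. x \<in> carrier (F (Suc 0)) \<Longrightarrow> \<epsilon> (d (Suc 0) x) = \<zero>\<^bsub>M\<^esub>"
    "\<And>i x. x \<in> carrier (F (Suc i)) \<Longrightarrow> d (Suc i) x = \<zero>\<^bsub>F i\<^esub>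
       \<Longrightarrow> x \<in> d (Suc (Suc i)) ` carrier (F (Suc (Suc i)))"
    "\<And>i x. x \<in> carrier (F (Suc (Suc i))) \<Longrightarrow> d (Suc i) (d (Suc (Suc i)) x) = \<zero>\<^bsub>F i\<^esub>"
    "\<And>i x. x \<in> carrier (F (Suc i)) \<Longrightarrow> d (Suc i) x \<in> mpow R (Suc 0) (F i)"
  shows "minimal_free_resolution R M F d \<epsilon>"
  unfolding minimal_free_resolution_def
proof (intro conjI allI impI)
  show "boundaries F d 0 = a_kernel (F 0) M \<epsilon>"
    using assms(6,7) homD(1)[OF assms(3)[of 0]] by (auto simp: boundaries_def a_kernel_iff)
  fix i :: nat assume "i \<ge> 1"
  then obtain j where i: "i = Suc j" by (cases i) auto
  show "boundaries F d i = cycles F d i"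
    using assms(8,9) homD(1)[OF assms(3)[of "Suc j"]] unfolding i
    by (auto simp: boundaries_def cycles_def a_kernel_iff)
  show "d i ` carrier (F i) \<subseteq> ideal_smult \<mm> (F (i - 1))"
    using assms(10) unfolding i mpow_1 by auto
  show "d i \<in> module_hom R (F i) (F (i - 1))" using assms(3) unfolding i by simp
qed (use assms in auto)

text \<open>The comparison theorem of homological algebra, with control over the \<open>\<mm>\<close>-adic size of the chain map: if
  \<open>\<theta>\<close> takes values in \<open>\<mm>\<^sup>k M'\<close>, then the chain map can be chosen with values in \<open>\<mm>\<^sup>k G\<close>,
  provided that boundaries of \<open>G\<close> lying in \<open>\<mm>\<^sup>k\<^sup>+\<^sup>1 G\<close> are boundaries of elements of \<open>\<mm>\<^sup>k G\<close>.
  The additional factor \<open>\<mm>\<close> needed at each step comes from the minimality of \<open>F\<close>.\<close>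

lemma comparison_map:
  assumes M: "module R M" and M': "module R M'"
    and F: "minimal_free_resolution R M F d \<epsilon>" and G: "minimal_free_resolution R M' G \<delta> \<eta>"
    and \<theta>: "\<theta> \<in> module_hom R M M'" and \<theta>k: "\<And>x. x \<in> carrier M \<Longrightarrow> \<theta> x \<in> mpow R k M'"
    and strict: "\<And>i y. y \<in> carrier (G (Suc i)) \<Longrightarrow> \<delta> (Suc i) y \<in> mpow R (Suc k) (G i)
      \<Longrightarrow> \<delta> (Suc i) y \<in> \<delta> (Suc i) ` mpow R k (G (Suc i))"
  obtains f where "\<And>i. f i \<in> module_hom R (F i) (G i)"
    "\<And>i x. x \<in> carrier (F i) \<Longrightarrow> f i x \<in> mpow R k (G i)"
    "\<And>x. x \<in> carrier (F 0) \<Longrightarrow> \<eta> (f 0 x) = \<theta> (\<epsilon> x)"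
    "\<And>i x. x \<in> carrier (F (Suc i)) \<Longrightarrow> \<delta> (Suc i) (f (Suc i) x) = f i (d (Suc i) x)"
proof -
  note f = minimal_free_resolutionD[OF F M] and g = minimal_free_resolutionD[OF G M']
  define P where "P i h \<longleftrightarrow> h \<in> module_hom R (F i) (G i) \<and> (\<forall>x\<in>carrier (F i). h x \<in> mpow R k (G i)) \<and>
      (\<forall>x\<in>carrier (F (Suc i)). h (d (Suc i) x) \<in> \<delta> (Suc i) ` carrier (G (Suc i))) \<and>
      (i = 0 \<longrightarrow> (\<forall>x\<in>carrier (F 0). \<eta> (h x) = \<theta> (\<epsilon> x)))" for i h
  define Q where "Q i h h' \<longleftrightarrow> (\<forall>x\<in>carrier (F (Suc i)). \<delta> (Suc i) (h' x) = h (d (Suc i) x))" for i h h'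
  (* The third conjunct of P is what the lift in the next degree needs; it holds by exactness of G. *)
  have "\<exists>f. \<forall>i. P i (f i) \<and> Q i (f i) (f (Suc i))"
  proof (rule dependent_nat_choice)
    have "(\<lambda>x. \<theta> (\<epsilon> x)) \<in> module_hom R (F 0) M'" by (rule hom_compose[OF f(4) \<theta>])
    moreover have "\<theta> (\<epsilon> x) \<in> \<eta> ` mpow R k (G 0)" if "x \<in> carrier (F 0)" for x
      using mpow_surj[OF g(1) M' g(4,5)] \<theta>k homD(1)[OF f(4)] that by auto
    ultimately obtain h where h: "h \<in> module_hom R (F 0) (G 0)"
      "\<And>x. x \<in> carrier (F 0) \<Longrightarrow> h x \<in> mpow R k (G 0) \<and> \<eta> (h x) = \<theta> (\<epsilon> x)"
      using free_lift[OF f(1,2) g(1) M' _ g(4) mpow_submodule[OF g(1)]] by blast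
    have "h (d (Suc 0) x) \<in> \<delta> (Suc 0) ` carrier (G (Suc 0))" if "x \<in> carrier (F (Suc 0))" for x
    proof -
      have dx: "d (Suc 0) x \<in> carrier (F 0)" using homD(1)[OF f(3)] that by auto
      have "\<eta> (h (d (Suc 0) x)) = \<zero>\<^bsub>M'\<^esub>"
        using h(2)[OF dx] f(7)[OF that] hom_arith(1)[OF M M' \<theta>] by simp
      thus ?thesis using g(6) homD(1)[OF h(1) dx] by auto
    qed
    thus "\<exists>h. P 0 h" using h unfolding P_def by auto
  next
    fix h i assume "P i h"
    hence h: "h \<in> module_hom R (F i) (G i)" "\<And>x. x \<in> carrier (F i) \<Longrightarrow> h x \<in> mpow R k (G i)"
      "\<And>x. x \<in> carrier (F (Suc i)) \<Longrightarrow> h (d (Suc i) x) \<in> \<delta> (Suc i) ` carrier (G (Suc i))"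
      unfolding P_def by auto
    have "(\<lambda>x. h (d (Suc i) x)) \<in> module_hom R (F (Suc i)) (G i)" by (rule hom_compose[OF f(3) h(1)])
    moreover have "h (d (Suc i) x) \<in> \<delta> (Suc i) ` mpow R k (G (Suc i))"
      if "x \<in> carrier (F (Suc i))" for x
    proof -
      have "h (d (Suc i) x) \<in> mpow R (Suc 0 + k) (G i)"
        using mpow_hom[OF f(1) g(1) h(1,2) f(10)[OF that]] by simp
      thus ?thesis using h(3)[OF that] strict by auto
    qed
    ultimately obtain h' where h': "h' \<in> module_hom R (F (Suc i)) (G (Suc i))"
      "\<And>x. x \<in> carrier (F (Suc i)) \<Longrightarrow> h' x \<in> mpow R k (G (Suc i)) \<and> \<delta> (Suc i) (h' x) = h (d (Suc i) x)"
      using free_lift[OF f(1,2) g(1) g(1) _ g(3) mpow_submodule[OF g(1)]] by blast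
    have "h' (d (Suc (Suc i)) x) \<in> \<delta> (Suc (Suc i)) ` carrier (G (Suc (Suc i)))"
      if "x \<in> carrier (F (Suc (Suc i)))" for x
    proof -
      have dx: "d (Suc (Suc i)) x \<in> carrier (F (Suc i))" using homD(1)[OF f(3)] that by auto
      have "\<delta> (Suc i) (h' (d (Suc (Suc i)) x)) = \<zero>\<^bsub>G i\<^esub>"
        using h'(2)[OF dx] f(9)[OF that] hom_arith(1)[OF f(1) g(1) h(1)] by simp
      thus ?thesis using g(8) homD(1)[OF h'(1) dx] by auto
    qed
    thus "\<exists>h'. P (Suc i) h' \<and> Q i h h'" using h' unfolding P_def Q_def by auto
  qed
  then obtain f where "\<And>i. P i (f i)" "\<And>i. Q i (f i) (f (Suc i))" by auto
  thus thesis by (intro that[of f]) (auto simp: P_def Q_def)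
qed

text \<open>A chain map that lifts zero is null homotopic. The induction remembers one component \<open>h\<close> of the
  homotopy, through the equation \<open>d h = e\<close> on boundaries, since this is all that the next one needs.\<close>

lemma null_homotopy:
  assumes M: "module R M" and F: "minimal_free_resolution R M F d \<epsilon>"
    and e: "\<And>i. e i \<in> module_hom R (F i) (F i)"
    and e0: "\<And>x. x \<in> carrier (F 0) \<Longrightarrow> \<epsilon> (e 0 x) = \<zero>\<^bsub>M\<^esub>"
    and ed: "\<And>i x. x \<in> carrier (F (Suc i)) \<Longrightarrow> d (Suc i) (e (Suc i) x) = e i (d (Suc i) x)"
  shows "\<exists>h\<in>module_hom R (F i) (F (Suc i)). \<forall>x\<in>carrier (F (Suc i)).
    \<exists>y\<in>carrier (F (Suc (Suc i))). e (Suc i) x = h (d (Suc i) x) \<oplus>\<^bsub>F (Suc i)\<^esub> d (Suc (Suc i)) y"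
proof -
  note f = minimal_free_resolutionD[OF F M]
  have lift: "\<exists>y\<in>carrier (F (Suc (Suc i))). e (Suc i) x = h (d (Suc i) x) \<oplus>\<^bsub>F (Suc i)\<^esub> d (Suc (Suc i)) y"
    if h: "h \<in> module_hom R (F i) (F (Suc i))"
      and hd: "\<And>x. x \<in> carrier (F (Suc i)) \<Longrightarrow> d (Suc i) (h (d (Suc i) x)) = e i (d (Suc i) x)"
      and x: "x \<in> carrier (F (Suc i))" for h i x
  proof -
    interpret Fi: module R "F i" by (rule f)
    interpret Fs: module R "F (Suc i)" by (rule f)
    have c: "e (Suc i) x \<in> carrier (F (Suc i))" "h (d (Suc i) x) \<in> carrier (F (Suc i))"
      using homD(1)[OF e] homD(1)[OF f(3)] homD(1)[OF h] x by auto
    have "d (Suc i) (e (Suc i) x \<ominus>\<^bsub>F (Suc i)\<^esub> h (d (Suc i) x)) = \<zero>\<^bsub>F i\<^esub>"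
      using hom_arith(3)[OF f(1) f(1) f(3) c] ed[OF x] hd[OF x] homD(1)[OF e] homD(1)[OF f(3) x]
      by (simp add: Fi.minus_zero_iff)
    then obtain y where "y \<in> carrier (F (Suc (Suc i)))"
      "e (Suc i) x \<ominus>\<^bsub>F (Suc i)\<^esub> h (d (Suc i) x) = d (Suc (Suc i)) y"
      using f(8) c by blast
    thus ?thesis using c homD(1)[OF f(3)] by (subst (asm) Fs.minus_eq_iff) auto
  qed
  have "\<exists>h\<in>module_hom R (F i) (F (Suc i)). \<forall>x\<in>carrier (F (Suc i)). d (Suc i) (h (d (Suc i) x)) = e i (d (Suc i) x)"
  proof (induction i)
    case 0
    have "e 0 x \<in> d (Suc 0) ` carrier (F (Suc 0))" if "x \<in> carrier (F 0)" for x
      using f(6)[OF homD(1)[OF e]] e0 that by auto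
    from free_lift[OF f(1,2) f(1) f(1) e f(3) module.carrier_is_submodule[OF f(1)] this]
    obtain h where "h \<in> module_hom R (F 0) (F (Suc 0))" "\<forall>x\<in>carrier (F 0). d (Suc 0) (h x) = e 0 x" by auto
    thus ?case using homD(1)[OF f(3)] by (intro bexI[of _ h]) auto
  next
    case (Suc i)
    then obtain h where h: "h \<in> module_hom R (F i) (F (Suc i))"
      "\<And>x. x \<in> carrier (F (Suc i)) \<Longrightarrow> d (Suc i) (h (d (Suc i) x)) = e i (d (Suc i) x)" by auto
    interpret Fs: module R "F (Suc i)" by (rule f)
    let ?\<beta> = "\<lambda>x. e (Suc i) x \<ominus>\<^bsub>F (Suc i)\<^esub> h (d (Suc i) x)"
    have b: "?\<beta> \<in> module_hom R (F (Suc i)) (F (Suc i))"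
      by (rule hom_minus[OF f(1) f(1) e hom_compose[OF f(3) h(1)]])
    have "?\<beta> x \<in> d (Suc (Suc i)) ` carrier (F (Suc (Suc i)))" if x: "x \<in> carrier (F (Suc i))" for x
    proof -
      from lift[OF h x] obtain y where y: "y \<in> carrier (F (Suc (Suc i)))"
        "e (Suc i) x = h (d (Suc i) x) \<oplus>\<^bsub>F (Suc i)\<^esub> d (Suc (Suc i)) y" by auto
      have "?\<beta> x = d (Suc (Suc i)) y"
        unfolding y(2) using y(1) x homD(1)[OF f(3)] homD(1)[OF h(1)]
        by (intro Fs.minus_minus_cancel(5)) auto
      thus ?thesis using y by auto
    qed
    from free_lift[OF f(1,2) f(1) f(1) b f(3) module.carrier_is_submodule[OF f(1)] this]
    obtain h' where h': "h' \<in> module_hom R (F (Suc i)) (F (Suc (Suc i)))"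
      "\<And>x. x \<in> carrier (F (Suc i)) \<Longrightarrow> d (Suc (Suc i)) (h' x) = ?\<beta> x" by auto
    have "d (Suc (Suc i)) (h' (d (Suc (Suc i)) x)) = e (Suc i) (d (Suc (Suc i)) x)"
      if x: "x \<in> carrier (F (Suc (Suc i)))" for x
    proof -
      have "d (Suc (Suc i)) x \<in> carrier (F (Suc i))" using homD(1)[OF f(3)] x by auto
      thus ?thesis using h'(2) f(9)[OF x] hom_arith(1)[OF f(1) f(1) h(1)] homD(1)[OF e]
        by (simp add: a_minus_def)
    qed
    thus ?case using h' by blast
  qed
  thus ?thesis using lift by blast
qed

text \<open>For a free resolution \<open>F\<close> of \<open>M\<close>, \<open>x \<in> F\<^sub>i\<close> with \<open>d x \<in> \<mm>\<^sup>q\<^sup>+\<^sup>1 F\<^sub>i\<^sub>-\<^sub>1\<close> represents a class of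
  \<open>Tor\<^sub>i(M, R/\<mm>\<^sup>q\<^sup>+\<^sup>1)\<close>. The predicate says that the natural map from it to \<open>Tor\<^sub>i(M, R/\<mm>\<^sup>q)\<close> vanishes
  for all \<open>q\<close>.\<close>

definition tor_maps_zero :: "(nat \<Rightarrow> ('a, 'f) module) \<Rightarrow> (nat \<Rightarrow> 'f \<Rightarrow> 'f) \<Rightarrow> nat \<Rightarrow> bool"
  where "tor_maps_zero F d i \<longleftrightarrow> (\<forall>q. \<forall>x\<in>carrier (F i). d i x \<in> mpow R (Suc q) (F (i - 1)) \<longrightarrow>
    (\<exists>y\<in>carrier (F (Suc i)). x \<ominus>\<^bsub>F i\<^esub> d (Suc i) y \<in> mpow R q (F i)))"

lemma tor_maps_zeroD:
  assumes "tor_maps_zero F d (Suc i)" "x \<in> carrier (F (Suc i))" "d (Suc i) x \<in> mpow R (Suc q) (F i)"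
  obtains y where "y \<in> carrier (F (Suc (Suc i)))" "x \<ominus>\<^bsub>F (Suc i)\<^esub> d (Suc (Suc i)) y \<in> mpow R q (F (Suc i))"
  using assms unfolding tor_maps_zero_def by fastforce

lemma tor_maps_zeroI:
  assumes "\<And>q x. x \<in> carrier (F (Suc i)) \<Longrightarrow> d (Suc i) x \<in> mpow R (Suc q) (F i) \<Longrightarrow>
    \<exists>y\<in>carrier (F (Suc (Suc i))). x \<ominus>\<^bsub>F (Suc i)\<^esub> d (Suc (Suc i)) y \<in> mpow R q (F (Suc i))"
  shows "tor_maps_zero F d (Suc i)"
  using assms unfolding tor_maps_zero_def by simp

text \<open>Up to a homotopy \<open>h\<close>, the element \<open>x\<close> agrees with its image under the comparison maps from \<open>F\<close> to
  \<open>G\<close> and back, to which the hypothesis on \<open>G\<close> applies. The homotopy contributes a boundary and the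
  element \<open>h (d x)\<close>, which is even in \<open>\<mm>\<^sup>q\<^sup>+\<^sup>1 F\<close>.\<close>

lemma tor_maps_zero_independent_aux:
  assumes M: "module R M"
    and F: "minimal_free_resolution R M F d \<epsilon>" and G: "minimal_free_resolution R M G \<delta> \<eta>"
    and T: "tor_maps_zero G \<delta> (Suc i)"
  shows "tor_maps_zero F d (Suc i)"
proof (rule tor_maps_zeroI)
  fix q x assume x: "x \<in> carrier (F (Suc i))" and dx: "d (Suc i) x \<in> mpow R (Suc q) (F i)"
  note f = minimal_free_resolutionD[OF F M] and g = minimal_free_resolutionD[OF G M]
  have strict: "\<And>i y. y \<in> carrier (G (Suc i)) \<Longrightarrow> \<delta> (Suc i) y \<in> \<delta> (Suc i) ` mpow R 0 (G (Suc i))"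
    "\<And>i y. y \<in> carrier (F (Suc i)) \<Longrightarrow> d (Suc i) y \<in> d (Suc i) ` mpow R 0 (F (Suc i))"
    using mpow_0[OF f(1)] mpow_0[OF g(1)] by auto
  obtain u where u: "\<And>i. u i \<in> module_hom R (F i) (G i)"
    "\<And>x. x \<in> carrier (F 0) \<Longrightarrow> \<eta> (u 0 x) = \<epsilon> x"
    "\<And>i x. x \<in> carrier (F (Suc i)) \<Longrightarrow> \<delta> (Suc i) (u (Suc i) x) = u i (d (Suc i) x)"
    by (rule comparison_map[OF M M F G hom_id _ strict(1)]) (simp add: mpow_0[OF M], assumption, rule that, assumption+)
  obtain v where v: "\<And>i. v i \<in> module_hom R (G i) (F i)"
    "\<And>x. x \<in> carrier (G 0) \<Longrightarrow> \<epsilon> (v 0 x) = \<eta> x"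
    "\<And>i x. x \<in> carrier (G (Suc i)) \<Longrightarrow> d (Suc i) (v (Suc i) x) = v i (\<delta> (Suc i) x)"
    by (rule comparison_map[OF M M G F hom_id _ strict(2)]) (simp add: mpow_0[OF M], assumption, rule that, assumption+)
  note uc = homD(1)[OF u(1)] and vc = homD(1)[OF v(1)] and dc = homD(1)[OF f(3)] and \<delta>c = homD(1)[OF g(3)]
  define e where "e i x = x \<ominus>\<^bsub>F i\<^esub> v i (u i x)" for i x
  have e: "e i \<in> module_hom R (F i) (F i)" for i
    unfolding e_def by (rule hom_minus[OF f(1) f(1) hom_id hom_compose[OF u(1) v(1)]])
  interpret M: module R M by fact
  interpret F0: module R "F 0" by (rule f)
  have e0: "\<epsilon> (e 0 x) = \<zero>\<^bsub>M\<^esub>" if "x \<in> carrier (F 0)" for x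
    unfolding e_def using hom_arith(3)[OF f(1) M f(4), of x] that u(2) v(2) uc vc homD(1)[OF f(4)]
    by (simp add: M.minus_zero_iff)
  have ed: "d (Suc i) (e (Suc i) x) = e i (d (Suc i) x)" if "x \<in> carrier (F (Suc i))" for i x
    unfolding e_def using hom_arith(3)[OF f(1) f(1) f(3), of x] that u(3) v(3) uc vc by simp
  obtain h where h: "h \<in> module_hom R (F i) (F (Suc i))"
    and "\<forall>x\<in>carrier (F (Suc i)). \<exists>y\<in>carrier (F (Suc (Suc i))).
      e (Suc i) x = h (d (Suc i) x) \<oplus>\<^bsub>F (Suc i)\<^esub> d (Suc (Suc i)) y"
    using null_homotopy[OF M F e e0 ed] by blast
  then obtain y where y: "y \<in> carrier (F (Suc (Suc i)))"
    "e (Suc i) x = h (d (Suc i) x) \<oplus>\<^bsub>F (Suc i)\<^esub> d (Suc (Suc i)) y" using x by blast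
  have "\<delta> (Suc i) (u (Suc i) x) \<in> mpow R (Suc q) (G i)"
    using u(3)[OF x] mpow_hom_0[OF f(1) g(1) u(1) dx] by simp
  then obtain z where z: "z \<in> carrier (G (Suc (Suc i)))"
    "u (Suc i) x \<ominus>\<^bsub>G (Suc i)\<^esub> \<delta> (Suc (Suc i)) z \<in> mpow R q (G (Suc i))"
    using T uc[OF x] by (metis tor_maps_zeroD)
  interpret Fs: module R "F (Suc i)" by (rule f)
  interpret Fss: module R "F (Suc (Suc i))" by (rule f)
  let ?b = "v (Suc i) (u (Suc i) x)" and ?vz = "v (Suc (Suc i)) z"
  have vz: "?vz \<in> carrier (F (Suc (Suc i)))" using vc z by auto
  have "v (Suc i) (u (Suc i) x \<ominus>\<^bsub>G (Suc i)\<^esub> \<delta> (Suc (Suc i)) z) = ?b \<ominus>\<^bsub>F (Suc i)\<^esub> d (Suc (Suc i)) ?vz"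
    using hom_arith(3)[OF g(1) f(1) v(1)] uc[OF x] \<delta>c[OF z(1)] v(3)[OF z(1)] by simp
  hence 1: "?b \<ominus>\<^bsub>F (Suc i)\<^esub> d (Suc (Suc i)) ?vz \<in> mpow R q (F (Suc i))"
    using mpow_hom_0[OF g(1) f(1) v(1) z(2)] by simp
  have hdx: "h (d (Suc i) x) \<in> mpow R q (F (Suc i))"
    using mpow_hom_0[OF f(1) f(1) h dx] mpow_Suc_antimono[OF f(1)] by blast
  have hc: "h (d (Suc i) x) \<in> carrier (F (Suc i))" using hdx mpowD(7)[OF f(1)] by auto
  have b: "?b \<in> carrier (F (Suc i))" using uc vc x by auto
  have "x = ?b \<oplus>\<^bsub>F (Suc i)\<^esub> (h (d (Suc i) x) \<oplus>\<^bsub>F (Suc i)\<^esub> d (Suc (Suc i)) y)"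
    using y(2) x b hc dc[OF y(1)] unfolding e_def by (subst (asm) Fs.minus_eq_iff) auto
  hence "x \<ominus>\<^bsub>F (Suc i)\<^esub> (d (Suc (Suc i)) ?vz \<oplus>\<^bsub>F (Suc i)\<^esub> d (Suc (Suc i)) y)
     = (?b \<ominus>\<^bsub>F (Suc i)\<^esub> d (Suc (Suc i)) ?vz) \<oplus>\<^bsub>F (Suc i)\<^esub> h (d (Suc i) x)"
    using b hc dc[OF y(1)] dc[OF vz]
    by (metis Fs.minus_add_minus Fs.minus_minus_cancel(4) Fs.add.m_closed)
  moreover have "d (Suc (Suc i)) (?vz \<oplus>\<^bsub>F (Suc (Suc i))\<^esub> y) =
      d (Suc (Suc i)) ?vz \<oplus>\<^bsub>F (Suc i)\<^esub> d (Suc (Suc i)) y"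
    using homD(2)[OF f(3)] vz y by auto
  ultimately have "x \<ominus>\<^bsub>F (Suc i)\<^esub> d (Suc (Suc i)) (?vz \<oplus>\<^bsub>F (Suc (Suc i))\<^esub> y) \<in> mpow R q (F (Suc i))"
    using mpowD(5)[OF f(1) 1 hdx] by simp
  thus "\<exists>y\<in>carrier (F (Suc (Suc i))). x \<ominus>\<^bsub>F (Suc i)\<^esub> d (Suc (Suc i)) y \<in> mpow R q (F (Suc i))"
    using vz y by (intro bexI[of _ "?vz \<oplus>\<^bsub>F (Suc (Suc i))\<^esub> y"]) auto
qed

lemma tor_maps_zero_independent:
  assumes "module R M" "minimal_free_resolution R M F d \<epsilon>" "minimal_free_resolution R M G \<delta> \<eta>"
  shows "tor_maps_zero F d (Suc i) \<longleftrightarrow> tor_maps_zero G \<delta> (Suc i)"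
  using tor_maps_zero_independent_aux[OF assms(1,2,3)] tor_maps_zero_independent_aux[OF assms(1,3,2)]
  by blast

end

section \<open>Products and powers of free modules\<close>

context noetherian_local_ring
begin

lemma mpow_prod:
  assumes M: "module R M" and N: "module R N"
  shows "mpow R q (prod_module M N) = mpow R q M \<times> mpow R q N"
proof
  note h = prod_module_homs[OF M N] and P = prod_module_module[OF M N]
  show "mpow R q (prod_module M N) \<subseteq> mpow R q M \<times> mpow R q N"
    using mpow_hom_0[OF P M h(1)] mpow_hom_0[OF P N h(2)] by (auto simp: mem_Times_iff)
  show "mpow R q M \<times> mpow R q N \<subseteq> mpow R q (prod_module M N)"
  proof safe
    interpret M: module R M by fact
    interpret N: module R N by fact
    fix x y assume xy: "x \<in> mpow R q M" "y \<in> mpow R q N"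
    have "(x, \<zero>\<^bsub>N\<^esub>) \<oplus>\<^bsub>prod_module M N\<^esub> (\<zero>\<^bsub>M\<^esub>, y) \<in> mpow R q (prod_module M N)"
      using mpowD(5)[OF P mpow_hom_0[OF M P h(3) xy(1)] mpow_hom_0[OF N P h(4) xy(2)]] .
    thus "(x, y) \<in> mpow R q (prod_module M N)"
      using mpowD(7)[OF M xy(1)] mpowD(7)[OF N xy(2)] by simp
  qed
qed

lemma mpow_power:
  assumes M: "module R M" and J: "finite J"
  shows "mpow R q (power_module J M) = (J \<rightarrow>\<^sub>E mpow R q M)"
proof
  note h = power_module_homs[OF M] and P = power_module_module[OF M, of J]
  show "mpow R q (power_module J M) \<subseteq> (J \<rightarrow>\<^sub>E mpow R q M)"
  proof
    fix x assume x: "x \<in> mpow R q (power_module J M)"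
    have "x \<in> carrier (power_module J M)" using mpowD(7)[OF P x] .
    thus "x \<in> (J \<rightarrow>\<^sub>E mpow R q M)"
      using mpow_hom_0[OF P M h(1) x] by (auto simp: power_module_simps PiE_iff)
  qed
  show "(J \<rightarrow>\<^sub>E mpow R q M) \<subseteq> mpow R q (power_module J M)"
  proof
    fix x assume x: "x \<in> J \<rightarrow>\<^sub>E mpow R q M"
    hence xP: "x \<in> carrier (power_module J M)" using mpowD(7)[OF M] by (auto simp: power_module_simps PiE_iff)
    have "(\<lambda>k\<in>J. if k = j then x j else \<zero>\<^bsub>M\<^esub>) \<in> mpow R q (power_module J M)" if "j \<in> J" for j
      using mpow_hom_0[OF M P h(2)[OF that], of "x j" q] x that by auto
    hence "(\<lambda>j. \<lambda>k\<in>J. if k = j then x j else \<zero>\<^bsub>M\<^esub>) \<in> J \<rightarrow> mpow R q (power_module J M)" by (rule Pi_I)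
    from submodule_finsum[OF P mpow_submodule[OF P] this]
    show "x \<in> mpow R q (power_module J M)" unfolding power_module_sum[OF M J xP] .
  qed
qed

lemma one_not_zero: "\<one> \<noteq> \<zero>"
proof
  assume "\<one> = \<zero>"
  hence "carrier R = {\<zero>}" by (rule one_zeroD)
  moreover have "\<zero> \<in> \<mm>"
    using additive_subgroup.zero_closed[OF ideal.axioms(1)[OF max_ideal_ideal]] .
  ultimately have "\<mm> = carrier R" by (intro equalityI subsetI) (auto dest: max_ideal_carrier)
  from maximalideal.I_notcarr[OF max_ideal_maximal] this[symmetric] show False by (rule notE)
qed

text \<open>Nontriviality of \<open>R\<close> enters because a basis is required to be a set: the images of the
  unit vectors must be distinct.\<close>

lemma free_of_finite_rankI:
  assumes F: "module R F" and J: "finite J" and \<theta>: "\<theta> \<in> module_hom R (free_module R J) F"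
    "bij_betw \<theta> (carrier (free_module R J)) (carrier F)"
  shows "free_of_finite_rank R F"
proof -
  interpret F: module R F by fact
  have inj\<theta>: "inj_on \<theta> (carrier (free_module R J))" and im: "\<theta> ` carrier (free_module R J) = carrier F"
    using \<theta>(2) by (auto simp: bij_betw_def)
  note u = unit_vec_carrier[OF is_cring, of J]
  define b where "b j = \<theta> (unit_vec R J j)" for j
  have bF: "b j \<in> carrier F" for j unfolding b_def by (rule homD(1)[OF \<theta>(1) u])
  have inj: "inj_on b J"
  proof (rule inj_onI)
    fix i j assume ij: "i \<in> J" "j \<in> J" "b i = b j"
    hence "unit_vec R J i = unit_vec R J j" using inj_onD[OF inj\<theta>] u unfolding b_def by blast
    from fun_cong[OF this, of i] show "i = j"
      using ij one_not_zero by (simp add: unit_vec_def split: if_splits)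
  qed
  have sum: "(\<Oplus>\<^bsub>F\<^esub>y\<in>b ` J. c y \<odot>\<^bsub>F\<^esub> y) = \<theta> (\<lambda>j\<in>J. c (b j))" if c: "c \<in> b ` J \<rightarrow>\<^sub>E carrier R" for c
  proof -
    have cb: "(\<lambda>j\<in>J. c (b j)) \<in> carrier (free_module R J)" using c by (auto simp: free_module_simps)
    have "(\<Oplus>\<^bsub>F\<^esub>y\<in>b ` J. c y \<odot>\<^bsub>F\<^esub> y) = lincomb F J b (\<lambda>j. c (b j))"
      unfolding lincomb_def using c bF by (intro F.finsum_reindex[OF _ inj]) auto
    also have "\<dots> = lincomb F J b (\<lambda>j\<in>J. c (b j))"
      using cb bF by (intro lincomb_cong[OF F]) (auto simp: free_module_simps)
    also have "\<dots> = \<theta> (\<lambda>j\<in>J. c (b j))"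
      using hom_free_module_eq_lincomb[OF F J \<theta>(1) cb] by (simp add: b_def[abs_def])
    finally show ?thesis .
  qed
  show ?thesis
    unfolding free_of_finite_rank_def
  proof (intro exI[of _ "b ` J"] conjI ballI)
    show "finite (b ` J)" "b ` J \<subseteq> carrier F" using J bF by auto
    fix x assume "x \<in> carrier F"
    then obtain y where y: "y \<in> carrier (free_module R J)" "x = \<theta> y" using im by blast
    let ?c = "\<lambda>z\<in>b ` J. y (the_inv_into J b z)"
    have c: "?c \<in> b ` J \<rightarrow>\<^sub>E carrier R" "(\<lambda>j\<in>J. ?c (b j)) = y"
      using y(1) inj
      by (auto simp: free_module_simps the_inv_into_f_f PiE_iff extensional_def fun_eq_iff)
    show "\<exists>!c. c \<in> b ` J \<rightarrow>\<^sub>E carrier R \<and> x = (\<Oplus>\<^bsub>F\<^esub>y\<in>b ` J. c y \<odot>\<^bsub>F\<^esub> y)"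
    proof (rule ex1I[of _ ?c], intro conjI)
      show "x = (\<Oplus>\<^bsub>F\<^esub>y\<in>b ` J. ?c y \<odot>\<^bsub>F\<^esub> y)" unfolding sum[OF c(1)] c(2) by (rule y)
      fix c' assume c': "c' \<in> b ` J \<rightarrow>\<^sub>E carrier R \<and> x = (\<Oplus>\<^bsub>F\<^esub>y\<in>b ` J. c' y \<odot>\<^bsub>F\<^esub> y)"
      hence "\<theta> (\<lambda>j\<in>J. c' (b j)) = \<theta> y" using sum y by metis
      hence eq: "(\<lambda>j\<in>J. c' (b j)) = y"
        using c' y(1) by (intro inj_onD[OF inj\<theta>]) (auto simp: free_module_simps)
      have "c' (b j) = ?c (b j)" if "j \<in> J" for j
        using fun_cong[OF eq, of j] fun_cong[OF c(2), of j] that by (metis restrict_apply')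
      thus "c' = ?c" using c' c(1) by (intro PiE_ext[of c' "b ` J" "\<lambda>_. carrier R" ?c]) auto
    qed (rule c)
  qed
qed

lemma free_module_free: "finite J \<Longrightarrow> free_of_finite_rank R (free_module R J)"
  by (rule free_of_finite_rankI[OF free_module_module[OF is_cring] _ hom_id]) (auto simp: bij_betw_def)

lemma ring_as_module_free: "free_of_finite_rank R (ring_as_module R)"
proof (rule free_of_finite_rankI[OF ring_as_module_module[OF is_cring]])
  show "(\<lambda>x. x ()) \<in> module_hom R (free_module R {()}) (ring_as_module R)"
    by (intro homI) (auto simp: free_module_simps ring_as_module_simps)
  show "bij_betw (\<lambda>x. x ()) (carrier (free_module R {()})) (carrier (ring_as_module R))"
    by (rule bij_betw_byWitness[where f' = "\<lambda>r. \<lambda>_\<in>{()}. r"])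
       (auto simp: free_module_simps ring_as_module_simps PiE_iff extensional_def)
qed simp

lemma free_prod:
  assumes M: "module R M" "free_of_finite_rank R M" and N: "module R N" "free_of_finite_rank R N"
  shows "free_of_finite_rank R (prod_module M N)"
proof -
  obtain A \<theta> where "finite A" "A \<subseteq> carrier M" "\<theta> \<in> module_hom R (free_module R A) M"
    "bij_betw \<theta> (carrier (free_module R A)) (carrier M)" by (rule free_iso_free_module[OF M]) (rule that)
  note A = this(1,3,4)
  obtain B \<kappa> where "finite B" "B \<subseteq> carrier N" "\<kappa> \<in> module_hom R (free_module R B) N"
    "bij_betw \<kappa> (carrier (free_module R B)) (carrier N)" by (rule free_iso_free_module[OF N]) (rule that)
  note B = this(1,3,4)
  let ?J = "Inl ` A \<union> Inr ` B"
  let ?l = "\<lambda>x. \<lambda>a\<in>A. x (Inl a)" and ?r = "\<lambda>x. \<lambda>b\<in>B. x (Inr b)"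
  have l: "?l \<in> module_hom R (free_module R ?J) (free_module R A)"
    and r: "?r \<in> module_hom R (free_module R ?J) (free_module R B)"
    by (auto intro!: homI restrict_ext simp: free_module_simps PiE_iff)
  let ?f = "\<lambda>x. (\<theta> (?l x), \<kappa> (?r x))"
  have f: "?f \<in> module_hom R (free_module R ?J) (prod_module M N)"
    by (rule hom_pair[OF hom_compose[OF l A(2)] hom_compose[OF r B(2)]])
  have "inj_on ?f (carrier (free_module R ?J))"
  proof (rule inj_onI)
    fix x y assume xy: "x \<in> carrier (free_module R ?J)" "y \<in> carrier (free_module R ?J)" "?f x = ?f y"
    have "?l x = ?l y" "?r x = ?r y"
      using xy homD(1)[OF l] homD(1)[OF r] A(3) B(3) by (auto simp: bij_betw_def inj_on_def)
    hence "x (Inl a) = y (Inl a)" "x (Inr b) = y (Inr b)" if "a \<in> A" "b \<in> B" for a b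
      using that by (metis restrict_apply')+
    moreover have "x (Inl a) = y (Inl a)" if "a \<in> A" for a
      using fun_cong[OF \<open>?l x = ?l y\<close>, of a] that by simp
    moreover have "x (Inr b) = y (Inr b)" if "b \<in> B" for b
      using fun_cong[OF \<open>?r x = ?r y\<close>, of b] that by simp
    ultimately show "x = y" using xy(1,2) unfolding free_module_simps(1) by (intro PiE_ext) auto
  qed
  moreover have "?f ` carrier (free_module R ?J) = carrier (prod_module M N)"
  proof
    show "?f ` carrier (free_module R ?J) \<subseteq> carrier (prod_module M N)" using homD(1)[OF f] by blast
    show "carrier (prod_module M N) \<subseteq> ?f ` carrier (free_module R ?J)"
    proof
      fix z assume "z \<in> carrier (prod_module M N)"
      hence "fst z \<in> \<theta> ` carrier (free_module R A)" "snd z \<in> \<kappa> ` carrier (free_module R B)"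
        using A(3) B(3) by (auto simp: bij_betw_def)
      then obtain x y where xy: "x \<in> A \<rightarrow>\<^sub>E carrier R" "fst z = \<theta> x" "y \<in> B \<rightarrow>\<^sub>E carrier R" "snd z = \<kappa> y"
        by (auto simp: free_module_simps)
      let ?w = "restrict (case_sum x y) ?J"
      have "?l ?w = x" "?r ?w = y" using xy(1,3) by (auto simp: fun_eq_iff PiE_iff extensional_def)
      hence "z = ?f ?w" using xy by (simp add: prod_eq_iff)
      moreover have "?w \<in> carrier (free_module R ?J)" using xy(1,3) by (auto simp: free_module_simps)
      ultimately show "z \<in> ?f ` carrier (free_module R ?J)" by (rule image_eqI)
    qed
  qed
  ultimately show ?thesis
    using A(1) B(1) by (intro free_of_finite_rankI[OF prod_module_module[OF M(1) N(1)] _ f]) (auto simp: bij_betw_def)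
qed

lemma free_power:
  assumes M: "module R M" "free_of_finite_rank R M" and J: "finite J"
  shows "free_of_finite_rank R (power_module J M)"
proof -
  obtain A \<theta> where "finite A" "A \<subseteq> carrier M" "\<theta> \<in> module_hom R (free_module R A) M"
    "bij_betw \<theta> (carrier (free_module R A)) (carrier M)" by (rule free_iso_free_module[OF M]) (rule that)
  note A = this(1,3,4)
  let ?I = "J \<times> A" and ?c = "\<lambda>j x. \<lambda>a\<in>A. x (j, a)"
  have c: "?c j \<in> module_hom R (free_module R ?I) (free_module R A)" if "j \<in> J" for j
    using that by (auto intro!: homI restrict_ext simp: free_module_simps PiE_iff)
  let ?f = "\<lambda>x. \<lambda>j\<in>J. \<theta> (?c j x)"
  have f: "?f \<in> module_hom R (free_module R ?I) (power_module J M)"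
    using homD[OF hom_compose[OF c A(2)]]
    by (intro homI) (auto simp: power_module_simps intro!: restrict_ext)
  have "inj_on ?f (carrier (free_module R ?I))"
  proof (rule inj_onI)
    fix x y assume xy: "x \<in> carrier (free_module R ?I)" "y \<in> carrier (free_module R ?I)" "?f x = ?f y"
    have "x (j, a) = y (j, a)" if "j \<in> J" "a \<in> A" for j a
    proof -
      have "\<theta> (?c j x) = \<theta> (?c j y)" using fun_cong[OF xy(3), of j] that by simp
      hence "?c j x = ?c j y"
        using homD(1)[OF c[OF that(1)]] xy(1,2) A(3) by (auto simp: bij_betw_def inj_on_def)
      from fun_cong[OF this, of a] show ?thesis using that by simp
    qed
    thus "x = y" using xy(1,2) unfolding free_module_simps(1) by (intro PiE_ext) auto
  qed
  moreover have "?f ` carrier (free_module R ?I) = carrier (power_module J M)"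
  proof
    show "?f ` carrier (free_module R ?I) \<subseteq> carrier (power_module J M)" using homD(1)[OF f] by blast
    show "carrier (power_module J M) \<subseteq> ?f ` carrier (free_module R ?I)"
    proof
      fix z assume z: "z \<in> carrier (power_module J M)"
      hence "\<forall>j\<in>J. \<exists>x\<in>A \<rightarrow>\<^sub>E carrier R. z j = \<theta> x"
        using A(3) by (auto simp: power_module_simps bij_betw_def free_module_simps PiE_iff image_iff)
      then obtain x where x: "\<And>j. j \<in> J \<Longrightarrow> x j \<in> A \<rightarrow>\<^sub>E carrier R" "\<And>j. j \<in> J \<Longrightarrow> z j = \<theta> (x j)" by metis
      let ?w = "\<lambda>p\<in>?I. x (fst p) (snd p)"
      have "?c j ?w = x j" if "j \<in> J" for j
        using x(1)[OF that] that by (auto simp: fun_eq_iff PiE_iff extensional_def)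
      hence "?f ?w = restrict z J" by (intro restrict_ext) (simp only: x(2))
      also have "\<dots> = z" using z by (simp add: power_module_simps PiE_restrict)
      finally have "z = ?f ?w" by (rule sym)
      moreover have "?w \<in> carrier (free_module R ?I)" using x(1) by (auto simp: free_module_simps PiE_iff)
      ultimately show "z \<in> ?f ` carrier (free_module R ?I)" by (rule image_eqI)
    qed
  qed
  ultimately show ?thesis
    using A(1) J by (intro free_of_finite_rankI[OF power_module_module[OF M(1)] _ f]) (auto simp: bij_betw_def)
qed

end

section \<open>Finitely generated modules and existence of minimal free resolutions\<close>

text \<open>The generated submodule in inductive form: its elements are traced through homomorphisms and
  submodules by rule induction, without manipulating sums.\<close>

inductive_set lspan :: "('a, 'r) ring_scheme \<Rightarrow> ('a, 'm) module \<Rightarrow> 'm set \<Rightarrow> 'm set"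
  for R and M and A where
    zero: "\<zero>\<^bsub>M\<^esub> \<in> lspan R M A"
  | gen: "a \<in> A \<Longrightarrow> a \<in> lspan R M A"
  | add: "\<lbrakk>x \<in> lspan R M A; y \<in> lspan R M A\<rbrakk> \<Longrightarrow> x \<oplus>\<^bsub>M\<^esub> y \<in> lspan R M A"
  | smult: "\<lbrakk>r \<in> carrier R; x \<in> lspan R M A\<rbrakk> \<Longrightarrow> r \<odot>\<^bsub>M\<^esub> x \<in> lspan R M A"

lemma lspan_least:
  assumes "module R M" "submodule H R M" "A \<subseteq> H"
  shows "lspan R M A \<subseteq> H"
proof
  note s = submoduleD[OF assms(1,2)]
  show "x \<in> H" if "x \<in> lspan R M A" for x
    using that by induct (use s assms(3) in auto)
qed

lemma lspan_submodule:
  assumes M: "module R M" and A: "A \<subseteq> carrier M"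
  shows "submodule (lspan R M A) R M"
proof -
  interpret M: module R M by fact
  have "lspan R M A \<subseteq> carrier M"
    by (rule lspan_least[OF M module.carrier_is_submodule[OF M] A])
  thus ?thesis by (intro submodule_closedI[OF M]) (auto intro: lspan.intros)
qed

lemma lspan_carrier_update: "lspan R (M\<lparr>carrier := H\<rparr>) A = lspan R M A"
proof (intro equalityI subsetI)
  show "x \<in> lspan R M A" if "x \<in> lspan R (M\<lparr>carrier := H\<rparr>) A" for x
    using that by induct (auto intro: lspan.intros)
  show "x \<in> lspan R (M\<lparr>carrier := H\<rparr>) A" if "x \<in> lspan R M A" for x
    using that
  proof induct
    case zero show ?case using lspan.zero[of "M\<lparr>carrier := H\<rparr>"] by simp
  next
    case (add x y) thus ?case using lspan.add[of x R "M\<lparr>carrier := H\<rparr>"] by simp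
  next
    case (smult r x) thus ?case using lspan.smult[of r R x "M\<lparr>carrier := H\<rparr>"] by simp
  qed (rule lspan.gen)
qed

lemma lspan_image:
  assumes M: "module R M" and J: "finite J" and h: "\<And>j. j \<in> J \<Longrightarrow> h j \<in> carrier M"
  shows "lspan R M (h ` J) = lincomb M J h ` carrier (free_module R J)"
proof
  interpret M: module R M by fact
  note F = free_module_module[OF M.is_cring, of J] and hom = lincomb_hom[OF M J h]
  note sub = lspan_submodule[OF M image_subsetI[OF h]]
  have "h j \<in> lincomb M J h ` carrier (free_module R J)" if "j \<in> J" for j
    by (rule image_eqI[of _ _ "unit_vec R J j"])
       (simp_all only: unit_vec_carrier[OF M.is_cring] lincomb_unit_vec[where h = h, OF M J h that])
  thus "lspan R M (h ` J) \<subseteq> lincomb M J h ` carrier (free_module R J)"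
    by (intro lspan_least[OF M submodule_image[OF F M hom module.carrier_is_submodule[OF F]]]) auto
  show "lincomb M J h ` carrier (free_module R J) \<subseteq> lspan R M (h ` J)"
    unfolding lincomb_def
    by (intro image_subsetI submodule_finsum[OF M sub] Pi_I lspan.smult lspan.gen) (auto simp: free_module_simps)
qed

lemma finitely_generated_iff_lspan:
  assumes M: "module R M"
  shows "finitely_generated R M \<longleftrightarrow> (\<exists>A. finite A \<and> A \<subseteq> carrier M \<and> lspan R M A = carrier M)"
proof -
  interpret M: module R M by fact
  have "(\<forall>x\<in>carrier M. \<exists>c\<in>A \<rightarrow> carrier R. x = (\<Oplus>\<^bsub>M\<^esub>a\<in>A. c a \<odot>\<^bsub>M\<^esub> a)) \<longleftrightarrow> lspan R M A = carrier M"
    if A: "finite A" "A \<subseteq> carrier M" for A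
  proof -
    have AM: "\<And>a. a \<in> A \<Longrightarrow> a \<in> carrier M" using A by auto
    let ?L = "lincomb M A (\<lambda>a. a)"
    have L: "?L \<in> module_hom R (free_module R A) M" by (rule lincomb_hom[OF M A(1) AM])
    have im: "lspan R M A = ?L ` (A \<rightarrow>\<^sub>E carrier R)"
      using lspan_image[OF M A(1), of "\<lambda>a. a"] AM by (simp add: free_module_simps)
    have sub: "?L ` (A \<rightarrow>\<^sub>E carrier R) \<subseteq> carrier M" using homD(1)[OF L] by (auto simp: free_module_simps)
    have "?L ` (A \<rightarrow> carrier R) \<subseteq> ?L ` (A \<rightarrow>\<^sub>E carrier R)"
    proof (rule image_subsetI)
      fix c assume c: "c \<in> A \<rightarrow> carrier R"
      have "?L (restrict c A) = ?L c" using c AM by (intro lincomb_cong[OF M]) auto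
      moreover have "restrict c A \<in> A \<rightarrow>\<^sub>E carrier R" using c by auto
      ultimately show "?L c \<in> ?L ` (A \<rightarrow>\<^sub>E carrier R)" by (metis imageI)
    qed
    moreover have "?L ` (A \<rightarrow>\<^sub>E carrier R) \<subseteq> ?L ` (A \<rightarrow> carrier R)" by (rule image_mono) auto
    ultimately have L': "lspan R M A = ?L ` (A \<rightarrow> carrier R)" using im by (simp only: subset_antisym)
    have "lspan R M A = carrier M \<longleftrightarrow> carrier M \<subseteq> lspan R M A"
      unfolding set_eq_subset[of _ "carrier M"] using sub by (simp add: im)
    also have "\<dots> \<longleftrightarrow> carrier M \<subseteq> ?L ` (A \<rightarrow> carrier R)" unfolding L' ..
    also have "\<dots> \<longleftrightarrow> (\<forall>x\<in>carrier M. \<exists>c\<in>A \<rightarrow> carrier R. x = ?L c)" by (auto simp only: subset_iff image_iff)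
    finally show ?thesis by (simp add: lincomb_def)
  qed
  thus ?thesis unfolding finitely_generated_def by (intro ex_cong1 conj_cong refl)
qed

lemma finitely_generated_image:
  assumes M: "module R M" and N: "module R N" and f: "f \<in> module_hom R M N"
    and surj: "f ` carrier M = carrier N" and fg: "finitely_generated R M"
  shows "finitely_generated R N"
proof -
  obtain A where A: "finite A" "A \<subseteq> carrier M" "lspan R M A = carrier M"
    using fg unfolding finitely_generated_iff_lspan[OF M] by auto
  have fA: "f ` A \<subseteq> carrier N" using A(2) surj by auto
  have "f x \<in> lspan R N (f ` A)" if "x \<in> lspan R M A" for x
    using that
  proof induct
    case zero thus ?case using hom_arith(1)[OF M N f] lspan.zero by metis
  next
    case (add x y)
    hence "x \<in> carrier M" "y \<in> carrier M" using A(3) by auto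
    thus ?case using add homD(2)[OF f] by (auto intro: lspan.add)
  next
    case (smult r x)
    hence "x \<in> carrier M" using A(3) by auto
    thus ?case using smult homD(3)[OF f] by (auto intro: lspan.smult)
  qed (auto intro: lspan.gen)
  hence "carrier N \<subseteq> lspan R N (f ` A)" unfolding surj[symmetric] using A(3) by auto
  moreover have "lspan R N (f ` A) \<subseteq> carrier N" using submoduleD(1)[OF N lspan_submodule[OF N fA]] .
  ultimately show ?thesis
    unfolding finitely_generated_iff_lspan[OF N] using A(1) fA by (intro exI[of _ "f ` A"]) simp
qed

lemma free_finitely_generated:
  assumes M: "module R M" and free: "free_of_finite_rank R M"
  shows "finitely_generated R M"
proof -
  from free obtain B where B: "finite B \<and> B \<subseteq> carrier M \<and>
      (\<forall>x\<in>carrier M. \<exists>!c. c \<in> B \<rightarrow>\<^sub>E carrier R \<and> x = (\<Oplus>\<^bsub>M\<^esub>b\<in>B. c b \<odot>\<^bsub>M\<^esub> b))"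
    unfolding free_of_finite_rank_def ..
  show ?thesis
    unfolding finitely_generated_def
  proof (intro exI[of _ B] conjI ballI)
    fix x assume "x \<in> carrier M"
    with B obtain c where c: "c \<in> B \<rightarrow>\<^sub>E carrier R" "x = (\<Oplus>\<^bsub>M\<^esub>b\<in>B. c b \<odot>\<^bsub>M\<^esub> b)"
      by (elim conjE) (drule (1) bspec, elim ex1E conjE, rule that)
    show "\<exists>c\<in>B \<rightarrow> carrier R. x = (\<Oplus>\<^bsub>M\<^esub>b\<in>B. c b \<odot>\<^bsub>M\<^esub> b)"
      by (rule bexI[of _ c]) (fact c(2), use c(1) in auto)
  qed (use B in auto)
qed

lemma lspan_insertE:
  assumes M: "module R M" and A: "insert a A \<subseteq> carrier M" and x: "x \<in> lspan R M (insert a A)"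
  obtains r s where "r \<in> carrier R" "s \<in> lspan R M A" "x = r \<odot>\<^bsub>M\<^esub> a \<oplus>\<^bsub>M\<^esub> s"
proof -
  interpret M: module R M by fact
  have aM: "a \<in> carrier M" and AM: "A \<subseteq> carrier M" using A by auto
  note sp = submoduleD[OF M lspan_submodule[OF M AM]]
  let ?K = "{r \<odot>\<^bsub>M\<^esub> a \<oplus>\<^bsub>M\<^esub> s | r s. r \<in> carrier R \<and> s \<in> lspan R M A}"
  have "submodule ?K R M"
  proof (rule submodule_closedI[OF M])
    show "?K \<subseteq> carrier M" using aM sp(7) by auto
    show "\<zero>\<^bsub>M\<^esub> \<in> ?K" using aM sp(2) by (intro CollectI exI[of _ "\<zero>\<^bsub>R\<^esub>"] exI[of _ "\<zero>\<^bsub>M\<^esub>"]) auto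
  next
    fix x y assume "x \<in> ?K" "y \<in> ?K"
    then obtain r s r' s' where "r \<in> carrier R" "s \<in> lspan R M A" "x = r \<odot>\<^bsub>M\<^esub> a \<oplus>\<^bsub>M\<^esub> s"
      "r' \<in> carrier R" "s' \<in> lspan R M A" "y = r' \<odot>\<^bsub>M\<^esub> a \<oplus>\<^bsub>M\<^esub> s'" by auto
    thus "x \<oplus>\<^bsub>M\<^esub> y \<in> ?K" using aM sp(7) sp(5)
      by (intro CollectI exI[of _ "r \<oplus>\<^bsub>R\<^esub> r'"] exI[of _ "s \<oplus>\<^bsub>M\<^esub> s'"]) (auto simp: M.smult_l_distr M.M.add.m_ac)
  next
    fix t x assume t: "t \<in> carrier R" and "x \<in> ?K"
    then obtain r s where "r \<in> carrier R" "s \<in> lspan R M A" "x = r \<odot>\<^bsub>M\<^esub> a \<oplus>\<^bsub>M\<^esub> s" by auto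
    thus "t \<odot>\<^bsub>M\<^esub> x \<in> ?K" using aM sp(7) sp(4) t
      by (intro CollectI exI[of _ "t \<otimes>\<^bsub>R\<^esub> r"] exI[of _ "t \<odot>\<^bsub>M\<^esub> s"]) (auto simp: M.smult_r_distr M.smult_assoc1)
  qed
  moreover have "insert a A \<subseteq> ?K"
  proof -
    have "a \<in> ?K" using aM sp(2) by (intro CollectI exI[of _ "\<one>\<^bsub>R\<^esub>"] exI[of _ "\<zero>\<^bsub>M\<^esub>"]) auto
    moreover have "y \<in> ?K" if "y \<in> A" for y
      using aM that AM by (intro CollectI exI[of _ "\<zero>\<^bsub>R\<^esub>"] exI[of _ y]) (auto intro: lspan.gen)
    ultimately show ?thesis by auto
  qed
  ultimately have "x \<in> ?K" using lspan_least[OF M] x by blast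
  thus thesis using that by auto
qed

text \<open>The coefficients of \<open>a\<close> in the elements of \<open>L\<close>, taken modulo the span of \<open>A\<close>. To this ideal the
  noetherian hypothesis on the ring is applied.\<close>

lemma coefficient_ideal:
  assumes M: "module R M" and aM: "a \<in> carrier M" and A: "A \<subseteq> carrier M" and L: "submodule L R M"
  shows "ideal {r \<in> carrier R. \<exists>s\<in>lspan R M A. r \<odot>\<^bsub>M\<^esub> a \<oplus>\<^bsub>M\<^esub> s \<in> L} R" (is "ideal ?J R")
proof -
  interpret M: module R M by fact
  note sp = submoduleD[OF M lspan_submodule[OF M A]] and l = submoduleD[OF M L]
  have add: "x \<oplus>\<^bsub>R\<^esub> y \<in> ?J" if "x \<in> ?J" "y \<in> ?J" for x y
  proof -
    from that obtain s t where st: "x \<in> carrier R" "y \<in> carrier R" "s \<in> lspan R M A" "t \<in> lspan R M A"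
      "x \<odot>\<^bsub>M\<^esub> a \<oplus>\<^bsub>M\<^esub> s \<in> L" "y \<odot>\<^bsub>M\<^esub> a \<oplus>\<^bsub>M\<^esub> t \<in> L" by auto
    have "(x \<oplus>\<^bsub>R\<^esub> y) \<odot>\<^bsub>M\<^esub> a \<oplus>\<^bsub>M\<^esub> (s \<oplus>\<^bsub>M\<^esub> t) = (x \<odot>\<^bsub>M\<^esub> a \<oplus>\<^bsub>M\<^esub> s) \<oplus>\<^bsub>M\<^esub> (y \<odot>\<^bsub>M\<^esub> a \<oplus>\<^bsub>M\<^esub> t)"
      using st(1,2) aM sp(7)[OF st(3)] sp(7)[OF st(4)] by (simp add: M.smult_l_distr M.M.add.m_ac)
    also have "\<dots> \<in> L" using l(5) st by auto
    finally show ?thesis using st sp(5) by (intro CollectI conjI bexI[of _ "s \<oplus>\<^bsub>M\<^esub> t"]) auto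
  qed
  have mult: "t \<otimes>\<^bsub>R\<^esub> x \<in> ?J" if t: "t \<in> carrier R" and "x \<in> ?J" for x t
  proof -
    from that obtain s where s: "x \<in> carrier R" "s \<in> lspan R M A" "x \<odot>\<^bsub>M\<^esub> a \<oplus>\<^bsub>M\<^esub> s \<in> L" by auto
    have "(t \<otimes>\<^bsub>R\<^esub> x) \<odot>\<^bsub>M\<^esub> a \<oplus>\<^bsub>M\<^esub> t \<odot>\<^bsub>M\<^esub> s = t \<odot>\<^bsub>M\<^esub> (x \<odot>\<^bsub>M\<^esub> a \<oplus>\<^bsub>M\<^esub> s)"
      using s(1) aM sp(7)[OF s(2)] t by (simp add: M.smult_r_distr M.smult_assoc1)
    also have "\<dots> \<in> L" using l(4) s t by auto
    finally show ?thesis using s t sp(4) by (intro CollectI conjI bexI[of _ "t \<odot>\<^bsub>M\<^esub> s"]) auto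
  qed
  have neg: "\<ominus>\<^bsub>R\<^esub> x \<in> ?J" if "x \<in> ?J" for x
    using mult[of "\<ominus>\<^bsub>R\<^esub> \<one>\<^bsub>R\<^esub>" x] that by (auto simp: M.l_minus)
  have zero: "\<zero>\<^bsub>R\<^esub> \<in> ?J"
    using aM sp(2) l(2) by (intro CollectI conjI bexI[of _ "\<zero>\<^bsub>M\<^esub>"]) auto
  show ?thesis
  proof (rule idealI)
    show "ring R" by unfold_locales
    show "subgroup ?J (add_monoid R)"
      using zero by (intro M.R.add.subgroupI add neg) auto
    show mult': "t \<otimes>\<^bsub>R\<^esub> x \<in> ?J" if "x \<in> ?J" "t \<in> carrier R" for x t using mult that by auto
    show "x \<otimes>\<^bsub>R\<^esub> t \<in> ?J" if "x \<in> ?J" "t \<in> carrier R" for x t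
      using mult[OF that(2,1)] that M.R.m_comm[of x t] by auto
  qed
qed

context noetherian_local_ring
begin

text \<open>Finitely many elements of \<open>K\<close> realize generators of the ideal of coefficients of \<open>a\<close>. Subtracting a
  combination of them moves any element of \<open>K\<close> into the span of the remaining generators.\<close>

lemma submodule_of_finite_lspan:
  assumes M: "module R M" and "finite A" "A \<subseteq> carrier M" "submodule K R M" "K \<subseteq> lspan R M A"
  shows "\<exists>B. finite B \<and> B \<subseteq> K \<and> lspan R M B = K"
  using assms(2-)
proof (induction A arbitrary: K rule: finite_induct)
  case empty
  have "lspan R M {} \<subseteq> {\<zero>\<^bsub>M\<^esub>}"
  proof -
    interpret M: module R M by fact
    show ?thesis by (intro lspan_least[OF M] submodule_closedI[OF M]) auto
  qed
  hence "K = lspan R M {}" using empty submoduleD(2)[OF M empty(2)] lspan.zero[of M R "{}"] by auto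
  thus ?case by (intro exI[of _ "{}"]) auto
next
  case (insert a A)
  interpret M: module R M by fact
  have aM: "a \<in> carrier M" and AM: "A \<subseteq> carrier M" using insert.prems by auto
  note sp = submoduleD[OF M lspan_submodule[OF M AM]] and k = submoduleD[OF M insert.prems(2)]
  have K0: "submodule (K \<inter> lspan R M A) R M"
    using sp k by (intro submodule_closedI[OF M]) auto
  then obtain B0 where B0: "finite B0" "B0 \<subseteq> K \<inter> lspan R M A" "lspan R M B0 = K \<inter> lspan R M A"
    using insert.IH[OF AM K0 Int_lower2] by (elim exE conjE)
  let ?I = "{r \<in> carrier R. \<exists>s\<in>lspan R M A. r \<odot>\<^bsub>M\<^esub> a \<oplus>\<^bsub>M\<^esub> s \<in> K}"
  have "ideal ?I R" by (rule coefficient_ideal[OF M aM AM insert.prems(2)])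
  from finetely_gen[OF this] obtain X where X: "X \<subseteq> carrier R \<and> finite X \<and> ?I = Idl X" by (elim exE)
  note X = conjunct1[OF X] conjunct1[OF conjunct2[OF X]] conjunct2[OF conjunct2[OF X]]
  have "X \<subseteq> ?I" unfolding X(3) by (rule genideal_self[OF X(1)])
  hence "\<forall>r\<in>X. \<exists>s. s \<in> lspan R M A \<and> r \<odot>\<^bsub>M\<^esub> a \<oplus>\<^bsub>M\<^esub> s \<in> K" by auto
  then obtain s where s: "\<And>r. r \<in> X \<Longrightarrow> s r \<in> lspan R M A"
    "\<And>r. r \<in> X \<Longrightarrow> r \<odot>\<^bsub>M\<^esub> a \<oplus>\<^bsub>M\<^esub> s r \<in> K" by metis
  define B1 where "B1 = (\<lambda>r. r \<odot>\<^bsub>M\<^esub> a \<oplus>\<^bsub>M\<^esub> s r) ` X"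
  have B1: "B1 \<subseteq> K" using s by (auto simp: B1_def)
  have B1M: "B1 \<subseteq> carrier M" using B1 k by auto
  have BK: "B1 \<union> B0 \<subseteq> K" using B1 B0 by auto
  have BM: "B1 \<union> B0 \<subseteq> carrier M" using BK k by auto
  note sB = submoduleD[OF M lspan_submodule[OF M BM]]
  have I: "?I \<subseteq> {r \<in> carrier R. \<exists>s\<in>lspan R M A. r \<odot>\<^bsub>M\<^esub> a \<oplus>\<^bsub>M\<^esub> s \<in> lspan R M B1}" (is "_ \<subseteq> ?J")
    unfolding X(3)
  proof (rule genideal_minimal)
    show "ideal ?J R" by (rule coefficient_ideal[OF M aM AM lspan_submodule[OF M B1M]])
    show "X \<subseteq> ?J"
    proof
      fix r assume r: "r \<in> X"
      hence "r \<odot>\<^bsub>M\<^esub> a \<oplus>\<^bsub>M\<^esub> s r \<in> lspan R M B1" by (auto simp: B1_def intro: lspan.gen)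
      thus "r \<in> ?J" using r X(1) s(1)[OF r] by blast
    qed
  qed
  have mono1: "lspan R M B1 \<subseteq> lspan R M (B1 \<union> B0)" "lspan R M B0 \<subseteq> lspan R M (B1 \<union> B0)"
    by (intro lspan_least[OF M lspan_submodule[OF M BM]]; auto intro: lspan.gen)+
  have B1K: "lspan R M B1 \<subseteq> K" by (rule lspan_least[OF M insert.prems(2) B1])
  have "K \<subseteq> lspan R M (B1 \<union> B0)"
  proof
    fix x assume x: "x \<in> K"
    with insert.prems have "x \<in> lspan R M (insert a A)" by auto
    then obtain r t where r: "r \<in> carrier R" "t \<in> lspan R M A" "x = r \<odot>\<^bsub>M\<^esub> a \<oplus>\<^bsub>M\<^esub> t"
      using lspan_insertE[OF M insert.prems(1)] by metis
    hence "r \<in> ?I" using x by auto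
    then obtain t' where t': "t' \<in> lspan R M A" "r \<odot>\<^bsub>M\<^esub> a \<oplus>\<^bsub>M\<^esub> t' \<in> lspan R M B1" using I by auto
    let ?y = "r \<odot>\<^bsub>M\<^esub> a \<oplus>\<^bsub>M\<^esub> t'"
    have yK: "?y \<in> K" using t'(2) B1K by auto
    have tM: "t \<in> carrier M" "t' \<in> carrier M" "r \<odot>\<^bsub>M\<^esub> a \<in> carrier M" "x \<in> carrier M" "?y \<in> carrier M"
      using sp(7) r t' aM x k(7) yK by auto
    have "x \<ominus>\<^bsub>M\<^esub> ?y = (r \<odot>\<^bsub>M\<^esub> a \<ominus>\<^bsub>M\<^esub> r \<odot>\<^bsub>M\<^esub> a) \<oplus>\<^bsub>M\<^esub> (t \<ominus>\<^bsub>M\<^esub> t')"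
      unfolding r(3) using tM by (intro M.minus_add_minus)
    also have "\<dots> = t \<ominus>\<^bsub>M\<^esub> t'" using tM by (simp add: M.M.minus_zero_iff[THEN iffD2])
    finally have "x \<ominus>\<^bsub>M\<^esub> ?y \<in> K \<inter> lspan R M A" using k(6)[OF x yK] sp(6)[OF r(2) t'(1)] by simp
    hence "x \<ominus>\<^bsub>M\<^esub> ?y \<in> lspan R M (B1 \<union> B0)" using B0(3) mono1 by auto
    moreover have "?y \<in> lspan R M (B1 \<union> B0)" using t'(2) mono1 by auto
    ultimately have "?y \<oplus>\<^bsub>M\<^esub> (x \<ominus>\<^bsub>M\<^esub> ?y) \<in> lspan R M (B1 \<union> B0)" using sB(5) by auto
    thus "x \<in> lspan R M (B1 \<union> B0)" using M.minus_minus_cancel(2)[of x ?y] tM by simp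
  qed
  moreover have "lspan R M (B1 \<union> B0) \<subseteq> K" by (rule lspan_least[OF M insert.prems(2) BK])
  moreover have "finite (B1 \<union> B0)" using X B0 by (auto simp: B1_def)
  ultimately show ?case using BK by blast
qed

lemma submodule_finitely_generated:
  assumes M: "module R M" and fg: "finitely_generated R M" and K: "submodule K R M"
  shows "finitely_generated R (M\<lparr>carrier := K\<rparr>)"
proof -
  obtain A where A: "finite A" "A \<subseteq> carrier M" "lspan R M A = carrier M"
    using fg unfolding finitely_generated_iff_lspan[OF M] by auto
  have "K \<subseteq> lspan R M A" using submoduleD(1)[OF M K] A(3) by auto
  from submodule_of_finite_lspan[OF M A(1,2) K this] show ?thesis
    unfolding finitely_generated_iff_lspan[OF submodule.submodule_is_module[OF K M]] lspan_carrier_update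
    by simp
qed

text \<open>A generating set of least cardinality gives a free cover whose kernel lies in \<open>\<mm> F\<close>: a
  relation with a coefficient outside \<open>\<mm>\<close>, hence invertible, would make a generator redundant.\<close>

lemma minimal_cover:
  assumes M: "module R M" and fg: "finitely_generated R M"
  shows "\<exists>(F :: ('a, nat \<Rightarrow> 'a) module) \<epsilon>. module R F \<and> free_of_finite_rank R F \<and>
    \<epsilon> \<in> module_hom R F M \<and> \<epsilon> ` carrier F = carrier M \<and> a_kernel F M \<epsilon> \<subseteq> mpow R (Suc 0) F"
proof -
  interpret M: module R M by fact
  define G where "G A \<longleftrightarrow> finite A \<and> A \<subseteq> carrier M \<and> lspan R M A = carrier M" for A
  have "\<exists>A. G A" using fg finitely_generated_iff_lspan[OF M] by (auto simp: G_def)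
  then obtain A where "G A" and least: "\<And>B. G B \<Longrightarrow> card A \<le> card B"
    using ex_has_least_nat[of G _ card] by metis
  hence A: "finite A" "A \<subseteq> carrier M" "lspan R M A = carrier M" by (auto simp: G_def)
  define n where "n = card A"
  obtain h where h: "bij_betw h {..<n} A"
    using ex_bij_betw_nat_finite[OF A(1)] by (auto simp: n_def atLeast0LessThan)
  have hM: "\<And>j. j < n \<Longrightarrow> h j \<in> carrier M" and hA: "\<And>j. j < n \<Longrightarrow> h j \<in> A"
    using h A(2) by (auto simp: bij_betw_def)
  define F where "F = free_module R {..<n}"
  note rm = ring_as_module_module[OF is_cring]
  have F: "module R F" unfolding F_def by (rule free_module_module[OF is_cring])
  have Ff: "free_of_finite_rank R F" unfolding F_def by (rule free_module_free) simp
  have Fx: "\<And>x j. x \<in> carrier F \<Longrightarrow> j < n \<Longrightarrow> x j \<in> carrier R"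
    by (auto simp: F_def free_module_simps)
  define \<epsilon> where "\<epsilon> = lincomb M {..<n} h"
  have \<epsilon>: "\<epsilon> \<in> module_hom R F M" unfolding \<epsilon>_def F_def using hM by (intro lincomb_hom[OF M]) auto
  have surj: "\<epsilon> ` carrier F = carrier M"
    unfolding \<epsilon>_def F_def using lspan_image[OF M, of "{..<n}" h] hM h A(3) by (simp add: bij_betw_def)
  have "x \<in> mpow R (Suc 0) F" if x: "x \<in> carrier F" and x0: "\<epsilon> x = \<zero>\<^bsub>M\<^esub>" for x
  proof -
    have xm: "x i \<in> \<mm>" if i: "i < n" for i
    proof (rule ccontr)
      assume "x i \<notin> \<mm>"
      hence u: "x i \<in> Units R" using Units_outside_max_ideal Fx[OF x i] by auto
      let ?B = "A - {h i}"
      have BM: "?B \<subseteq> carrier M" using A by auto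
      note sB = submoduleD[OF M lspan_submodule[OF M BM]]
      have hB: "h j \<in> ?B" if "j < n" "j \<noteq> i" for j
        using that i hA h by (auto simp: bij_betw_def inj_on_def)
      let ?t = "(\<Oplus>\<^bsub>M\<^esub>j\<in>{..<n} - {i}. x j \<odot>\<^bsub>M\<^esub> h j)"
      have t: "?t \<in> lspan R M ?B"
        using Fx[OF x] hB by (intro submodule_finsum[OF M lspan_submodule[OF M BM]]) (auto intro!: lspan.smult intro: lspan.gen)
      have "\<epsilon> x = (\<Oplus>\<^bsub>M\<^esub>j\<in>insert i ({..<n} - {i}). x j \<odot>\<^bsub>M\<^esub> h j)"
        unfolding \<epsilon>_def lincomb_def using i by (simp add: insert_absorb)
      also have "\<dots> = x i \<odot>\<^bsub>M\<^esub> h i \<oplus>\<^bsub>M\<^esub> ?t"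
        using Fx[OF x] hM i by (intro M.finsum_insert) auto
      (* The relation now expresses the generator h i by the others. *)
      finally have "x i \<odot>\<^bsub>M\<^esub> h i \<oplus>\<^bsub>M\<^esub> ?t = \<zero>\<^bsub>M\<^esub>" using x0 by simp
      hence "\<ominus>\<^bsub>M\<^esub> ?t = x i \<odot>\<^bsub>M\<^esub> h i"
        using sB(7)[OF t] Fx[OF x i] hM[OF i] by (intro M.minus_equality) auto
      hence "x i \<odot>\<^bsub>M\<^esub> h i \<in> lspan R M ?B" using sB(3)[OF t] by simp
      hence "inv (x i) \<odot>\<^bsub>M\<^esub> (x i \<odot>\<^bsub>M\<^esub> h i) \<in> lspan R M ?B" using u sB(4) by auto
      moreover have "inv (x i) \<odot>\<^bsub>M\<^esub> (x i \<odot>\<^bsub>M\<^esub> h i) = h i"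
        using u Fx[OF x i] hM[OF i] by (simp add: M.smult_assoc1[symmetric])
      ultimately have "h i \<in> lspan R M ?B" by simp
      hence "A \<subseteq> lspan R M ?B" by (auto intro: lspan.gen)
      from lspan_least[OF M lspan_submodule[OF M BM] this]
      have "G ?B" unfolding G_def using A sB(1) BM by auto
      from least[OF this] show False using A(1) hA[OF i] by (metis card_Diff1_less not_le)
    qed
    have "x i \<in> mpow R (Suc 0) (ring_as_module R)" if "i < n" for i
    proof -
      have "\<one> \<in> mpow R 0 (ring_as_module R)" by (simp add: mpow_0[OF rm] ring_as_module_simps)
      from mpow_SucI[OF rm xm[OF that] this] show ?thesis
        using Fx[OF x that] by (simp add: ring_as_module_simps)
    qed
    thus ?thesis unfolding F_def free_module_def mpow_power[OF rm finite_lessThan] using x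
      by (auto simp: F_def free_module_simps PiE_iff)
  qed
  hence "a_kernel F M \<epsilon> \<subseteq> mpow R (Suc 0) F" by (auto simp: a_kernel_iff)
  with F Ff \<epsilon> surj show ?thesis by (intro exI[of _ F] exI[of _ \<epsilon>] conjI)
qed

lemma kernel_finitely_generated:
  assumes "module R F" "free_of_finite_rank R F" "module R N" "e \<in> module_hom R F N"
  shows "module R (F\<lparr>carrier := a_kernel F N e\<rparr>)" "finitely_generated R (F\<lparr>carrier := a_kernel F N e\<rparr>)"
  using submodule_finitely_generated[OF assms(1) free_finitely_generated[OF assms(1,2)]]
    submodule.submodule_is_module submodule_kernel[OF assms(1,3,4)] assms(1) by blast+

text \<open>Each module of the resolution is a minimal cover of the kernel of the previous map, which is
  finitely generated by noetherianity.\<close>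

lemma minimal_free_resolution_exists:
  assumes M: "module R M" and fg: "finitely_generated R M"
  shows "\<exists>(F :: nat \<Rightarrow> ('a, nat \<Rightarrow> 'a) module) d \<epsilon>. minimal_free_resolution R M F d \<epsilon>"
proof -
  obtain F0 :: "('a, nat \<Rightarrow> 'a) module" and \<epsilon> where F0: "module R F0" "free_of_finite_rank R F0"
    "\<epsilon> \<in> module_hom R F0 M" "\<epsilon> ` carrier F0 = carrier M" "a_kernel F0 M \<epsilon> \<subseteq> mpow R (Suc 0) F0"
    using minimal_cover[OF M fg] by blast
  define is_cover :: "('a, nat \<Rightarrow> 'a) module \<Rightarrow> ('a, nat \<Rightarrow> 'a) module \<times> ((nat \<Rightarrow> 'a) \<Rightarrow> (nat \<Rightarrow> 'a)) \<Rightarrow> bool"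
    where "is_cover K p \<longleftrightarrow> module R (fst p) \<and> free_of_finite_rank R (fst p) \<and>
      snd p \<in> module_hom R (fst p) K \<and> snd p ` carrier (fst p) = carrier K \<and>
      a_kernel (fst p) K (snd p) \<subseteq> mpow R (Suc 0) (fst p)" for K p
  define cov where "cov K = (SOME p. is_cover K p)" for K
  have cov: "is_cover K (cov K)" if K: "module R K" "finitely_generated R K" for K
  proof -
    obtain F :: "('a, nat \<Rightarrow> 'a) module" and e where "module R F \<and> free_of_finite_rank R F \<and>
      e \<in> module_hom R F K \<and> e ` carrier F = carrier K \<and> a_kernel F K e \<subseteq> mpow R (Suc 0) F"
      using minimal_cover[OF K] by (elim exE)
    hence "is_cover K (F, e)" by (simp add: is_cover_def)
    thus ?thesis unfolding cov_def by (rule someI)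
  qed
  (* The module syz i is the kernel of the map out of F i, to be covered by F (i + 1). *)
  define next_syz where "next_syz K = (fst (cov K))\<lparr>carrier := a_kernel (fst (cov K)) K (snd (cov K))\<rparr>" for K
  define syz where "syz = rec_nat (F0\<lparr>carrier := a_kernel F0 M \<epsilon>\<rparr>) (\<lambda>_. next_syz)"
  have syz0: "syz 0 = F0\<lparr>carrier := a_kernel F0 M \<epsilon>\<rparr>" and syzS: "syz (Suc i) = next_syz (syz i)" for i
    by (simp_all add: syz_def)
  have inv: "module R (syz i) \<and> finitely_generated R (syz i)" for i
  proof (induction i)
    case 0 thus ?case unfolding syz0 using kernel_finitely_generated[OF F0(1,2) M F0(3)] by simp
  next
    case (Suc i)
    hence K: "module R (syz i)" "finitely_generated R (syz i)" by auto
    note c = cov[OF this, unfolded is_cover_def]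
    show ?case
      unfolding syzS next_syz_def
      using kernel_finitely_generated[OF conjunct1[OF c] conjunct1[OF conjunct2[OF c]] K(1)
        conjunct1[OF conjunct2[OF conjunct2[OF c]]]] by (rule conjI)
  qed
  note c = cov[OF conjunct1[OF inv] conjunct2[OF inv], unfolded is_cover_def]
  define F where "F = case_nat F0 (\<lambda>j. fst (cov (syz j)))"
  define d where "d = case_nat undefined (\<lambda>j. snd (cov (syz j)))"
  define Z where "Z = case_nat (a_kernel F0 M \<epsilon>) (\<lambda>j. a_kernel (F (Suc j)) (syz j) (d (Suc j)))"
  have FS: "F (Suc i) = fst (cov (syz i))" and dS: "d (Suc i) = snd (cov (syz i))" for i
    by (simp_all add: F_def d_def)
  have syz: "syz i = (F i)\<lparr>carrier := Z i\<rparr>" for i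
    by (cases i) (simp_all add: syz0 syzS next_syz_def Z_def F_def d_def)
  have Zsub: "Z i \<subseteq> carrier (F i)" for i
    by (cases i) (auto simp: Z_def F_def a_kernel_iff)
  have dim: "d (Suc i) ` carrier (F (Suc i)) = Z i" for i
    using c[of i] unfolding FS[symmetric] dS[symmetric] by (simp add: syz)
  have dhom: "d (Suc i) \<in> module_hom R (F (Suc i)) (syz i)" for i
    using c[of i] unfolding FS[symmetric] dS[symmetric] by simp
  have Zm: "Z i \<subseteq> mpow R (Suc 0) (F i)" for i
  proof (cases i)
    case 0 thus ?thesis using F0 by (simp add: Z_def F_def)
  next
    case (Suc j) thus ?thesis using c[of j] unfolding FS[symmetric] dS[symmetric] by (simp add: Z_def)
  qed
  have "minimal_free_resolution R M F d \<epsilon>"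
  proof (rule minimal_free_resolutionI)
    show "module R (F i)" "free_of_finite_rank R (F i)" for i
      using F0 c by (cases i; simp add: F_def)+
    show "d (Suc i) \<in> module_hom R (F (Suc i)) (F i)" for i
    proof (rule homI)
      fix x assume x: "x \<in> carrier (F (Suc i))"
      show "d (Suc i) x \<in> carrier (F i)" using dim[of i] Zsub[of i] x by auto
      show "d (Suc i) (x \<oplus>\<^bsub>F (Suc i)\<^esub> y) = d (Suc i) x \<oplus>\<^bsub>F i\<^esub> d (Suc i) y" if "y \<in> carrier (F (Suc i))" for y
        using homD(2)[OF dhom x that] by (simp add: syz)
      show "d (Suc i) (r \<odot>\<^bsub>F (Suc i)\<^esub> x) = r \<odot>\<^bsub>F i\<^esub> d (Suc i) x" if "r \<in> carrier R" for r
        using homD(3)[OF dhom that x] by (simp add: syz)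
    qed
    show "\<epsilon> \<in> module_hom R (F 0) M" "\<epsilon> ` carrier (F 0) = carrier M" using F0 by (simp_all add: F_def)
    have Z0: "x \<in> Z 0 \<longleftrightarrow> x \<in> carrier (F 0) \<and> \<epsilon> x = \<zero>\<^bsub>M\<^esub>" for x by (simp add: Z_def F_def a_kernel_iff)
    have ZS: "x \<in> Z (Suc i) \<longleftrightarrow> x \<in> carrier (F (Suc i)) \<and> d (Suc i) x = \<zero>\<^bsub>F i\<^esub>" for x i
    proof -
      have "Z (Suc i) = a_kernel (F (Suc i)) (syz i) (d (Suc i))" by (simp add: Z_def)
      moreover have "\<zero>\<^bsub>syz i\<^esub> = \<zero>\<^bsub>F i\<^esub>" by (subst syz) simp
      ultimately show ?thesis by (simp add: a_kernel_iff)
    qed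
    show "x \<in> d (Suc 0) ` carrier (F (Suc 0))" if "x \<in> carrier (F 0)" "\<epsilon> x = \<zero>\<^bsub>M\<^esub>" for x
      unfolding dim using that by (simp add: Z0)
    show "\<epsilon> (d (Suc 0) x) = \<zero>\<^bsub>M\<^esub>" if "x \<in> carrier (F (Suc 0))" for x
      using dim[of 0] Z0 that by blast
    show "x \<in> d (Suc (Suc i)) ` carrier (F (Suc (Suc i)))"
      if "x \<in> carrier (F (Suc i))" "d (Suc i) x = \<zero>\<^bsub>F i\<^esub>" for i x
      unfolding dim using that by (simp add: ZS)
    show "d (Suc i) (d (Suc (Suc i)) x) = \<zero>\<^bsub>F i\<^esub>" if "x \<in> carrier (F (Suc (Suc i)))" for i x
      using dim[of "Suc i"] ZS that by blast
    show "d (Suc i) x \<in> mpow R (Suc 0) (F i)" if "x \<in> carrier (F (Suc i))" for i x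
      using dim[of i] Zm[of i] that by blast
  qed
  thus ?thesis by blast
qed

lemma minimal_free_resolution_iso:
  assumes M: "module R M" and N: "module R N" and F: "minimal_free_resolution R M F d \<epsilon>"
    and \<theta>: "\<theta> \<in> module_hom R M N" "bij_betw \<theta> (carrier M) (carrier N)"
  shows "minimal_free_resolution R N F d (\<lambda>x. \<theta> (\<epsilon> x))"
proof -
  note f = minimal_free_resolutionD[OF F M]
  have z: "\<theta> y = \<zero>\<^bsub>N\<^esub> \<longleftrightarrow> y = \<zero>\<^bsub>M\<^esub>" if "y \<in> carrier M" for y
  proof -
    interpret M: module R M by fact
    show ?thesis
      using that hom_arith(1)[OF M N \<theta>(1)] \<theta>(2) M.M.zero_closed unfolding bij_betw_def inj_on_def by metis
  qed
  show ?thesis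
  proof (rule minimal_free_resolutionI[OF f(1,2,3) hom_compose[OF f(4) \<theta>(1)]])
    show "(\<lambda>x. \<theta> (\<epsilon> x)) ` carrier (F 0) = carrier N"
      using f(5) \<theta>(2) unfolding bij_betw_def by (metis image_image)
    show "x \<in> d (Suc 0) ` carrier (F (Suc 0))" if "x \<in> carrier (F 0)" "\<theta> (\<epsilon> x) = \<zero>\<^bsub>N\<^esub>" for x
      using f(6)[OF that(1)] that z homD(1)[OF f(4)] by auto
    show "\<theta> (\<epsilon> (d (Suc 0) x)) = \<zero>\<^bsub>N\<^esub>" if "x \<in> carrier (F (Suc 0))" for x
      using f(7)[OF that] hom_arith(1)[OF M N \<theta>(1)] by simp
  qed (fact f)+
qed

end

section \<open>The linear part and vanishing of maps on Tor\<close>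

lemma coset_iff: "x \<in> H +>\<^bsub>M\<^esub> u \<longleftrightarrow> (\<exists>h\<in>H. x = h \<oplus>\<^bsub>M\<^esub> u)"
  by (auto simp: a_r_coset_def')

lemma coset_eq_iff:
  assumes M: "module R M" and H: "submodule H R M" and uv: "u \<in> carrier M" "v \<in> carrier M"
  shows "H +>\<^bsub>M\<^esub> u = H +>\<^bsub>M\<^esub> v \<longleftrightarrow> u \<ominus>\<^bsub>M\<^esub> v \<in> H"
proof -
  interpret M: module R M by fact
  note h = submoduleD[OF M H]
  have 1: "H +>\<^bsub>M\<^esub> u \<subseteq> H +>\<^bsub>M\<^esub> v" if uv: "u \<in> carrier M" "v \<in> carrier M" and "u \<ominus>\<^bsub>M\<^esub> v \<in> H" for u v
  proof
    fix x assume "x \<in> H +>\<^bsub>M\<^esub> u"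
    then obtain k where k: "k \<in> H" "x = k \<oplus>\<^bsub>M\<^esub> u" by (auto simp: coset_iff)
    have "x = (k \<oplus>\<^bsub>M\<^esub> (u \<ominus>\<^bsub>M\<^esub> v)) \<oplus>\<^bsub>M\<^esub> v"
      using k uv h(7) by (simp add: M.M.add.m_assoc M.minus_minus_cancel(3))
    thus "x \<in> H +>\<^bsub>M\<^esub> v" using h(5)[OF k(1) that(3)] by (auto simp: coset_iff)
  qed
  show ?thesis
  proof
    assume "H +>\<^bsub>M\<^esub> u = H +>\<^bsub>M\<^esub> v"
    moreover have "u \<in> H +>\<^bsub>M\<^esub> u" using h(2) uv by (auto simp: coset_iff intro!: bexI[of _ "\<zero>\<^bsub>M\<^esub>"])
    ultimately obtain k where k: "k \<in> H" "u = k \<oplus>\<^bsub>M\<^esub> v" by (auto simp: coset_iff)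
    have "u \<ominus>\<^bsub>M\<^esub> v = k" unfolding k(2) using k(1) h(7) uv by (intro M.minus_minus_cancel(4)) auto
    thus "u \<ominus>\<^bsub>M\<^esub> v \<in> H" using k by simp
  next
    assume a: "u \<ominus>\<^bsub>M\<^esub> v \<in> H"
    have "v \<ominus>\<^bsub>M\<^esub> u = \<ominus>\<^bsub>M\<^esub> (u \<ominus>\<^bsub>M\<^esub> v)"
      using uv by (simp add: a_minus_def M.minus_add M.M.add.m_comm)
    hence "v \<ominus>\<^bsub>M\<^esub> u \<in> H" using h(3)[OF a] by simp
    thus "H +>\<^bsub>M\<^esub> u = H +>\<^bsub>M\<^esub> v" using 1[OF uv a] 1[OF uv(2,1)] by auto
  qed
qed

lemma coset_zero:
  assumes M: "module R M" and H: "submodule H R M"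
  shows "H +>\<^bsub>M\<^esub> \<zero>\<^bsub>M\<^esub> = H"
proof -
  interpret M: module R M by fact
  show ?thesis using submoduleD(7)[OF M H] by (force simp: coset_iff)
qed

lemma coset_add:
  assumes M: "module R M" and H: "submodule H R M" and uv: "u \<in> carrier M" "v \<in> carrier M"
  shows "(H +>\<^bsub>M\<^esub> u) <+>\<^bsub>M\<^esub> (H +>\<^bsub>M\<^esub> v) = H +>\<^bsub>M\<^esub> (u \<oplus>\<^bsub>M\<^esub> v)"
proof -
  interpret M: module R M by fact
  note h = submoduleD[OF M H]
  show ?thesis
  proof (intro equalityI subsetI)
    fix x assume "x \<in> (H +>\<^bsub>M\<^esub> u) <+>\<^bsub>M\<^esub> (H +>\<^bsub>M\<^esub> v)"
    then obtain k l where k: "k \<in> H" "l \<in> H" "x = (k \<oplus>\<^bsub>M\<^esub> u) \<oplus>\<^bsub>M\<^esub> (l \<oplus>\<^bsub>M\<^esub> v)"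
      by (auto simp: set_add_def' coset_iff)
    have "x = (k \<oplus>\<^bsub>M\<^esub> l) \<oplus>\<^bsub>M\<^esub> (u \<oplus>\<^bsub>M\<^esub> v)"
      unfolding k(3) using h(7)[OF k(1)] h(7)[OF k(2)] uv by (simp add: M.M.add.m_ac)
    thus "x \<in> H +>\<^bsub>M\<^esub> (u \<oplus>\<^bsub>M\<^esub> v)" using h(5)[OF k(1,2)] by (auto simp: coset_iff)
  next
    fix x assume "x \<in> H +>\<^bsub>M\<^esub> (u \<oplus>\<^bsub>M\<^esub> v)"
    then obtain k where k: "k \<in> H" "x = k \<oplus>\<^bsub>M\<^esub> (u \<oplus>\<^bsub>M\<^esub> v)" by (auto simp: coset_iff)
    have "x = (k \<oplus>\<^bsub>M\<^esub> u) \<oplus>\<^bsub>M\<^esub> (\<zero>\<^bsub>M\<^esub> \<oplus>\<^bsub>M\<^esub> v)"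
      unfolding k(2) using h(7)[OF k(1)] uv by (simp add: M.M.add.m_ac)
    thus "x \<in> (H +>\<^bsub>M\<^esub> u) <+>\<^bsub>M\<^esub> (H +>\<^bsub>M\<^esub> v)"
      using k(1) h(2) unfolding set_add_def' by (fastforce simp: coset_iff)
  qed
qed

context noetherian_local_ring
begin

context
  fixes M :: "('a, 'm) module" and F :: "nat \<Rightarrow> ('a, 'f) module" and d \<epsilon>
  assumes M: "module R M" and F: "minimal_free_resolution R M F d \<epsilon>"
begin

interpretation Fi: module R "F i" for i
  by (rule minimal_free_resolutionD(1)[OF F M])

lemma filt_mpow: "filt R F n i = mpow R (n - i) (F i)"
  by (simp add: filt_def mpow_def)

lemma filt_submodule: "submodule (filt R F n i) R (F i)"
  unfolding filt_mpow by (rule mpow_submodule) (rule Fi.module_axioms)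

lemmas filtD = submoduleD[OF Fi.module_axioms filt_submodule]

lemmas d_hom = minimal_free_resolutionD(3)[OF F M]
lemmas d_arith = homD[OF d_hom] hom_arith[OF Fi.module_axioms Fi.module_axioms d_hom]

lemma d_filt:
  assumes "x \<in> filt R F n (Suc i)"
  shows "d (Suc i) x \<in> filt R F n i"
proof -
  have "d (Suc i) x \<in> mpow R (n - Suc i + Suc 0) (F i)"
    using mpow_hom[OF Fi.module_axioms Fi.module_axioms d_hom minimal_free_resolutionD(10)[OF F M]]
      assms unfolding filt_mpow by blast
  moreover have "n - i \<le> n - Suc i + Suc 0" by simp
  ultimately show ?thesis unfolding filt_mpow using mpow_antimono[OF Fi.module_axioms] by blast
qed

definition gr_class :: "nat \<Rightarrow> nat \<Rightarrow> 'f \<Rightarrow> 'f set"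
  where "gr_class n i u = filt R F (Suc n) i +>\<^bsub>F i\<^esub> u"

text \<open>Representatives of the elements of the linear part, with zero representing the zero class, so that
  they inherit finite support.\<close>

definition finite_seqs :: "nat \<Rightarrow> (nat \<Rightarrow> 'f) set"
  where "finite_seqs i = {u. (\<forall>n. u n \<in> filt R F n i) \<and> finite {n. u n \<noteq> \<zero>\<^bsub>F i\<^esub>}}"

lemma finite_seqs_carrier: "u \<in> finite_seqs i \<Longrightarrow> u n \<in> carrier (F i)"
  using filtD(7) by (auto simp: finite_seqs_def)

lemma gr_class_eq_iff:
  "u \<in> carrier (F i) \<Longrightarrow> v \<in> carrier (F i) \<Longrightarrow>
    gr_class n i u = gr_class n i v \<longleftrightarrow> u \<ominus>\<^bsub>F i\<^esub> v \<in> filt R F (Suc n) i"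
  unfolding gr_class_def by (rule coset_eq_iff[OF Fi.module_axioms filt_submodule])

lemma gr_zero: "\<zero>\<^bsub>gr R F n i\<^esub> = gr_class n i \<zero>\<^bsub>F i\<^esub>"
  by (simp add: gr_def quot_module_def gr_class_def coset_zero[OF Fi.module_axioms filt_submodule])

lemma gr_carrier: "carrier (gr R F n i) = gr_class n i ` filt R F n i"
  by (auto simp: gr_def quot_module_def gr_class_def A_RCOSETS_def' a_r_coset_def')

lemma lin_carrier: "carrier (lin R F i) = (\<lambda>u n. gr_class n i (u n)) ` finite_seqs i"
proof (intro equalityI subsetI)
  fix x assume "x \<in> carrier (lin R F i)"
  hence x: "\<And>n. x n \<in> gr_class n i ` filt R F n i" "finite {n. x n \<noteq> gr_class n i \<zero>\<^bsub>F i\<^esub>}"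
    by (auto simp: lin_def direct_sum_def gr_zero gr_carrier)
  have "\<exists>u. u \<in> filt R F n i \<and> x n = gr_class n i u \<and> (x n = gr_class n i \<zero>\<^bsub>F i\<^esub> \<longrightarrow> u = \<zero>\<^bsub>F i\<^esub>)" for n
    using x(1)[of n] filtD(2)[of i n] by (cases "x n = gr_class n i \<zero>\<^bsub>F i\<^esub>") auto
  then obtain u where u: "\<And>n. u n \<in> filt R F n i" "\<And>n. x n = gr_class n i (u n)"
    "\<And>n. x n = gr_class n i \<zero>\<^bsub>F i\<^esub> \<Longrightarrow> u n = \<zero>\<^bsub>F i\<^esub>" by metis
  have "finite {n. u n \<noteq> \<zero>\<^bsub>F i\<^esub>}" using u(3) by (intro finite_subset[OF _ x(2)]) auto
  hence "u \<in> finite_seqs i" using u(1) by (simp add: finite_seqs_def)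
  moreover have "x = (\<lambda>n. gr_class n i (u n))" using u(2) by (rule ext)
  ultimately show "x \<in> (\<lambda>u n. gr_class n i (u n)) ` finite_seqs i" by blast
next
  fix x assume "x \<in> (\<lambda>u n. gr_class n i (u n)) ` finite_seqs i"
  then obtain u where u: "u \<in> finite_seqs i" "x = (\<lambda>n. gr_class n i (u n))" by auto
  have "finite {n. gr_class n i (u n) \<noteq> gr_class n i \<zero>\<^bsub>F i\<^esub>}"
    by (rule finite_subset[of _ "{n. u n \<noteq> \<zero>\<^bsub>F i\<^esub>}"]) (use u(1) in \<open>auto simp: finite_seqs_def\<close>)
  thus "x \<in> carrier (lin R F i)"
    using u by (auto simp: lin_def direct_sum_def gr_zero gr_carrier finite_seqs_def)
qed

lemma lin_zero: "\<zero>\<^bsub>lin R F i\<^esub> = (\<lambda>n. gr_class n i \<zero>\<^bsub>F i\<^esub>)"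
  by (simp add: lin_def direct_sum_def gr_zero)

lemma lin_add:
  assumes "u \<in> finite_seqs i" "v \<in> finite_seqs i"
  shows "(\<lambda>n. gr_class n i (u n)) \<oplus>\<^bsub>lin R F i\<^esub> (\<lambda>n. gr_class n i (v n)) = (\<lambda>n. gr_class n i (u n \<oplus>\<^bsub>F i\<^esub> v n))"
proof -
  have "set_add ((F i)\<lparr>carrier := H\<rparr>) = set_add (F i)" for H by (intro ext) (simp add: set_add_def')
  thus ?thesis
    using finite_seqs_carrier[OF assms(1)] finite_seqs_carrier[OF assms(2)]
    by (simp add: lin_def direct_sum_def gr_def quot_module_def gr_class_def
        coset_add[OF Fi.module_axioms filt_submodule])
qed

lemma gr_diff_class:
  assumes u: "u \<in> carrier (F (Suc i))"
  shows "gr_diff R F d n (Suc i) (gr_class n (Suc i) u) = gr_class n i (d (Suc i) u)"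
proof -
  have "filt R F (Suc n) i +>\<^bsub>F i\<^esub> d (Suc i) x = gr_class n i (d (Suc i) u)"
    if x: "x \<in> gr_class n (Suc i) u" for x
  proof -
    obtain h where h: "h \<in> filt R F (Suc n) (Suc i)" "x = h \<oplus>\<^bsub>F (Suc i)\<^esub> u"
      using x by (auto simp: gr_class_def coset_iff)
    have hc: "h \<in> carrier (F (Suc i))" using filtD(7) h by auto
    have "d (Suc i) x \<ominus>\<^bsub>F i\<^esub> d (Suc i) u = d (Suc i) h"
      unfolding h(2) using hc u d_arith(1) by (simp add: d_arith(2) Fi.minus_minus_cancel(4))
    hence "d (Suc i) x \<ominus>\<^bsub>F i\<^esub> d (Suc i) u \<in> filt R F (Suc n) i" using d_filt[OF h(1)] by simp
    moreover have "d (Suc i) x \<in> carrier (F i)" using h hc u d_arith(1) by auto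
    ultimately show ?thesis unfolding gr_class_def
      using coset_eq_iff[OF Fi.module_axioms filt_submodule] d_arith(1)[OF u] by blast
  qed
  moreover have "u \<in> gr_class n (Suc i) u"
    unfolding gr_class_def coset_iff using filtD(2) u by (intro bexI[of _ "\<zero>\<^bsub>F (Suc i)\<^esub>"]) auto
  ultimately have "(\<Union>x\<in>gr_class n (Suc i) u. filt R F (Suc n) i +>\<^bsub>F i\<^esub> d (Suc i) x) = gr_class n i (d (Suc i) u)"
    by blast
  thus ?thesis by (simp add: gr_diff_def)
qed

lemma lin_diff_class:
  assumes "u \<in> finite_seqs (Suc i)"
  shows "lin_diff R F d (Suc i) (\<lambda>n. gr_class n (Suc i) (u n)) = (\<lambda>n. gr_class n i (d (Suc i) (u n)))"
  by (simp add: lin_diff_def gr_diff_class[OF finite_seqs_carrier[OF assms]])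

lemma d_finite_seqs:
  assumes "u \<in> finite_seqs (Suc i)"
  shows "(\<lambda>n. d (Suc i) (u n)) \<in> finite_seqs i"
proof -
  have "finite {n. d (Suc i) (u n) \<noteq> \<zero>\<^bsub>F i\<^esub>}"
    by (rule finite_subset[of _ "{n. u n \<noteq> \<zero>\<^bsub>F (Suc i)\<^esub>}"]) (use assms in \<open>auto simp: finite_seqs_def d_arith\<close>)
  thus ?thesis using assms d_filt by (auto simp: finite_seqs_def)
qed

lemma finite_seqs_ops:
  assumes "u \<in> finite_seqs i" "v \<in> finite_seqs i"
  shows "(\<lambda>n. u n \<oplus>\<^bsub>F i\<^esub> v n) \<in> finite_seqs i" "(\<lambda>n. u n \<ominus>\<^bsub>F i\<^esub> v n) \<in> finite_seqs i"
proof -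
  have fin: "finite ({n. u n \<noteq> \<zero>\<^bsub>F i\<^esub>} \<union> {n. v n \<noteq> \<zero>\<^bsub>F i\<^esub>})" using assms by (simp add: finite_seqs_def)
  have "finite {n. u n \<oplus>\<^bsub>F i\<^esub> v n \<noteq> \<zero>\<^bsub>F i\<^esub>}" "finite {n. u n \<ominus>\<^bsub>F i\<^esub> v n \<noteq> \<zero>\<^bsub>F i\<^esub>}"
    by (rule finite_subset[OF _ fin]; auto simp: a_minus_def)+
  thus "(\<lambda>n. u n \<oplus>\<^bsub>F i\<^esub> v n) \<in> finite_seqs i" "(\<lambda>n. u n \<ominus>\<^bsub>F i\<^esub> v n) \<in> finite_seqs i"
    using assms filtD(5,6) by (auto simp: finite_seqs_def)
qed

lemma zero_finite_seqs: "(\<lambda>n. \<zero>\<^bsub>F i\<^esub>) \<in> finite_seqs i"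
  using filtD(2) by (simp add: finite_seqs_def)

text \<open>Exactness of the linear part in a positive degree, with cosets replaced by representatives. A family
  concentrated in one degree \<open>n\<close> isolates the condition for this \<open>n\<close>.\<close>

lemma homology_lin_trivial_iff:
  "carrier (homology (lin R F) (lin_diff R F d) (Suc i)) = {\<zero>\<^bsub>homology (lin R F) (lin_diff R F d) (Suc i)\<^esub>} \<longleftrightarrow>
    (\<forall>n. \<forall>x\<in>filt R F n (Suc i). d (Suc i) x \<in> filt R F (Suc n) i \<longrightarrow>
      (\<exists>y\<in>filt R F n (Suc (Suc i)). x \<ominus>\<^bsub>F (Suc i)\<^esub> d (Suc (Suc i)) y \<in> filt R F (Suc n) (Suc i)))"
  (is "_ \<longleftrightarrow> ?exact")
proof -
  let ?j = "Suc i"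
  define Z where "Z = cycles (lin R F) (lin_diff R F d) ?j"
  define B where "B = boundaries (lin R F) (lin_diff R F d) ?j"
  let ?L = "\<lambda>u n. gr_class n ?j (u n)" and ?D = "\<lambda>y n. gr_class n ?j (d (Suc ?j) (y n))"
  have dcl: "gr_class n i (d ?j x) = gr_class n i \<zero>\<^bsub>F i\<^esub> \<longleftrightarrow> d ?j x \<in> filt R F (Suc n) i"
    if "x \<in> carrier (F ?j)" for n x
    using d_arith(1)[OF that] by (subst gr_class_eq_iff) (auto simp: Fi.minus_zero_right)
  have Z: "z \<in> Z \<longleftrightarrow> (\<exists>u\<in>finite_seqs ?j. z = ?L u \<and> (\<forall>n. d ?j (u n) \<in> filt R F (Suc n) i))" for z
  proof -
    have "lin_diff R F d ?j (?L u) = \<zero>\<^bsub>lin R F i\<^esub> \<longleftrightarrow> (\<forall>n. d ?j (u n) \<in> filt R F (Suc n) i)"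
      if "u \<in> finite_seqs ?j" for u
      unfolding lin_diff_class[OF that] lin_zero fun_eq_iff using dcl[OF finite_seqs_carrier[OF that]] by simp
    thus ?thesis unfolding Z_def cycles_def by (auto simp: a_kernel_iff lin_carrier)
  qed
  have B: "B = ?D ` finite_seqs (Suc ?j)"
    unfolding B_def boundaries_def Suc_eq_plus1[symmetric] lin_carrier image_image
    by (rule image_cong) (simp_all add: lin_diff_class)
  have add: "?L u \<oplus>\<^bsub>lin R F ?j\<^esub> ?L v = ?L (\<lambda>n. u n \<oplus>\<^bsub>F ?j\<^esub> v n)"
    if "u \<in> finite_seqs ?j" "v \<in> finite_seqs ?j" for u v
    using lin_add[OF that] .
  let ?C = "\<lambda>a. B +>\<^bsub>lin R F ?j\<^esub> a"
  have zero_B: "?L (\<lambda>n. \<zero>\<^bsub>F ?j\<^esub>) \<in> B" unfolding B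
    by (rule image_eqI[OF _ zero_finite_seqs]) (simp add: d_arith)
  have coset_B: "?C b = B" if b: "b \<in> B" for b
  proof -
    obtain y where y: "y \<in> finite_seqs (Suc ?j)" "b = ?D y" using b B by auto
    note yc = finite_seqs_carrier[OF y(1)]
    show ?thesis
    proof (intro equalityI subsetI)
      fix x assume "x \<in> ?C b"
      then obtain y' where y': "y' \<in> finite_seqs (Suc ?j)" "x = ?D y' \<oplus>\<^bsub>lin R F ?j\<^esub> b"
        by (auto simp: coset_iff B)
      have "x = ?D (\<lambda>n. y' n \<oplus>\<^bsub>F (Suc ?j)\<^esub> y n)"
        unfolding y' y(2) add[OF d_finite_seqs[OF y'(1)] d_finite_seqs[OF y(1)]]
        by (simp add: d_arith yc finite_seqs_carrier[OF y'(1)])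
      thus "x \<in> B" unfolding B
        by (rule image_eqI[of _ _ "\<lambda>n. y' n \<oplus>\<^bsub>F (Suc ?j)\<^esub> y n"]) (rule finite_seqs_ops(1)[OF y'(1) y(1)])
    next
      fix x assume "x \<in> B"
      then obtain y' where y': "y' \<in> finite_seqs (Suc ?j)" "x = ?D y'" by (auto simp: B)
      note yc' = finite_seqs_carrier[OF y'(1)] and s = finite_seqs_ops(2)[OF y'(1) y(1)]
      have "d (Suc ?j) (y' n) = d (Suc ?j) (y' n \<ominus>\<^bsub>F (Suc ?j)\<^esub> y n) \<oplus>\<^bsub>F ?j\<^esub> d (Suc ?j) (y n)" for n
        using yc yc' by (simp add: d_arith Fi.minus_minus_cancel(3))
      hence "x = ?D (\<lambda>n. y' n \<ominus>\<^bsub>F (Suc ?j)\<^esub> y n) \<oplus>\<^bsub>lin R F ?j\<^esub> b"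
        unfolding y(2) y'(2) add[OF d_finite_seqs[OF s] d_finite_seqs[OF y(1)]] by simp
      moreover have "?D (\<lambda>n. y' n \<ominus>\<^bsub>F (Suc ?j)\<^esub> y n) \<in> B" unfolding B by (rule image_eqI[OF refl s])
      ultimately show "x \<in> ?C b" unfolding coset_iff by blast
    qed
  qed
  have coset_B': "z \<in> B" if z: "z \<in> Z" "?C z = B" for z
  proof -
    obtain u where u: "u \<in> finite_seqs ?j" "z = ?L u" using z Z by auto
    have "?L (\<lambda>n. \<zero>\<^bsub>F ?j\<^esub>) \<oplus>\<^bsub>lin R F ?j\<^esub> z = z"
      unfolding u(2) add[OF zero_finite_seqs u(1)] by (simp add: finite_seqs_carrier[OF u(1)])
    hence "z \<in> ?C z" using zero_B unfolding coset_iff by metis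
    thus ?thesis using z(2) by simp
  qed
  have Z0: "?L (\<lambda>n. \<zero>\<^bsub>F ?j\<^esub>) \<in> Z"
    unfolding Z using zero_finite_seqs filtD(2) by (intro bexI[OF _ zero_finite_seqs]) (simp add: d_arith)
  have "carrier (homology (lin R F) (lin_diff R F d) ?j) = ?C ` Z"
    unfolding homology_def Z_def[symmetric] B_def[symmetric]
    by (auto simp: quot_module_def A_RCOSETS_def' a_r_coset_def')
  moreover have "\<zero>\<^bsub>homology (lin R F) (lin_diff R F d) ?j\<^esub> = B"
    unfolding homology_def Z_def[symmetric] B_def[symmetric] by (simp add: quot_module_def)
  moreover have "?C ` Z = {B} \<longleftrightarrow> Z \<subseteq> B"
  proof
    assume CZ: "?C ` Z = {B}"
    show "Z \<subseteq> B"
    proof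
      fix z assume z: "z \<in> Z"
      hence "?C z \<in> ?C ` Z" by (rule imageI)
      hence "?C z = B" unfolding CZ by (rule singletonD)
      with z show "z \<in> B" by (rule coset_B')
    qed
  next
    assume ZB: "Z \<subseteq> B"
    hence "?C z = B" if "z \<in> Z" for z using coset_B that by (meson subsetD)
    hence "?C ` Z = (\<lambda>_. B) ` Z" by (rule image_cong[OF refl])
    thus "?C ` Z = {B}" using Z0 by (simp add: image_constant_conv) (metis empty_iff)
  qed
  moreover have "Z \<subseteq> B \<longleftrightarrow> ?exact"
  proof
    assume ZB: "Z \<subseteq> B"
    show ?exact
    proof (intro allI ballI impI)
      fix n x assume x: "x \<in> filt R F n ?j" and dx: "d ?j x \<in> filt R F (Suc n) i"
      define u where "u m = (if m = n then x else \<zero>\<^bsub>F ?j\<^esub>)" for m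
      have "finite {m. u m \<noteq> \<zero>\<^bsub>F ?j\<^esub>}" by (rule finite_subset[of _ "{n}"]) (auto simp: u_def)
      hence u: "u \<in> finite_seqs ?j" using x filtD(2) by (auto simp: finite_seqs_def u_def)
      have "d ?j (u m) \<in> filt R F (Suc m) i" for m
        using dx filtD(2) by (simp add: u_def d_arith)
      hence "?L u \<in> Z" unfolding Z by (intro bexI[of _ u] conjI allI u refl)
      hence "?L u \<in> ?D ` finite_seqs (Suc ?j)" using ZB unfolding B by (rule rev_subsetD)
      then obtain y where y: "y \<in> finite_seqs (Suc ?j)" "?L u = ?D y" by (rule imageE)
      from fun_cong[OF y(2), of n] have "gr_class n ?j x = gr_class n ?j (d (Suc ?j) (y n))"
        by (simp add: u_def)
      hence "x \<ominus>\<^bsub>F ?j\<^esub> d (Suc ?j) (y n) \<in> filt R F (Suc n) ?j"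
        using filtD(7)[OF x] finite_seqs_carrier[OF y(1)] d_arith(1) by (subst (asm) gr_class_eq_iff) auto
      thus "\<exists>y\<in>filt R F n (Suc ?j). x \<ominus>\<^bsub>F ?j\<^esub> d (Suc ?j) y \<in> filt R F (Suc n) ?j"
        using y(1) by (auto simp: finite_seqs_def)
    qed
  next
    assume ex: ?exact
    show "Z \<subseteq> B"
    proof
      fix z assume "z \<in> Z"
      then obtain u where u: "u \<in> finite_seqs ?j" "z = ?L u" "\<And>n. d ?j (u n) \<in> filt R F (Suc n) i"
        unfolding Z by auto
      note uc = finite_seqs_carrier[OF u(1)]
      have "\<exists>y. y \<in> filt R F n (Suc ?j) \<and> u n \<ominus>\<^bsub>F ?j\<^esub> d (Suc ?j) y \<in> filt R F (Suc n) ?j \<and>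
          (u n = \<zero>\<^bsub>F ?j\<^esub> \<longrightarrow> y = \<zero>\<^bsub>F (Suc ?j)\<^esub>)" for n
      proof (cases "u n = \<zero>\<^bsub>F ?j\<^esub>")
        case True thus ?thesis using filtD(2) by (intro exI[of _ "\<zero>\<^bsub>F (Suc ?j)\<^esub>"]) (auto simp: d_arith Fi.minus_zero_right)
      next
        case False thus ?thesis using ex u(3) u(1) unfolding finite_seqs_def by blast
      qed
      then obtain y where y: "\<And>n. y n \<in> filt R F n (Suc ?j)"
        "\<And>n. u n \<ominus>\<^bsub>F ?j\<^esub> d (Suc ?j) (y n) \<in> filt R F (Suc n) ?j"
        "\<And>n. u n = \<zero>\<^bsub>F ?j\<^esub> \<Longrightarrow> y n = \<zero>\<^bsub>F (Suc ?j)\<^esub>" by metis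
      have "finite {n. y n \<noteq> \<zero>\<^bsub>F (Suc ?j)\<^esub>}"
        by (rule finite_subset[of _ "{n. u n \<noteq> \<zero>\<^bsub>F ?j\<^esub>}"]) (use u(1) y(3) in \<open>auto simp: finite_seqs_def\<close>)
      hence ys: "y \<in> finite_seqs (Suc ?j)" using y(1) by (simp add: finite_seqs_def)
      have "gr_class n ?j (u n) = gr_class n ?j (d (Suc ?j) (y n))" for n
        using y(2) uc finite_seqs_carrier[OF ys] d_arith(1) by (subst gr_class_eq_iff) auto
      hence "?L u = ?D y" by (rule ext)
      thus "z \<in> B" unfolding B u(2) by (rule image_eqI[of _ _ y]) (rule ys)
    qed
  qed
  ultimately show ?thesis by simp
qed

text \<open>Successive approximation: an element of \<open>\<mm>\<^sup>k F\<^sub>i\<close> whose differential is in \<open>\<mm>\<^sup>q\<^sup>+\<^sup>1 F\<^sub>i\<^sub>-\<^sub>1\<close> represents a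
  cycle of the linear part as long as \<open>k < q\<close>, so that a boundary moves it into \<open>\<mm>\<^sup>k\<^sup>+\<^sup>1 F\<^sub>i\<close>.\<close>

lemma tor_maps_zero_if_homology_lin_trivial:
  assumes "carrier (homology (lin R F) (lin_diff R F d) (Suc i)) =
    {\<zero>\<^bsub>homology (lin R F) (lin_diff R F d) (Suc i)\<^esub>}"
  shows "tor_maps_zero F d (Suc i)"
proof (rule tor_maps_zeroI)
  fix q x assume x: "x \<in> carrier (F (Suc i))" and dx: "d (Suc i) x \<in> mpow R (Suc q) (F i)"
  note ex = assms[unfolded homology_lin_trivial_iff, rule_format]
  have "\<exists>y\<in>carrier (F (Suc (Suc i))). x \<ominus>\<^bsub>F (Suc i)\<^esub> d (Suc (Suc i)) y \<in> mpow R k (F (Suc i))" if "k \<le> q" for k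
    using that
  proof (induction k)
    case 0
    show ?case using x by (intro bexI[of _ "\<zero>\<^bsub>F (Suc (Suc i))\<^esub>"]) (auto simp: mpow_0[OF Fi.module_axioms] d_arith Fi.minus_zero_right)
  next
    case (Suc k)
    then obtain y where y: "y \<in> carrier (F (Suc (Suc i)))"
      "x \<ominus>\<^bsub>F (Suc i)\<^esub> d (Suc (Suc i)) y \<in> mpow R k (F (Suc i))" by auto
    let ?z = "x \<ominus>\<^bsub>F (Suc i)\<^esub> d (Suc (Suc i)) y" and ?n = "Suc i + k"
    have dy: "d (Suc (Suc i)) y \<in> carrier (F (Suc i))" using d_arith(1) y by auto
    have "d (Suc i) ?z = d (Suc i) x"
      using x dy y d_arith(1) minimal_free_resolutionD(9)[OF F M y(1)] by (simp add: d_arith a_minus_def)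
    moreover have "mpow R (Suc q) (F i) \<subseteq> mpow R (Suc (Suc k)) (F i)"
      using Suc.prems by (intro mpow_antimono[OF Fi.module_axioms]) simp
    ultimately have "d (Suc i) ?z \<in> filt R F (Suc ?n) i" using dx by (auto simp: filt_mpow)
    moreover have "?z \<in> filt R F ?n (Suc i)" using y(2) by (simp add: filt_mpow)
    ultimately obtain w where w: "w \<in> filt R F ?n (Suc (Suc i))"
      "?z \<ominus>\<^bsub>F (Suc i)\<^esub> d (Suc (Suc i)) w \<in> filt R F (Suc ?n) (Suc i)" using ex by blast
    have wc: "w \<in> carrier (F (Suc (Suc i)))" using filtD(7) w by auto
    have "?z \<ominus>\<^bsub>F (Suc i)\<^esub> d (Suc (Suc i)) w = x \<ominus>\<^bsub>F (Suc i)\<^esub> d (Suc (Suc i)) (y \<oplus>\<^bsub>F (Suc (Suc i))\<^esub> w)"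
      using x y(1) wc d_arith(1)[OF y(1)] d_arith(1)[OF wc] by (simp add: d_arith(2) a_minus_def Fi.minus_add Fi.M.add.m_ac)
    moreover have "filt R F (Suc ?n) (Suc i) = mpow R (Suc k) (F (Suc i))" by (simp add: filt_mpow)
    ultimately show ?case using w(2) y(1) wc by auto
  qed
  from this[of q] show "\<exists>y\<in>carrier (F (Suc (Suc i))). x \<ominus>\<^bsub>F (Suc i)\<^esub> d (Suc (Suc i)) y \<in> mpow R q (F (Suc i))" by simp
qed

text \<open>Degree \<open>i\<close> gives \<open>x = d y + z\<close> with \<open>z\<close> as small as required, but with no bound on \<open>y\<close>. Since \<open>d y\<close> is as
  small as \<open>x\<close>, the vanishing in degree \<open>i + 1\<close> replaces \<open>y\<close> by an element in the right step of the
  filtration with the same boundary.\<close>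

lemma homology_lin_trivial_if_tor_maps_zero:
  assumes T1: "tor_maps_zero F d (Suc i)" and T2: "tor_maps_zero F d (Suc (Suc i))"
  shows "carrier (homology (lin R F) (lin_diff R F d) (Suc i)) =
    {\<zero>\<^bsub>homology (lin R F) (lin_diff R F d) (Suc i)\<^esub>}"
  unfolding homology_lin_trivial_iff
proof (intro allI ballI impI)
  fix n x assume x: "x \<in> filt R F n (Suc i)" and dx: "d (Suc i) x \<in> filt R F (Suc n) i"
  have xc: "x \<in> carrier (F (Suc i))" using filtD(7)[OF x] .
  show "\<exists>y\<in>filt R F n (Suc (Suc i)). x \<ominus>\<^bsub>F (Suc i)\<^esub> d (Suc (Suc i)) y \<in> filt R F (Suc n) (Suc i)"
  proof (cases "n < Suc i")
    case True
    hence "filt R F (Suc n) (Suc i) = carrier (F (Suc i))" by (simp add: filt_mpow mpow_0[OF Fi.module_axioms])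
    thus ?thesis using xc filtD(2)[of "Suc (Suc i)" n] by (intro bexI[of _ "\<zero>\<^bsub>F (Suc (Suc i))\<^esub>"]) (auto simp: d_arith)
  next
    case False
    then obtain k where n: "n = Suc i + k" using le_Suc_ex by (metis not_less)
    have dx': "d (Suc i) x \<in> mpow R (Suc (Suc k)) (F i)" using dx by (simp add: filt_mpow n Suc_diff_le)
    obtain y where y: "y \<in> carrier (F (Suc (Suc i)))" "x \<ominus>\<^bsub>F (Suc i)\<^esub> d (Suc (Suc i)) y \<in> mpow R (Suc k) (F (Suc i))"
      using tor_maps_zeroD[OF T1 xc dx'] by blast
    have dyc: "d (Suc (Suc i)) y \<in> carrier (F (Suc i))" using d_arith(1) y by auto
    have xk: "x \<in> mpow R k (F (Suc i))" using x by (simp add: filt_mpow n)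
    have "x \<ominus>\<^bsub>F (Suc i)\<^esub> (x \<ominus>\<^bsub>F (Suc i)\<^esub> d (Suc (Suc i)) y) \<in> mpow R k (F (Suc i))"
      using mpowD(6)[OF Fi.module_axioms xk] mpow_Suc_antimono[OF Fi.module_axioms] y(2) by blast
    hence dy: "d (Suc (Suc i)) y \<in> mpow R k (F (Suc i))" using xc dyc by (simp add: Fi.minus_minus_cancel(1))
    obtain w where w: "w \<in> carrier (F (Suc (Suc (Suc i))))"
      "y \<ominus>\<^bsub>F (Suc (Suc i))\<^esub> d (Suc (Suc (Suc i))) w \<in> mpow R (k - 1) (F (Suc (Suc i)))"
    proof (cases k)
      (* For k = 0 the bound on y is void, in accordance with the truncated subtraction. *)
      case 0
      thus thesis using y(1) by (intro that[of "\<zero>\<^bsub>F (Suc (Suc (Suc i)))\<^esub>"]) (auto simp: d_arith mpow_0[OF Fi.module_axioms] Fi.minus_zero_right)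
    next
      case (Suc m)
      thus thesis using tor_maps_zeroD[OF T2 y(1)] dy that by (metis diff_Suc_1)
    qed
    let ?y = "y \<ominus>\<^bsub>F (Suc (Suc i))\<^esub> d (Suc (Suc (Suc i))) w"
    have dwc: "d (Suc (Suc (Suc i))) w \<in> carrier (F (Suc (Suc i)))" using d_arith(1) w by auto
    have "d (Suc (Suc i)) ?y = d (Suc (Suc i)) y"
      using y(1) dwc w d_arith(1)[OF y(1)] minimal_free_resolutionD(9)[OF F M w(1)] by (simp add: d_arith a_minus_def)
    thus ?thesis using w(2) y(2) by (intro bexI[of _ ?y]) (simp_all add: filt_mpow n)
  qed
qed

end

text \<open>Both preceding implications involve only degrees that are at least as large as the given one, so that
  for all degrees above \<open>e\<close> at once they form an equivalence. The resolution is arbitrary because the condition on the right is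
  independent of it.\<close>

lemma ld_le_iff:
  fixes G :: "nat \<Rightarrow> ('a, 'g) module"
  assumes M: "module R M" and fg: "finitely_generated R M" and nz: "carrier M \<noteq> {\<zero>\<^bsub>M\<^esub>}"
    and G: "minimal_free_resolution R M G \<delta> \<eta>"
  shows "ld R M \<le> enat e \<longleftrightarrow> (\<forall>i>e. tor_maps_zero G \<delta> i)"
proof -
  define P where "P p = (case p of (F :: nat \<Rightarrow> ('a, nat \<Rightarrow> 'a) module, d, \<epsilon>) \<Rightarrow> minimal_free_resolution R M F d \<epsilon>)" for p
  have "\<exists>p. P p" using minimal_free_resolution_exists[OF M fg] unfolding P_def by auto
  hence "P (SOME p. P p)" by (rule someI_ex)
  moreover obtain F d \<epsilon> where S: "(SOME p. P p) = (F, d, \<epsilon>)" by (metis prod_cases3)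
  ultimately have F: "minimal_free_resolution R M F d \<epsilon>" by (simp add: P_def)
  define triv where "triv i \<longleftrightarrow> carrier (homology (lin R F) (lin_diff R F d) i) = {\<zero>\<^bsub>homology (lin R F) (lin_diff R F d) i\<^esub>}" for i
  have "ld R M = Sup {enat i | i. \<not> triv i}"
    unfolding ld_def using nz S by (simp add: P_def[abs_def] triv_def)
  hence "ld R M \<le> enat e \<longleftrightarrow> (\<forall>i. \<not> triv i \<longrightarrow> i \<le> e)" by (auto simp: Sup_le_iff)
  also have "\<dots> \<longleftrightarrow> (\<forall>i>e. triv i)" by (metis not_le)
  also have "\<dots> \<longleftrightarrow> (\<forall>i>e. tor_maps_zero F d i)"
  proof (intro iffI allI impI)
    fix i assume "\<forall>i>e. triv i" "e < i"
    thus "tor_maps_zero F d i"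
      using tor_maps_zero_if_homology_lin_trivial[OF M F, of "i - 1"] by (cases i) (auto simp: triv_def)
  next
    fix i assume "\<forall>i>e. tor_maps_zero F d i" "e < i"
    thus "triv i" using homology_lin_trivial_if_tor_maps_zero[OF M F, of "i - 1"] by (cases i) (auto simp: triv_def)
  qed
  also have "\<dots> \<longleftrightarrow> (\<forall>i>e. tor_maps_zero G \<delta> i)"
    using tor_maps_zero_independent[OF M F G] by (metis gr0_conv_Suc less_nat_zero_code neq0_conv)
  finally show ?thesis .
qed

end

section \<open>The mapping cone of a resolution of a submodule\<close>

lemma prod_minus:
  assumes M: "module R M" and N: "module R N"
    and x: "x \<in> carrier (prod_module M N)" and y: "y \<in> carrier (prod_module M N)"
  shows "x \<ominus>\<^bsub>prod_module M N\<^esub> y = (fst x \<ominus>\<^bsub>M\<^esub> fst y, snd x \<ominus>\<^bsub>N\<^esub> snd y)"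
  using hom_arith(3)[OF prod_module_module[OF M N] M prod_module_homs(1)[OF M N] x y]
    hom_arith(3)[OF prod_module_module[OF M N] N prod_module_homs(2)[OF M N] x y]
  by (simp add: prod_eq_iff)

lemma hom_uminus:
  assumes M: "module R M" and N: "module R N" and f: "f \<in> module_hom R M N"
  shows "(\<lambda>x. \<ominus>\<^bsub>N\<^esub> f x) \<in> module_hom R M N"
proof -
  interpret N: module R N by fact
  show ?thesis
    using homD[OF f] by (intro homI) (simp_all add: N.minus_add N.smult_r_minus)
qed

context noetherian_local_ring
begin

lemma zero_submodule: "module R M \<Longrightarrow> submodule {\<zero>\<^bsub>M\<^esub>} R M"
proof -
  assume "module R M"
  then interpret M: module R M .
  show ?thesis by (rule submodule_closedI) (auto intro: M.module_axioms)
qed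

lemma zero_module_free:
  assumes M: "module R M"
  shows "free_of_finite_rank R (M\<lparr>carrier := {\<zero>\<^bsub>M\<^esub>}\<rparr>)"
proof -
  have m: "module R (M\<lparr>carrier := {\<zero>\<^bsub>M\<^esub>}\<rparr>)"
    by (rule submodule.submodule_is_module[OF zero_submodule[OF M] M])
  show ?thesis
  proof (rule free_of_finite_rankI[OF m, of "{} :: unit set"])
    show "(\<lambda>_. \<zero>\<^bsub>M\<^esub>) \<in> module_hom R (free_module R ({} :: unit set)) (M\<lparr>carrier := {\<zero>\<^bsub>M\<^esub>}\<rparr>)"
      using hom_zero[OF m] by simp
    show "bij_betw (\<lambda>_. \<zero>\<^bsub>M\<^esub>) (carrier (free_module R ({} :: unit set))) (carrier (M\<lparr>carrier := {\<zero>\<^bsub>M\<^esub>}\<rparr>))"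
      by (simp add: free_module_simps bij_betw_def)
  qed simp
qed

context
  fixes L :: "('a, 'l) module" and K :: "'l set" and N :: "('a, 'n) module" and \<pi>
    and P :: "nat \<Rightarrow> ('a, 'p) module" and d \<epsilon>
    and G :: "nat \<Rightarrow> ('a, 'g) module" and \<delta> \<eta> \<alpha>
  assumes L: "module R L" and N: "module R N" and K: "submodule K R L"
    and \<pi>: "\<pi> \<in> module_hom R L N" "\<pi> ` carrier L = carrier N" "a_kernel L N \<pi> = K"
    and P: "minimal_free_resolution R (L\<lparr>carrier := K\<rparr>) P d \<epsilon>"
    and G: "minimal_free_resolution R L G \<delta> \<eta>"
    and \<alpha>: "\<And>i. \<alpha> i \<in> module_hom R (P i) (G i)"
    and \<alpha>_small: "\<And>i x. x \<in> carrier (P i) \<Longrightarrow> \<alpha> i x \<in> mpow R (Suc 0) (G i)"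
    and \<alpha>_0: "\<And>x. x \<in> carrier (P 0) \<Longrightarrow> \<eta> (\<alpha> 0 x) = \<epsilon> x"
    and \<alpha>_Suc: "\<And>i x. x \<in> carrier (P (Suc i)) \<Longrightarrow> \<delta> (Suc i) (\<alpha> (Suc i) x) = \<alpha> i (d (Suc i) x)"
begin

text \<open>The resolution \<open>P\<close> moved up by one degree, with the sign that makes the differential of the cone
  square to zero. In degree 0 it is the zero module, on the type of the elements of \<open>P 0\<close>.\<close>

definition shifted :: "nat \<Rightarrow> ('a, 'p) module"
  where "shifted i = (case i of 0 \<Rightarrow> (P 0)\<lparr>carrier := {\<zero>\<^bsub>P 0\<^esub>}\<rparr> | Suc j \<Rightarrow> P j)"

definition shifted_diff :: "nat \<Rightarrow> 'p \<Rightarrow> 'p"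
  where "shifted_diff i p = (case i of Suc (Suc j) \<Rightarrow> \<ominus>\<^bsub>P j\<^esub> d (Suc j) p | _ \<Rightarrow> \<zero>\<^bsub>P 0\<^esub>)"

definition cone :: "nat \<Rightarrow> ('a, 'p \<times> 'g) module"
  where "cone i = prod_module (shifted i) (G i)"

definition cone_diff :: "nat \<Rightarrow> 'p \<times> 'g \<Rightarrow> 'p \<times> 'g"
  where "cone_diff i x = (shifted_diff i (fst x), \<alpha> (i - 1) (fst x) \<oplus>\<^bsub>G (i - 1)\<^esub> \<delta> i (snd x))"

lemma K_module: "module R (L\<lparr>carrier := K\<rparr>)"
  by (rule submodule.submodule_is_module[OF K L])

lemmas P_res = minimal_free_resolutionD[OF P K_module]
lemmas G_res = minimal_free_resolutionD[OF G L]

interpretation Pi: module R "P i" for i by (rule P_res)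
interpretation Gi: module R "G i" for i by (rule G_res)
interpretation L: module R L by (rule L)

lemmas P_arith = homD[OF P_res(3)] hom_arith[OF P_res(1) P_res(1) P_res(3)]
lemmas G_arith = homD[OF G_res(3)] hom_arith[OF G_res(1) G_res(1) G_res(3)]
lemmas \<alpha>_arith = homD[OF \<alpha>] hom_arith[OF P_res(1) G_res(1) \<alpha>]

lemma shifted_Suc: "shifted (Suc i) = P i" by (simp add: shifted_def)

lemma shifted_0: "shifted 0 = (P 0)\<lparr>carrier := {\<zero>\<^bsub>P 0\<^esub>}\<rparr>" by (simp add: shifted_def)

lemma shifted_module: "module R (shifted i)"
  by (cases i) (simp_all add: shifted_Suc shifted_0 P_res(1) submodule.submodule_is_module[OF zero_submodule[OF P_res(1)] P_res(1)])

lemma shifted_free: "free_of_finite_rank R (shifted i)"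
  by (cases i) (simp_all add: shifted_Suc shifted_0 P_res(2) zero_module_free[OF P_res(1)])

lemma shifted_diff_hom: "shifted_diff (Suc i) \<in> module_hom R (shifted (Suc i)) (shifted i)"
proof (cases i)
  case 0
  have "shifted_diff (Suc 0) = (\<lambda>_. \<zero>\<^bsub>shifted 0\<^esub>)" by (rule ext) (simp add: shifted_diff_def shifted_0)
  thus ?thesis using hom_zero[OF shifted_module] 0 by metis
next
  case (Suc j)
  have "shifted_diff (Suc (Suc j)) = (\<lambda>x. \<ominus>\<^bsub>P j\<^esub> d (Suc j) x)" by (rule ext) (simp add: shifted_diff_def)
  thus ?thesis using hom_uminus[OF P_res(1) P_res(1) P_res(3)] Suc by (simp add: shifted_Suc)
qed

lemma shifted_diff_Suc: "shifted_diff (Suc (Suc j)) x = \<ominus>\<^bsub>P j\<^esub> d (Suc j) x"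
  by (simp add: shifted_diff_def)

lemma shifted_diff_0: "shifted_diff (Suc 0) x = \<zero>\<^bsub>P 0\<^esub>"
  by (simp add: shifted_diff_def)

lemma cone_Suc_carrier: "x \<in> carrier (cone (Suc i)) \<longleftrightarrow> fst x \<in> carrier (P i) \<and> snd x \<in> carrier (G (Suc i))"
  by (auto simp: cone_def shifted_Suc mem_Times_iff)

lemma cone_module: "module R (cone i)"
  unfolding cone_def by (rule prod_module_module[OF shifted_module G_res(1)])

lemma cone_diff_Suc: "cone_diff (Suc i) x = (shifted_diff (Suc i) (fst x), \<alpha> i (fst x) \<oplus>\<^bsub>G i\<^esub> \<delta> (Suc i) (snd x))"
  by (simp add: cone_diff_def)

lemma cone_diff_hom: "cone_diff (Suc i) \<in> module_hom R (cone (Suc i)) (cone i)"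
proof -
  note h = prod_module_homs[OF shifted_module[of "Suc i"] G_res(1)[of "Suc i"]]
  have "(\<lambda>x. shifted_diff (Suc i) (fst x)) \<in> module_hom R (cone (Suc i)) (shifted i)"
    unfolding cone_def by (rule hom_compose[OF h(1) shifted_diff_hom])
  moreover have "(\<lambda>x. \<alpha> i (fst x) \<oplus>\<^bsub>G i\<^esub> \<delta> (Suc i) (snd x)) \<in> module_hom R (cone (Suc i)) (G i)"
    using hom_add[OF cone_module G_res(1) hom_compose[OF h(1)[folded cone_def] \<alpha>[folded shifted_Suc]]
        hom_compose[OF h(2)[folded cone_def] G_res(3)]] .
  ultimately show ?thesis
    using hom_pair by (auto simp: cone_diff_Suc[abs_def] cone_def[of i])
qed

lemma kernel_iff: "x \<in> K \<longleftrightarrow> x \<in> carrier L \<and> \<pi> x = \<zero>\<^bsub>N\<^esub>"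
  unfolding \<pi>(3)[symmetric] by (rule a_kernel_iff)

lemma \<epsilon>_K: "x \<in> carrier (P 0) \<Longrightarrow> \<epsilon> x \<in> K"
  using homD(1)[OF P_res(4)] by simp

lemma \<epsilon>_d: "x \<in> carrier (P (Suc 0)) \<Longrightarrow> \<epsilon> (d (Suc 0) x) = \<zero>\<^bsub>L\<^esub>"
  using P_res(7) by simp

lemma \<epsilon>_exact: "x \<in> carrier (P 0) \<Longrightarrow> \<epsilon> x = \<zero>\<^bsub>L\<^esub> \<Longrightarrow> x \<in> d (Suc 0) ` carrier (P (Suc 0))"
  using P_res(6) by simp

lemma \<epsilon>_minus: "x \<in> carrier (P 0) \<Longrightarrow> y \<in> carrier (P 0) \<Longrightarrow> \<epsilon> (x \<ominus>\<^bsub>P 0\<^esub> y) = \<epsilon> x \<ominus>\<^bsub>L\<^esub> \<epsilon> y"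
proof -
  assume xy: "x \<in> carrier (P 0)" "y \<in> carrier (P 0)"
  have "(\<lambda>x. x) \<in> module_hom R (L\<lparr>carrier := K\<rparr>) L" using submoduleD(7)[OF L K] by (intro homI) auto
  from hom_arith(3)[OF P_res(1) L hom_compose[OF P_res(4) this] xy] show ?thesis .
qed

text \<open>The cone is minimal because \<open>\<alpha>\<close> takes values in \<open>\<mm> G\<close>. It resolves \<open>N = L / K\<close> because \<open>\<alpha>\<close> lifts the
  inclusion of \<open>K\<close>.\<close>

lemma cone_resolution: "minimal_free_resolution R N cone cone_diff (\<lambda>x. \<pi> (\<eta> (snd x)))"
proof (rule minimal_free_resolutionI)
  note \<eta> = homD[OF G_res(4)] hom_arith[OF G_res(1) L G_res(4)]
  show "module R (cone i)" for i by (rule cone_module)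
  show "free_of_finite_rank R (cone i)" for i
    unfolding cone_def by (rule free_prod[OF shifted_module shifted_free G_res(1,2)])
  show "cone_diff (Suc i) \<in> module_hom R (cone (Suc i)) (cone i)" for i by (rule cone_diff_hom)
  show "(\<lambda>x. \<pi> (\<eta> (snd x))) \<in> module_hom R (cone 0) N"
    unfolding cone_def
    by (rule hom_compose[OF hom_compose[OF prod_module_homs(2)[OF shifted_module G_res(1)] G_res(4)] \<pi>(1)])
  have "snd ` carrier (cone 0) = carrier (G 0)" by (auto simp: cone_def shifted_0 image_iff)
  moreover have "(\<lambda>x. \<pi> (\<eta> (snd x))) ` A = \<pi> ` \<eta> ` snd ` A" for A :: "('p \<times> 'g) set"
    by (simp add: image_image)
  ultimately show "(\<lambda>x. \<pi> (\<eta> (snd x))) ` carrier (cone 0) = carrier N" using G_res(5) \<pi>(2) by simp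
  show "x \<in> cone_diff (Suc 0) ` carrier (cone (Suc 0))" if x: "x \<in> carrier (cone 0)" "\<pi> (\<eta> (snd x)) = \<zero>\<^bsub>N\<^esub>" for x
  proof -
    have x': "fst x = \<zero>\<^bsub>P 0\<^esub>" "snd x \<in> carrier (G 0)" using x(1) by (auto simp: cone_def shifted_0)
    have "\<eta> (snd x) \<in> K" using x(2) \<eta>(1)[OF x'(2)] by (simp add: kernel_iff)
    then obtain u where u: "u \<in> carrier (P 0)" "\<eta> (snd x) = \<epsilon> u" using P_res(5) by auto
    have au: "\<alpha> 0 u \<in> carrier (G 0)" using \<alpha>_arith(1) u by auto
    have "\<eta> (snd x \<ominus>\<^bsub>G 0\<^esub> \<alpha> 0 u) = \<zero>\<^bsub>L\<^esub>"
      using \<eta>(6)[OF x'(2) au] u \<alpha>_0[OF u(1)] \<eta>(1)[OF au] by (simp add: L.minus_zero_iff)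
    then obtain v where v: "v \<in> carrier (G (Suc 0))" "snd x \<ominus>\<^bsub>G 0\<^esub> \<alpha> 0 u = \<delta> (Suc 0) v"
      using G_res(6)[of "snd x \<ominus>\<^bsub>G 0\<^esub> \<alpha> 0 u"] x'(2) au by auto
    have "snd x = \<alpha> 0 u \<oplus>\<^bsub>G 0\<^esub> \<delta> (Suc 0) v"
      using v au x'(2) G_arith(1)[OF v(1)] by (subst (asm) Gi.minus_eq_iff) auto
    hence "x = cone_diff (Suc 0) (u, v)" using x'(1) by (simp add: cone_diff_Suc shifted_diff_0 prod_eq_iff)
    thus ?thesis using u v by (intro image_eqI[of _ _ "(u, v)"]) (auto simp: cone_Suc_carrier)
  qed
  show "\<pi> (\<eta> (snd (cone_diff (Suc 0) x))) = \<zero>\<^bsub>N\<^esub>" if "x \<in> carrier (cone (Suc 0))" for x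
  proof -
    from that have x: "fst x \<in> carrier (P 0)" "snd x \<in> carrier (G (Suc 0))" by (auto simp: cone_Suc_carrier)
    have "\<eta> (snd (cone_diff (Suc 0) x)) = \<epsilon> (fst x)"
      using x \<alpha>_arith(1)[OF x(1)] G_arith(1)[OF x(2)] \<epsilon>_K[OF x(1)] submoduleD(7)[OF L K]
      by (simp add: cone_diff_Suc \<eta>(2) \<alpha>_0 G_res(7))
    thus ?thesis using \<epsilon>_K[OF x(1)] by (simp add: kernel_iff)
  qed
  show "x \<in> cone_diff (Suc (Suc i)) ` carrier (cone (Suc (Suc i)))"
    if x0: "x \<in> carrier (cone (Suc i))" "cone_diff (Suc i) x = \<zero>\<^bsub>cone i\<^esub>" for i x
  proof -
    from x0 have x: "fst x \<in> carrier (P i)" "snd x \<in> carrier (G (Suc i))" by (auto simp: cone_Suc_carrier)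
    have s0: "shifted_diff (Suc i) (fst x) = \<zero>\<^bsub>shifted i\<^esub>"
      and a0: "\<alpha> i (fst x) \<oplus>\<^bsub>G i\<^esub> \<delta> (Suc i) (snd x) = \<zero>\<^bsub>G i\<^esub>"
      using x0(2) by (auto simp: cone_diff_Suc cone_def)
    have ax: "\<alpha> i (fst x) \<in> carrier (G i)" and dx: "\<delta> (Suc i) (snd x) \<in> carrier (G i)"
      using \<alpha>_arith(1)[OF x(1)] G_arith(1)[OF x(2)] .
    have "fst x \<in> d (Suc i) ` carrier (P (Suc i))"
    proof (cases i)
      case 0
      have "\<eta> (\<alpha> 0 (fst x) \<oplus>\<^bsub>G 0\<^esub> \<delta> (Suc 0) (snd x)) = \<zero>\<^bsub>L\<^esub>" using a0 \<eta>(4) 0 by simp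
      hence "\<epsilon> (fst x) = \<zero>\<^bsub>L\<^esub>"
        using x ax dx \<epsilon>_K submoduleD(7)[OF L K] by (simp add: 0 \<eta>(2) \<alpha>_0 G_res(7))
      thus ?thesis using \<epsilon>_exact x 0 by auto
    next
      case (Suc j)
      have dj: "d (Suc j) (fst x) \<in> carrier (P j)" using P_arith(1) x Suc by auto
      have "\<ominus>\<^bsub>P j\<^esub> d (Suc j) (fst x) = \<zero>\<^bsub>P j\<^esub>" using s0 by (simp add: Suc shifted_diff_Suc shifted_Suc)
      hence "d (Suc j) (fst x) = \<zero>\<^bsub>P j\<^esub>" using Pi.M.add.inv_eq_1_iff[OF dj] by simp
      thus ?thesis using P_res(8) x Suc by auto
    qed
    then obtain u where u: "u \<in> carrier (P (Suc i))" "fst x = d (Suc i) u" by auto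
    let ?u = "\<ominus>\<^bsub>P (Suc i)\<^esub> u"
    have u': "?u \<in> carrier (P (Suc i))" "shifted_diff (Suc (Suc i)) ?u = fst x"
      using u P_arith(1)[OF u(1)] by (simp_all add: shifted_diff_Suc P_arith(5))
    have au: "\<alpha> (Suc i) ?u \<in> carrier (G (Suc i))" using \<alpha>_arith(1) u' by auto
    have "\<delta> (Suc i) (\<alpha> (Suc i) ?u) = \<ominus>\<^bsub>G i\<^esub> \<alpha> i (fst x)"
      using \<alpha>_Suc[OF u'(1)] u x P_arith(1)[OF u(1)] by (simp add: P_arith(5) \<alpha>_arith(5))
    hence "\<delta> (Suc i) (snd x \<ominus>\<^bsub>G (Suc i)\<^esub> \<alpha> (Suc i) ?u) = \<zero>\<^bsub>G i\<^esub>"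
      using G_arith(6)[OF x(2) au] a0 ax dx by (simp add: a_minus_def Gi.M.add.m_comm)
    then obtain v where v: "v \<in> carrier (G (Suc (Suc i)))" "snd x \<ominus>\<^bsub>G (Suc i)\<^esub> \<alpha> (Suc i) ?u = \<delta> (Suc (Suc i)) v"
      using G_res(8)[of "snd x \<ominus>\<^bsub>G (Suc i)\<^esub> \<alpha> (Suc i) ?u" i] x(2) au by auto
    have "snd x = \<alpha> (Suc i) ?u \<oplus>\<^bsub>G (Suc i)\<^esub> \<delta> (Suc (Suc i)) v"
      using v au x(2) G_arith(1)[OF v(1)] by (subst (asm) Gi.minus_eq_iff) auto
    hence "x = cone_diff (Suc (Suc i)) (?u, v)" using u'(2) by (simp add: cone_diff_Suc prod_eq_iff)
    thus ?thesis using u' v by (intro image_eqI[of _ _ "(?u, v)"]) (auto simp: cone_Suc_carrier)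
  qed
  show "cone_diff (Suc i) (cone_diff (Suc (Suc i)) x) = \<zero>\<^bsub>cone i\<^esub>"
    if "x \<in> carrier (cone (Suc (Suc i)))" for i x
  proof -
    from that have x: "fst x \<in> carrier (P (Suc i))" "snd x \<in> carrier (G (Suc (Suc i)))" by (auto simp: cone_Suc_carrier)
    note dx = P_arith(1)[OF x(1)]
    have 1: "shifted_diff (Suc i) (\<ominus>\<^bsub>P i\<^esub> d (Suc i) (fst x)) = \<zero>\<^bsub>shifted i\<^esub>"
    proof (cases i)
      case 0 thus ?thesis by (simp add: shifted_diff_0 shifted_0)
    next
      case (Suc j) thus ?thesis using x dx P_res(9)[of "fst x" j] by (simp add: shifted_diff_Suc shifted_Suc P_arith(5))
    qed
    have "\<delta> (Suc i) (\<alpha> (Suc i) (fst x) \<oplus>\<^bsub>G (Suc i)\<^esub> \<delta> (Suc (Suc i)) (snd x)) = \<alpha> i (d (Suc i) (fst x))"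
      using x \<alpha>_arith(1)[OF x(1)] G_arith(1)[OF x(2)] \<alpha>_arith(1)[OF dx]
      by (simp add: G_arith(2) G_res(9) \<alpha>_Suc)
    hence 2: "\<alpha> i (\<ominus>\<^bsub>P i\<^esub> d (Suc i) (fst x)) \<oplus>\<^bsub>G i\<^esub>
        \<delta> (Suc i) (\<alpha> (Suc i) (fst x) \<oplus>\<^bsub>G (Suc i)\<^esub> \<delta> (Suc (Suc i)) (snd x)) = \<zero>\<^bsub>G i\<^esub>"
      using \<alpha>_arith(1)[OF dx] dx by (simp add: \<alpha>_arith(5) Gi.l_neg)
    show ?thesis using 1 2 by (simp add: cone_diff_Suc shifted_diff_Suc) (simp add: cone_def)
  qed
  show "cone_diff (Suc i) x \<in> mpow R (Suc 0) (cone i)" if "x \<in> carrier (cone (Suc i))" for i x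
  proof -
    from that have x: "fst x \<in> carrier (P i)" "snd x \<in> carrier (G (Suc i))" by (auto simp: cone_Suc_carrier)
    have "shifted_diff (Suc i) (fst x) \<in> mpow R (Suc 0) (shifted i)"
    proof (cases i)
      case 0 thus ?thesis using mpowD(2)[OF shifted_module[of 0], of "Suc 0"] by (simp add: shifted_diff_0 shifted_0)
    next
      case (Suc j) thus ?thesis using mpowD(3)[OF P_res(1) P_res(10)] x by (simp add: shifted_diff_Suc shifted_Suc)
    qed
    moreover have "\<alpha> i (fst x) \<oplus>\<^bsub>G i\<^esub> \<delta> (Suc i) (snd x) \<in> mpow R (Suc 0) (G i)"
      using mpowD(5)[OF G_res(1) \<alpha>_small[OF x(1)] G_res(10)[OF x(2)]] .
    ultimately show ?thesis unfolding cone_def mpow_prod[OF shifted_module G_res(1)] by (simp add: cone_diff_Suc)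
  qed
qed

context
  assumes T: "\<And>i. tor_maps_zero G \<delta> (Suc i)"
begin

text \<open>Once the component in \<open>P\<^sub>i\<close> of an element of the cone can be moved into \<open>\<mm>\<^sup>q P\<^sub>i\<close> by a
  boundary, the component in \<open>G\<close> follows: the chain map \<open>\<alpha>\<close> gains one power of \<open>\<mm>\<close>, so the
  hypothesis on \<open>G\<close> applies to what remains.\<close>

lemma cone_reduce:
  assumes u: "u \<in> carrier (P i)" and v: "v \<in> carrier (G (Suc i))"
    and uv: "\<alpha> i u \<oplus>\<^bsub>G i\<^esub> \<delta> (Suc i) v \<in> mpow R (Suc q) (G i)"
    and w: "w \<in> carrier (P (Suc i))" and uw: "u \<ominus>\<^bsub>P i\<^esub> d (Suc i) w \<in> mpow R q (P i)"
  shows "\<exists>y\<in>carrier (cone (Suc (Suc i))). (u, v) \<ominus>\<^bsub>cone (Suc i)\<^esub> cone_diff (Suc (Suc i)) y \<in> mpow R q (cone (Suc i))"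
proof -
  let ?v = "v \<oplus>\<^bsub>G (Suc i)\<^esub> \<alpha> (Suc i) w" and ?z = "u \<ominus>\<^bsub>P i\<^esub> d (Suc i) w"
  note dw = P_arith(1)[OF w] and aw = \<alpha>_arith(1)[OF w] and dv = G_arith(1)[OF v] and au = \<alpha>_arith(1)[OF u]
  have zc: "?z \<in> carrier (P i)" using u dw by simp
  have az: "\<alpha> i ?z \<in> mpow R (Suc q) (G i)"
    using mpow_hom[OF P_res(1) G_res(1) \<alpha> \<alpha>_small uw] by simp
  have adw: "\<alpha> i (d (Suc i) w) \<in> carrier (G i)" using \<alpha>_arith(1)[OF dw] .
  have "\<delta> (Suc i) ?v = \<delta> (Suc i) v \<oplus>\<^bsub>G i\<^esub> \<alpha> i (d (Suc i) w)"
    using v aw w by (simp add: G_arith(2) \<alpha>_Suc)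
  also have "\<dots> = (\<alpha> i u \<oplus>\<^bsub>G i\<^esub> \<delta> (Suc i) v) \<ominus>\<^bsub>G i\<^esub> \<alpha> i ?z"
  proof -
    have "\<alpha> i ?z = \<alpha> i u \<ominus>\<^bsub>G i\<^esub> \<alpha> i (d (Suc i) w)" using \<alpha>_arith(6)[OF u dw] .
    moreover have "(\<alpha> i u \<oplus>\<^bsub>G i\<^esub> \<delta> (Suc i) v) \<ominus>\<^bsub>G i\<^esub> (\<alpha> i u \<ominus>\<^bsub>G i\<^esub> \<alpha> i (d (Suc i) w)) =
        \<delta> (Suc i) v \<oplus>\<^bsub>G i\<^esub> \<alpha> i (d (Suc i) w)"
    proof -
      have "(\<alpha> i u \<ominus>\<^bsub>G i\<^esub> \<alpha> i (d (Suc i) w)) \<oplus>\<^bsub>G i\<^esub> (\<delta> (Suc i) v \<oplus>\<^bsub>G i\<^esub> \<alpha> i (d (Suc i) w)) =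
        \<delta> (Suc i) v \<oplus>\<^bsub>G i\<^esub> ((\<alpha> i u \<ominus>\<^bsub>G i\<^esub> \<alpha> i (d (Suc i) w)) \<oplus>\<^bsub>G i\<^esub> \<alpha> i (d (Suc i) w))"
        using au adw dv by (simp add: Gi.M.add.m_lcomm)
      also have "\<dots> = \<alpha> i u \<oplus>\<^bsub>G i\<^esub> \<delta> (Suc i) v"
        using au adw dv by (simp add: Gi.minus_minus_cancel(2,3) Gi.M.add.m_comm)
      finally show ?thesis using au adw dv by (subst Gi.minus_eq_iff) auto
    qed
    ultimately show ?thesis by simp
  qed
  finally have "\<delta> (Suc i) ?v \<in> mpow R (Suc q) (G i)" using mpowD(6)[OF G_res(1) uv az] by simp
  then obtain y where y: "y \<in> carrier (G (Suc (Suc i)))"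
    "?v \<ominus>\<^bsub>G (Suc i)\<^esub> \<delta> (Suc (Suc i)) y \<in> mpow R q (G (Suc i))"
    using tor_maps_zeroD[OF T[of i], of ?v q] v aw by auto
  note dy = G_arith(1)[OF y(1)]
  let ?y = "(\<ominus>\<^bsub>P (Suc i)\<^esub> w, y)"
  have yc: "?y \<in> carrier (cone (Suc (Suc i)))" using w y by (simp add: cone_Suc_carrier)
  have cy: "cone_diff (Suc (Suc i)) ?y = (d (Suc i) w, \<ominus>\<^bsub>G (Suc i)\<^esub> \<alpha> (Suc i) w \<oplus>\<^bsub>G (Suc i)\<^esub> \<delta> (Suc (Suc i)) y)"
    using w dw by (simp add: cone_diff_Suc shifted_diff_Suc P_arith(5) \<alpha>_arith(5))
  have "v \<ominus>\<^bsub>G (Suc i)\<^esub> (\<ominus>\<^bsub>G (Suc i)\<^esub> \<alpha> (Suc i) w \<oplus>\<^bsub>G (Suc i)\<^esub> \<delta> (Suc (Suc i)) y) = ?v \<ominus>\<^bsub>G (Suc i)\<^esub> \<delta> (Suc (Suc i)) y"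
    using v aw dy by (simp add: a_minus_def Gi.minus_add Gi.M.add.m_ac)
  moreover have "(u, v) \<ominus>\<^bsub>cone (Suc i)\<^esub> cone_diff (Suc (Suc i)) ?y =
    (u \<ominus>\<^bsub>P i\<^esub> d (Suc i) w, v \<ominus>\<^bsub>G (Suc i)\<^esub> (\<ominus>\<^bsub>G (Suc i)\<^esub> \<alpha> (Suc i) w \<oplus>\<^bsub>G (Suc i)\<^esub> \<delta> (Suc (Suc i)) y))"
    unfolding cy unfolding cone_def shifted_Suc
    using u v dw aw dy by (subst prod_minus[OF P_res(1) G_res(1)]) auto
  ultimately have "(u, v) \<ominus>\<^bsub>cone (Suc i)\<^esub> cone_diff (Suc (Suc i)) ?y \<in> mpow R q (cone (Suc i))"
    using uw y(2) unfolding cone_def shifted_Suc mpow_prod[OF P_res(1) G_res(1)] by simp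
  thus ?thesis using yc by blast
qed

text \<open>Conversely, an element of \<open>P\<^sub>i\<close> extended to a cycle of the cone modulo a power of \<open>\<mm>\<close> is
  itself a boundary modulo the previous power, if the cone has this property.\<close>

lemma cone_project:
  assumes C: "tor_maps_zero cone cone_diff (Suc i)"
    and u: "u \<in> carrier (P i)" and v: "v \<in> carrier (G (Suc i))"
    and uv: "cone_diff (Suc i) (u, v) \<in> mpow R (Suc q) (cone i)"
  shows "\<exists>w\<in>carrier (P (Suc i)). u \<ominus>\<^bsub>P i\<^esub> d (Suc i) w \<in> mpow R q (P i)"
proof -
  have "(u, v) \<in> carrier (cone (Suc i))" using u v by (simp add: cone_Suc_carrier)
  then obtain y where y: "y \<in> carrier (cone (Suc (Suc i)))"
    "(u, v) \<ominus>\<^bsub>cone (Suc i)\<^esub> cone_diff (Suc (Suc i)) y \<in> mpow R q (cone (Suc i))"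
    using tor_maps_zeroD[OF C _ uv] by blast
  from y(1) have y': "fst y \<in> carrier (P (Suc i))" by (simp add: cone_Suc_carrier)
  let ?w = "\<ominus>\<^bsub>P (Suc i)\<^esub> fst y"
  have cy: "cone_diff (Suc (Suc i)) y \<in> carrier (cone (Suc i))" using homD(1)[OF cone_diff_hom y(1)] .
  have "fst ((u, v) \<ominus>\<^bsub>cone (Suc i)\<^esub> cone_diff (Suc (Suc i)) y) = u \<ominus>\<^bsub>P i\<^esub> d (Suc i) ?w"
    using cy u v y' unfolding cone_def shifted_Suc
    by (subst prod_minus[OF P_res(1) G_res(1)]) (auto simp: cone_diff_Suc shifted_diff_Suc P_arith(5))
  hence "u \<ominus>\<^bsub>P i\<^esub> d (Suc i) ?w \<in> mpow R q (P i)"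
    using y(2) unfolding cone_def shifted_Suc mpow_prod[OF P_res(1) G_res(1)] by auto
  thus ?thesis using y' by (intro bexI[of _ ?w]) auto
qed

text \<open>From \<open>P\<close> to the cone, this is the reduction above. From the cone to \<open>P\<close>, the image \<open>\<alpha> u\<close> has its
  differential in \<open>\<mm>\<^sup>q\<^sup>+\<^sup>2 G\<close>, one power more than \<open>d u\<close>; by the hypothesis on \<open>G\<close> it is a boundary up to
  \<open>\<mm>\<^sup>q\<^sup>+\<^sup>1 G\<close>, and this completes \<open>u\<close> to an element of the cone.\<close>

lemma tor_maps_zero_cone_Suc: "tor_maps_zero cone cone_diff (Suc (Suc i)) \<longleftrightarrow> tor_maps_zero P d (Suc i)"
proof
  assume TP: "tor_maps_zero P d (Suc i)"
  show "tor_maps_zero cone cone_diff (Suc (Suc i))"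
  proof (rule tor_maps_zeroI)
    fix q x assume x: "x \<in> carrier (cone (Suc (Suc i)))"
      and cx: "cone_diff (Suc (Suc i)) x \<in> mpow R (Suc q) (cone (Suc i))"
    from x have x': "fst x \<in> carrier (P (Suc i))" "snd x \<in> carrier (G (Suc (Suc i)))" by (auto simp: cone_Suc_carrier)
    from cx have 1: "\<ominus>\<^bsub>P i\<^esub> d (Suc i) (fst x) \<in> mpow R (Suc q) (P i)"
      and 2: "\<alpha> (Suc i) (fst x) \<oplus>\<^bsub>G (Suc i)\<^esub> \<delta> (Suc (Suc i)) (snd x) \<in> mpow R (Suc q) (G (Suc i))"
      unfolding cone_def shifted_Suc mpow_prod[OF P_res(1) G_res(1)] by (auto simp: cone_diff_Suc shifted_diff_Suc)
    have "d (Suc i) (fst x) \<in> mpow R (Suc q) (P i)" using mpowD(3)[OF P_res(1) 1] P_arith(1)[OF x'(1)] by simp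
    then obtain w where "w \<in> carrier (P (Suc (Suc i)))" "fst x \<ominus>\<^bsub>P (Suc i)\<^esub> d (Suc (Suc i)) w \<in> mpow R q (P (Suc i))"
      using tor_maps_zeroD[OF TP x'(1)] by blast
    from cone_reduce[OF x' 2 this]
    show "\<exists>y\<in>carrier (cone (Suc (Suc (Suc i)))). x \<ominus>\<^bsub>cone (Suc (Suc i))\<^esub> cone_diff (Suc (Suc (Suc i))) y
      \<in> mpow R q (cone (Suc (Suc i)))" by simp
  qed
next
  assume TC: "tor_maps_zero cone cone_diff (Suc (Suc i))"
  show "tor_maps_zero P d (Suc i)"
  proof (rule tor_maps_zeroI)
    fix q u assume u: "u \<in> carrier (P (Suc i))" and du: "d (Suc i) u \<in> mpow R (Suc q) (P i)"
    note au = \<alpha>_arith(1)[OF u]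
    have "\<delta> (Suc i) (\<alpha> (Suc i) u) \<in> mpow R (Suc (Suc q)) (G i)"
      using mpow_hom[OF P_res(1) G_res(1) \<alpha> \<alpha>_small du] \<alpha>_Suc[OF u] by simp
    then obtain v where v: "v \<in> carrier (G (Suc (Suc i)))"
      "\<alpha> (Suc i) u \<ominus>\<^bsub>G (Suc i)\<^esub> \<delta> (Suc (Suc i)) v \<in> mpow R (Suc q) (G (Suc i))"
      using tor_maps_zeroD[OF T au] by blast
    let ?v = "\<ominus>\<^bsub>G (Suc (Suc i))\<^esub> v"
    have v': "?v \<in> carrier (G (Suc (Suc i)))" using v by simp
    have "cone_diff (Suc (Suc i)) (u, ?v) \<in> mpow R (Suc q) (cone (Suc i))"
      using v mpowD(3)[OF P_res(1) du] unfolding cone_def shifted_Suc mpow_prod[OF P_res(1) G_res(1)]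
      by (simp add: cone_diff_Suc shifted_diff_Suc G_arith(5) a_minus_def)
    from cone_project[OF TC u v' this]
    show "\<exists>w\<in>carrier (P (Suc (Suc i))). u \<ominus>\<^bsub>P (Suc i)\<^esub> d (Suc (Suc i)) w \<in> mpow R q (P (Suc i))" .
  qed
qed

text \<open>In degree 1 the component in \<open>P\<^sub>0\<close> has no differential within \<open>P\<close>. Instead, the pairs \<open>(u, v)\<close> with
  \<open>\<alpha> u + \<delta> v\<close> in \<open>\<mm>\<^sup>q\<^sup>+\<^sup>1 G\<^sub>0\<close> are those whose image \<open>\<epsilon> u\<close> in \<open>K\<close> lies in \<open>\<mm>\<^sup>q\<^sup>+\<^sup>1 L\<close>, up to the choice of \<open>v\<close>.\<close>

lemma tor_maps_zero_cone_1:
  "tor_maps_zero cone cone_diff (Suc 0) \<longleftrightarrow> (\<forall>q. K \<inter> mpow R (Suc q) L \<subseteq> mpow R q (L\<lparr>carrier := K\<rparr>))"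
proof
  note \<eta> = homD[OF G_res(4)] hom_arith[OF G_res(1) L G_res(4)]
  have \<epsilon>_surj: "\<epsilon> ` carrier (P 0) = carrier (L\<lparr>carrier := K\<rparr>)" by (rule P_res(5))
  {
    assume AR: "\<forall>q. K \<inter> mpow R (Suc q) L \<subseteq> mpow R q (L\<lparr>carrier := K\<rparr>)"
    show "tor_maps_zero cone cone_diff (Suc 0)"
    proof (rule tor_maps_zeroI)
      fix q x assume x: "x \<in> carrier (cone (Suc 0))"
        and cx: "cone_diff (Suc 0) x \<in> mpow R (Suc q) (cone 0)"
      from x have x': "fst x \<in> carrier (P 0)" "snd x \<in> carrier (G (Suc 0))" by (auto simp: cone_Suc_carrier)
      from cx have 2: "\<alpha> 0 (fst x) \<oplus>\<^bsub>G 0\<^esub> \<delta> (Suc 0) (snd x) \<in> mpow R (Suc q) (G 0)"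
        unfolding cone_def mpow_prod[OF shifted_module G_res(1)] by (auto simp: cone_diff_Suc)
      have "\<eta> (\<alpha> 0 (fst x) \<oplus>\<^bsub>G 0\<^esub> \<delta> (Suc 0) (snd x)) = \<epsilon> (fst x)"
        using x' \<alpha>_arith(1)[OF x'(1)] G_arith(1)[OF x'(2)] \<epsilon>_K submoduleD(7)[OF L K]
        by (simp add: \<eta>(2) \<alpha>_0 G_res(7))
      hence "\<epsilon> (fst x) \<in> mpow R (Suc q) L" using mpow_hom_0[OF G_res(1) L G_res(4) 2] by simp
      hence "\<epsilon> (fst x) \<in> mpow R q (L\<lparr>carrier := K\<rparr>)" using AR \<epsilon>_K[OF x'(1)] by blast
      then obtain z where z: "z \<in> mpow R q (P 0)" "\<epsilon> (fst x) = \<epsilon> z"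
        using mpow_surj[OF P_res(1) K_module P_res(4,5)] by blast
      have zc: "z \<in> carrier (P 0)" using mpowD(7)[OF P_res(1) z(1)] .
      have "\<epsilon> (fst x \<ominus>\<^bsub>P 0\<^esub> z) = \<zero>\<^bsub>L\<^esub>"
        using \<epsilon>_minus[OF x'(1) zc] z(2) \<epsilon>_K[OF zc] submoduleD(7)[OF L K] by (simp add: L.minus_zero_iff)
      then obtain w where w: "w \<in> carrier (P (Suc 0))" "fst x \<ominus>\<^bsub>P 0\<^esub> z = d (Suc 0) w"
        using \<epsilon>_exact[of "fst x \<ominus>\<^bsub>P 0\<^esub> z"] x'(1) zc by auto
      have "fst x \<ominus>\<^bsub>P 0\<^esub> d (Suc 0) w = z"
        unfolding w(2)[symmetric] using x'(1) zc by (rule Pi.minus_minus_cancel(1))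
      hence "fst x \<ominus>\<^bsub>P 0\<^esub> d (Suc 0) w \<in> mpow R q (P 0)" using z by simp
      from cone_reduce[OF x' 2 w(1) this]
      show "\<exists>y\<in>carrier (cone (Suc (Suc 0))). x \<ominus>\<^bsub>cone (Suc 0)\<^esub> cone_diff (Suc (Suc 0)) y
        \<in> mpow R q (cone (Suc 0))" by simp
    qed
  }
  {
    assume TC: "tor_maps_zero cone cone_diff (Suc 0)"
    show "\<forall>q. K \<inter> mpow R (Suc q) L \<subseteq> mpow R q (L\<lparr>carrier := K\<rparr>)"
    proof (intro allI subsetI)
      fix q k assume "k \<in> K \<inter> mpow R (Suc q) L"
      hence k: "k \<in> K" "k \<in> mpow R (Suc q) L" by auto
      obtain u where u: "u \<in> carrier (P 0)" "k = \<epsilon> u" using k(1) P_res(5) by auto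
      obtain v where v: "v \<in> mpow R (Suc q) (G 0)" "k = \<eta> v"
        using k(2) mpow_surj[OF G_res(1) L G_res(4,5)] by blast
      note au = \<alpha>_arith(1)[OF u(1)] and vc = mpowD(7)[OF G_res(1) v(1)]
      have "\<eta> (\<alpha> 0 u \<ominus>\<^bsub>G 0\<^esub> v) = \<zero>\<^bsub>L\<^esub>"
        using \<eta>(6)[OF au vc] \<alpha>_0[OF u(1)] u v \<eta>(1)[OF vc] by (simp add: L.minus_zero_iff)
      then obtain w where w: "w \<in> carrier (G (Suc 0))" "\<alpha> 0 u \<ominus>\<^bsub>G 0\<^esub> v = \<delta> (Suc 0) w"
        using G_res(6)[of "\<alpha> 0 u \<ominus>\<^bsub>G 0\<^esub> v"] au vc by auto
      have "\<alpha> 0 u \<ominus>\<^bsub>G 0\<^esub> \<delta> (Suc 0) w = v"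
        unfolding w(2)[symmetric] using au vc by (rule Gi.minus_minus_cancel(1))
      hence "cone_diff (Suc 0) (u, \<ominus>\<^bsub>G (Suc 0)\<^esub> w) \<in> mpow R (Suc q) (cone 0)"
        using v(1) w(1) mpowD(2)[OF shifted_module[of 0], of "Suc q"]
        unfolding cone_def mpow_prod[OF shifted_module G_res(1)]
        by (simp add: cone_diff_Suc shifted_diff_0 shifted_0 G_arith(5) a_minus_def)
      from cone_project[OF TC u(1) _ this] obtain w' where
        w': "w' \<in> carrier (P (Suc 0))" "u \<ominus>\<^bsub>P 0\<^esub> d (Suc 0) w' \<in> mpow R q (P 0)" using w(1) by auto
      have "\<epsilon> (u \<ominus>\<^bsub>P 0\<^esub> d (Suc 0) w') = k"
        using \<epsilon>_minus[OF u(1) P_arith(1)[OF w'(1)]] \<epsilon>_d[OF w'(1)] u submoduleD(7)[OF L K k(1)]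
        by (simp add: L.minus_zero_right)
      thus "k \<in> mpow R q (L\<lparr>carrier := K\<rparr>)"
        using mpow_hom_0[OF P_res(1) K_module P_res(4) w'(2)] by simp
    qed
  }
qed

end

end

text \<open>The chain map \<open>\<alpha>\<close> is supplied by the comparison theorem with \<open>k = 1\<close>; the condition on boundaries of \<open>G\<close>
  required there is the case \<open>q = 1\<close> of the hypothesis \<open>T\<close>.\<close>

lemma resolution_of_quotient:
  fixes L :: "('a, 'l) module" and N :: "('a, 'n) module"
    and P :: "nat \<Rightarrow> ('a, 'p) module" and G :: "nat \<Rightarrow> ('a, 'g) module"
  assumes L: "module R L" and N: "module R N" and K: "submodule K R L" and Km: "K \<subseteq> mpow R (Suc 0) L"
    and \<pi>: "\<pi> \<in> module_hom R L N" "\<pi> ` carrier L = carrier N" "a_kernel L N \<pi> = K"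
    and P: "minimal_free_resolution R (L\<lparr>carrier := K\<rparr>) P d \<epsilon>"
    and G: "minimal_free_resolution R L G \<delta> \<eta>"
    and T: "\<And>i. tor_maps_zero G \<delta> (Suc i)"
  shows "\<exists>(C :: nat \<Rightarrow> ('a, 'p \<times> 'g) module) \<gamma> \<kappa>. minimal_free_resolution R N C \<gamma> \<kappa> \<and>
    (\<forall>i. tor_maps_zero C \<gamma> (Suc (Suc i)) \<longleftrightarrow> tor_maps_zero P d (Suc i)) \<and>
    (tor_maps_zero C \<gamma> (Suc 0) \<longleftrightarrow> (\<forall>q. K \<inter> mpow R (Suc q) L \<subseteq> mpow R q (L\<lparr>carrier := K\<rparr>)))"
proof -
  have N': "module R (L\<lparr>carrier := K\<rparr>)" by (rule submodule.submodule_is_module[OF K L])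
  note P_res = minimal_free_resolutionD[OF P N'] and G_res = minimal_free_resolutionD[OF G L]
  have inc: "(\<lambda>x. x) \<in> module_hom R (L\<lparr>carrier := K\<rparr>) L"
    using submoduleD(7)[OF L K] by (intro homI) auto
  have strict: "\<delta> (Suc i) y \<in> \<delta> (Suc i) ` mpow R (Suc 0) (G (Suc i))"
    if y: "y \<in> carrier (G (Suc i))" "\<delta> (Suc i) y \<in> mpow R (Suc (Suc 0)) (G i)" for i y
  proof -
    obtain w where w: "w \<in> carrier (G (Suc (Suc i)))"
      "y \<ominus>\<^bsub>G (Suc i)\<^esub> \<delta> (Suc (Suc i)) w \<in> mpow R (Suc 0) (G (Suc i))" using tor_maps_zeroD[OF T y] .
    interpret Gi: module R "G i" by (rule G_res)
    have "\<delta> (Suc i) (y \<ominus>\<^bsub>G (Suc i)\<^esub> \<delta> (Suc (Suc i)) w) = \<delta> (Suc i) y"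
      using hom_arith(3)[OF G_res(1) G_res(1) G_res(3) y(1) homD(1)[OF G_res(3) w(1)]] G_res(9)[OF w(1)] homD(1)[OF G_res(3) y(1)]
      by (simp add: Gi.minus_zero_right)
    thus ?thesis using w(2) by (metis imageI)
  qed
  have Km': "\<And>x. x \<in> carrier (L\<lparr>carrier := K\<rparr>) \<Longrightarrow> x \<in> mpow R (Suc 0) L" using Km by auto
  obtain \<alpha> where "\<And>i. \<alpha> i \<in> module_hom R (P i) (G i)"
    "\<And>i x. x \<in> carrier (P i) \<Longrightarrow> \<alpha> i x \<in> mpow R (Suc 0) (G i)"
    "\<And>x. x \<in> carrier (P 0) \<Longrightarrow> \<eta> (\<alpha> 0 x) = \<epsilon> x"
    "\<And>i x. x \<in> carrier (P (Suc i)) \<Longrightarrow> \<delta> (Suc i) (\<alpha> (Suc i) x) = \<alpha> i (d (Suc i) x)"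
    by (rule comparison_map[OF N' L P G inc Km' strict]) (assumption, assumption, assumption, rule that)
  note \<alpha> = this
  note data = L N K \<pi> P G \<alpha>
  show ?thesis
  proof (intro exI conjI allI)
    show "minimal_free_resolution R N (cone P G) (cone_diff P d G \<delta> \<alpha>) (\<lambda>x. \<pi> (\<eta> (snd x)))"
      by (rule cone_resolution[where L = L and N = N and K = K and \<pi> = \<pi> and P = P and d = d and \<epsilon> = \<epsilon> and G = G and \<delta> = \<delta>
        and \<eta> = \<eta> and \<alpha> = \<alpha>]) (fact data)+
    show "tor_maps_zero (cone P G) (cone_diff P d G \<delta> \<alpha>) (Suc (Suc i)) \<longleftrightarrow> tor_maps_zero P d (Suc i)" for i
      by (rule tor_maps_zero_cone_Suc[where L = L and N = N and K = K and \<pi> = \<pi> and P = P and d = d and \<epsilon> = \<epsilon> and G = G and \<delta> = \<delta>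
        and \<eta> = \<eta> and \<alpha> = \<alpha>]) (fact data T)+
    show "tor_maps_zero (cone P G) (cone_diff P d G \<delta> \<alpha>) (Suc 0) \<longleftrightarrow>
        (\<forall>q. K \<inter> mpow R (Suc q) L \<subseteq> mpow R q (L\<lparr>carrier := K\<rparr>))"
      by (rule tor_maps_zero_cone_1[where L = L and N = N and K = K and \<pi> = \<pi> and P = P and d = d and \<epsilon> = \<epsilon> and G = G and \<delta> = \<delta>
        and \<eta> = \<eta> and \<alpha> = \<alpha>]) (fact data T)+
  qed
qed

end

section \<open>Finite powers of resolutions, syzygies and isomorphisms\<close>

lemma enat_eqI_le: "(\<And>e. a \<le> enat e \<longleftrightarrow> b \<le> enat e) \<Longrightarrow> a = b"
  by (metis enat.exhaust enat_ord_code(3) order_antisym order_refl)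

context noetherian_local_ring
begin

lemma power_map_hom:
  assumes M: "module R M" and N: "module R N" and f: "f \<in> module_hom R M N"
  shows "(\<lambda>x. \<lambda>j\<in>J. f (x j)) \<in> module_hom R (power_module J M) (power_module J N)"
  using homD[OF f] by (intro homI) (auto simp: power_module_simps PiE_iff intro!: restrict_ext)

lemma power_map_image:
  assumes f: "\<And>x. x \<in> A \<Longrightarrow> f x \<in> B" and y: "y \<in> J \<rightarrow>\<^sub>E f ` A"
  shows "\<exists>x\<in>J \<rightarrow>\<^sub>E A. y = (\<lambda>j\<in>J. f (x j))"
proof -
  have "\<forall>j\<in>J. \<exists>a\<in>A. f a = y j" using y by force
  then obtain a where a: "\<And>j. j \<in> J \<Longrightarrow> a j \<in> A" "\<And>j. j \<in> J \<Longrightarrow> f (a j) = y j" by metis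
  have "y = (\<lambda>j\<in>J. f (restrict a J j))"
    using a y by (intro ext) (auto simp: PiE_iff extensional_def)
  thus ?thesis using a by (intro bexI[of _ "restrict a J"]) auto
qed

lemma power_minus:
  assumes M: "module R M" and "x \<in> carrier (power_module J M)" "y \<in> carrier (power_module J M)" "j \<in> J"
  shows "(x \<ominus>\<^bsub>power_module J M\<^esub> y) j = x j \<ominus>\<^bsub>M\<^esub> y j"
  using hom_arith(3)[OF power_module_module[OF M] M power_module_homs(1)[OF M assms(4)] assms(2,3)] by simp

lemma power_resolution:
  assumes M: "module R M" and F: "minimal_free_resolution R M F d \<epsilon>" and J: "finite J"
  shows "minimal_free_resolution R (power_module J M) (\<lambda>i. power_module J (F i))
    (\<lambda>i x. \<lambda>j\<in>J. d i (x j)) (\<lambda>x. \<lambda>j\<in>J. \<epsilon> (x j))"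
proof (rule minimal_free_resolutionI)
  note f = minimal_free_resolutionD[OF F M]
  note dc = homD(1)[OF f(3)] and \<epsilon>c = homD(1)[OF f(4)]
  show "module R (power_module J (F i))" for i by (rule power_module_module[OF f(1)])
  show "free_of_finite_rank R (power_module J (F i))" for i by (rule free_power[OF f(1,2) J])
  show "(\<lambda>x. \<lambda>j\<in>J. d (Suc i) (x j)) \<in> module_hom R (power_module J (F (Suc i))) (power_module J (F i))" for i
    by (rule power_map_hom[OF f(1) f(1) f(3)])
  show h: "(\<lambda>x. \<lambda>j\<in>J. \<epsilon> (x j)) \<in> module_hom R (power_module J (F 0)) (power_module J M)"
    by (rule power_map_hom[OF f(1) M f(4)])
  show "(\<lambda>x. \<lambda>j\<in>J. \<epsilon> (x j)) ` carrier (power_module J (F 0)) = carrier (power_module J M)"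
  proof
    show "(\<lambda>x. \<lambda>j\<in>J. \<epsilon> (x j)) ` carrier (power_module J (F 0)) \<subseteq> carrier (power_module J M)"
      using homD(1)[OF h] by blast
    show "carrier (power_module J M) \<subseteq> (\<lambda>x. \<lambda>j\<in>J. \<epsilon> (x j)) ` carrier (power_module J (F 0))"
    proof
      fix y assume "y \<in> carrier (power_module J M)"
      hence "y \<in> J \<rightarrow>\<^sub>E \<epsilon> ` carrier (F 0)" using f(5) by (simp add: power_module_simps)
      from power_map_image[OF \<epsilon>c this] show "y \<in> (\<lambda>x. \<lambda>j\<in>J. \<epsilon> (x j)) ` carrier (power_module J (F 0))"
        by (auto simp: power_module_simps)
    qed
  qed
  show "x \<in> (\<lambda>x. \<lambda>j\<in>J. d (Suc 0) (x j)) ` carrier (power_module J (F (Suc 0)))"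
    if x: "x \<in> carrier (power_module J (F 0))" "(\<lambda>j\<in>J. \<epsilon> (x j)) = \<zero>\<^bsub>power_module J M\<^esub>" for x
  proof -
    have "\<epsilon> (x j) = \<zero>\<^bsub>M\<^esub>" if "j \<in> J" for j
      using fun_cong[OF x(2), of j] that by (simp add: power_module_simps)
    hence "x \<in> J \<rightarrow>\<^sub>E d (Suc 0) ` carrier (F (Suc 0))"
      using x(1) f(6) by (auto simp: power_module_simps PiE_iff)
    from power_map_image[OF dc this] show ?thesis by (auto simp: power_module_simps)
  qed
  show "(\<lambda>j\<in>J. \<epsilon> ((\<lambda>j\<in>J. d (Suc 0) (x j)) j)) = \<zero>\<^bsub>power_module J M\<^esub>"
    if "x \<in> carrier (power_module J (F (Suc 0)))" for x
    using that by (auto simp: power_module_simps PiE_iff f(7) intro!: restrict_ext)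
  show "x \<in> (\<lambda>x. \<lambda>j\<in>J. d (Suc (Suc i)) (x j)) ` carrier (power_module J (F (Suc (Suc i))))"
    if x: "x \<in> carrier (power_module J (F (Suc i)))" "(\<lambda>j\<in>J. d (Suc i) (x j)) = \<zero>\<^bsub>power_module J (F i)\<^esub>" for i x
  proof -
    have "d (Suc i) (x j) = \<zero>\<^bsub>F i\<^esub>" if "j \<in> J" for j
      using fun_cong[OF x(2), of j] that by (simp add: power_module_simps)
    hence "x \<in> J \<rightarrow>\<^sub>E d (Suc (Suc i)) ` carrier (F (Suc (Suc i)))"
      using x(1) f(8) by (auto simp: power_module_simps PiE_iff)
    from power_map_image[OF dc this] show ?thesis by (auto simp: power_module_simps)
  qed
  show "(\<lambda>j\<in>J. d (Suc i) ((\<lambda>j\<in>J. d (Suc (Suc i)) (x j)) j)) = \<zero>\<^bsub>power_module J (F i)\<^esub>"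
    if "x \<in> carrier (power_module J (F (Suc (Suc i))))" for i x
    using that by (auto simp: power_module_simps PiE_iff f(9) intro!: restrict_ext)
  show "(\<lambda>j\<in>J. d (Suc i) (x j)) \<in> mpow R (Suc 0) (power_module J (F i))"
    if "x \<in> carrier (power_module J (F (Suc i)))" for i x
    using that f(10) unfolding mpow_power[OF f(1) J] by (auto simp: power_module_simps PiE_iff)
qed

lemma power_tor_maps_zero:
  assumes M: "module R M" and F: "minimal_free_resolution R M F d \<epsilon>" and J: "finite J"
    and T: "tor_maps_zero F d (Suc i)"
  shows "tor_maps_zero (\<lambda>i. power_module J (F i)) (\<lambda>i x. \<lambda>j\<in>J. d i (x j)) (Suc i)"
proof (rule tor_maps_zeroI)
  note f = minimal_free_resolutionD[OF F M]
  let ?P = "\<lambda>i. power_module J (F i)"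
  fix q x assume x: "x \<in> carrier (?P (Suc i))" and dx: "(\<lambda>j\<in>J. d (Suc i) (x j)) \<in> mpow R (Suc q) (?P i)"
  have "\<exists>y\<in>carrier (F (Suc (Suc i))). x j \<ominus>\<^bsub>F (Suc i)\<^esub> d (Suc (Suc i)) y \<in> mpow R q (F (Suc i))"
    if j: "j \<in> J" for j
  proof -
    have xj: "x j \<in> carrier (F (Suc i))" using x j by (auto simp: power_module_simps)
    have "(\<lambda>j\<in>J. d (Suc i) (x j)) j \<in> mpow R (Suc q) (F i)"
      using dx j unfolding mpow_power[OF f(1) J] by (rule PiE_mem)
    hence "d (Suc i) (x j) \<in> mpow R (Suc q) (F i)" using j by simp
    from tor_maps_zeroD[OF T xj this] show ?thesis by blast
  qed
  then obtain y where y: "\<And>j. j \<in> J \<Longrightarrow> y j \<in> carrier (F (Suc (Suc i)))"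
    "\<And>j. j \<in> J \<Longrightarrow> x j \<ominus>\<^bsub>F (Suc i)\<^esub> d (Suc (Suc i)) (y j) \<in> mpow R q (F (Suc i))" by metis
  have yc: "restrict y J \<in> carrier (?P (Suc (Suc i)))" using y(1) by (auto simp: power_module_simps)
  let ?dy = "\<lambda>j\<in>J. d (Suc (Suc i)) (restrict y J j)"
  have dy: "?dy \<in> carrier (?P (Suc i))"
    using y(1) homD(1)[OF f(3)] by (auto simp: power_module_simps)
  interpret Q: module R "?P (Suc i)" by (rule power_module_module[OF f(1)])
  have "x \<ominus>\<^bsub>?P (Suc i)\<^esub> ?dy \<in> carrier (?P (Suc i))" using x dy by simp
  moreover have "(x \<ominus>\<^bsub>?P (Suc i)\<^esub> ?dy) j \<in> mpow R q (F (Suc i))" if "j \<in> J" for j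
    using power_minus[OF f(1) x dy that] y(2)[OF that] that by simp
  ultimately have "x \<ominus>\<^bsub>?P (Suc i)\<^esub> ?dy \<in> mpow R q (?P (Suc i))"
    unfolding mpow_power[OF f(1) J] by (auto simp: power_module_simps(1) PiE_iff)
  thus "\<exists>y\<in>carrier (?P (Suc (Suc i))). x \<ominus>\<^bsub>?P (Suc i)\<^esub> (\<lambda>j\<in>J. d (Suc (Suc i)) (y j)) \<in> mpow R q (?P (Suc i))"
    using yc by blast
qed

text \<open>The first syzygy: \<open>Tor\<^sub>1(M, R/\<mm>\<^sup>q) = (K \<inter> \<mm>\<^sup>q F\<^sub>0) / \<mm>\<^sup>q K\<close> for \<open>K\<close> the image of \<open>d\<^sub>1\<close>.\<close>

lemma first_syzygy:
  assumes M: "module R M" and F: "minimal_free_resolution R M F d \<epsilon>"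
  defines "K \<equiv> d (Suc 0) ` carrier (F (Suc 0))"
  shows "submodule K R (F 0)" "K \<subseteq> mpow R (Suc 0) (F 0)" "a_kernel (F 0) M \<epsilon> = K"
    "minimal_free_resolution R ((F 0)\<lparr>carrier := K\<rparr>) (\<lambda>i. F (Suc i)) (\<lambda>i. d (Suc i)) (d (Suc 0))"
    "finitely_generated R ((F 0)\<lparr>carrier := K\<rparr>)"
    "tor_maps_zero F d (Suc 0) \<longleftrightarrow> (\<forall>q. K \<inter> mpow R (Suc q) (F 0) \<subseteq> mpow R q ((F 0)\<lparr>carrier := K\<rparr>))"
proof -
  note f = minimal_free_resolutionD[OF F M]
  show K: "submodule K R (F 0)"
    unfolding K_def by (rule submodule_image[OF f(1) f(1) f(3) module.carrier_is_submodule[OF f(1)]])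
  show "K \<subseteq> mpow R (Suc 0) (F 0)" unfolding K_def using f(10) by auto
  show "a_kernel (F 0) M \<epsilon> = K"
    unfolding K_def using f(6,7) homD(1)[OF f(3)] by (auto simp: a_kernel_iff)
  have mK: "module R ((F 0)\<lparr>carrier := K\<rparr>)" by (rule submodule.submodule_is_module[OF K f(1)])
  have dK: "d (Suc 0) \<in> module_hom R (F (Suc 0)) ((F 0)\<lparr>carrier := K\<rparr>)"
    using homD[OF f(3)] by (intro homI) (auto simp: K_def)
  have dK': "d (Suc 0) ` carrier (F (Suc 0)) = carrier ((F 0)\<lparr>carrier := K\<rparr>)" by (simp add: K_def)
  show "minimal_free_resolution R ((F 0)\<lparr>carrier := K\<rparr>) (\<lambda>i. F (Suc i)) (\<lambda>i. d (Suc i)) (d (Suc 0))"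
    using f dK dK' by (intro minimal_free_resolutionI) simp_all
  show "finitely_generated R ((F 0)\<lparr>carrier := K\<rparr>)"
    by (rule finitely_generated_image[OF f(1) mK dK dK' free_finitely_generated[OF f(1,2)]])
  interpret F1: module R "F (Suc 0)" by (rule f)
  interpret F0: module R "F 0" by (rule f)
  show "tor_maps_zero F d (Suc 0) \<longleftrightarrow> (\<forall>q. K \<inter> mpow R (Suc q) (F 0) \<subseteq> mpow R q ((F 0)\<lparr>carrier := K\<rparr>))"
  proof
    assume T: "tor_maps_zero F d (Suc 0)"
    show "\<forall>q. K \<inter> mpow R (Suc q) (F 0) \<subseteq> mpow R q ((F 0)\<lparr>carrier := K\<rparr>)"
    proof (intro allI subsetI)
      fix q u assume "u \<in> K \<inter> mpow R (Suc q) (F 0)"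
      then obtain x where x: "x \<in> carrier (F (Suc 0))" "u = d (Suc 0) x" "d (Suc 0) x \<in> mpow R (Suc q) (F 0)"
        by (auto simp: K_def)
      obtain y where y: "y \<in> carrier (F (Suc (Suc 0)))"
        "x \<ominus>\<^bsub>F (Suc 0)\<^esub> d (Suc (Suc 0)) y \<in> mpow R q (F (Suc 0))"
        using tor_maps_zeroD[OF T x(1,3)] .
      have "d (Suc 0) (x \<ominus>\<^bsub>F (Suc 0)\<^esub> d (Suc (Suc 0)) y) = u"
        using hom_arith(3)[OF f(1) f(1) f(3) x(1) homD(1)[OF f(3) y(1)]] f(9)[OF y(1)] homD(1)[OF f(3) x(1)] x(2)
        by (simp add: F0.minus_zero_right)
      thus "u \<in> mpow R q ((F 0)\<lparr>carrier := K\<rparr>)" using mpow_hom_0[OF f(1) mK dK y(2)] by simp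
    qed
  next
    assume AR: "\<forall>q. K \<inter> mpow R (Suc q) (F 0) \<subseteq> mpow R q ((F 0)\<lparr>carrier := K\<rparr>)"
    show "tor_maps_zero F d (Suc 0)"
    proof (rule tor_maps_zeroI)
      fix q x assume x: "x \<in> carrier (F (Suc 0))" "d (Suc 0) x \<in> mpow R (Suc q) (F 0)"
      have "d (Suc 0) x \<in> K" unfolding K_def using x(1) by (rule imageI)
      hence "d (Suc 0) x \<in> mpow R q ((F 0)\<lparr>carrier := K\<rparr>)" using AR x(2) by blast
      then obtain z where z: "z \<in> mpow R q (F (Suc 0))" "d (Suc 0) x = d (Suc 0) z"
        using mpow_surj[OF f(1) mK dK dK'] by blast
      have zc: "z \<in> carrier (F (Suc 0))" using mpowD(7)[OF f(1) z(1)] .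
      have "d (Suc 0) (x \<ominus>\<^bsub>F (Suc 0)\<^esub> z) = \<zero>\<^bsub>F 0\<^esub>"
        using hom_arith(3)[OF f(1) f(1) f(3) x(1) zc] z(2) homD(1)[OF f(3) zc] by (simp add: F0.minus_zero_iff)
      then obtain y where y: "y \<in> carrier (F (Suc (Suc 0)))" "x \<ominus>\<^bsub>F (Suc 0)\<^esub> z = d (Suc (Suc 0)) y"
        using f(8)[of "x \<ominus>\<^bsub>F (Suc 0)\<^esub> z" 0] x(1) zc by auto
      have "x \<ominus>\<^bsub>F (Suc 0)\<^esub> d (Suc (Suc 0)) y = z"
        unfolding y(2)[symmetric] using x(1) zc by (rule F1.minus_minus_cancel(1))
      thus "\<exists>y\<in>carrier (F (Suc (Suc 0))). x \<ominus>\<^bsub>F (Suc 0)\<^esub> d (Suc (Suc 0)) y \<in> mpow R q (F (Suc 0))"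
        using y(1) z(1) by auto
    qed
  qed
qed

lemma tor_maps_zero_shift:
  "tor_maps_zero (\<lambda>i. F (Suc i)) (\<lambda>i. d (Suc i)) (Suc i) \<longleftrightarrow> tor_maps_zero F d (Suc (Suc i))"
  by (simp add: tor_maps_zero_def)

lemma ld_iso:
  assumes M: "module R M" and N: "module R N" and fg: "finitely_generated R M"
    and \<theta>: "\<theta> \<in> module_hom R M N" "bij_betw \<theta> (carrier M) (carrier N)"
  shows "finitely_generated R N" "ld R M = ld R N"
proof -
  show fgN: "finitely_generated R N"
    using finitely_generated_image[OF M N \<theta>(1) _ fg] \<theta>(2) by (simp add: bij_betw_def)
  have \<theta>0: "\<theta> \<zero>\<^bsub>M\<^esub> = \<zero>\<^bsub>N\<^esub>" by (rule hom_arith(1)[OF M N \<theta>(1)])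
  have zero: "carrier M = {\<zero>\<^bsub>M\<^esub>} \<longleftrightarrow> carrier N = {\<zero>\<^bsub>N\<^esub>}"
  proof
    assume "carrier M = {\<zero>\<^bsub>M\<^esub>}"
    thus "carrier N = {\<zero>\<^bsub>N\<^esub>}" using \<theta>(2) \<theta>0 by (auto simp: bij_betw_def)
  next
    interpret M: module R M by fact
    assume N0: "carrier N = {\<zero>\<^bsub>N\<^esub>}"
    have "x = \<zero>\<^bsub>M\<^esub>" if "x \<in> carrier M" for x
      using \<theta>(2) that N0 \<theta>0 homD(1)[OF \<theta>(1) that] M.M.zero_closed by (metis bij_betw_def inj_onD singletonD)
    thus "carrier M = {\<zero>\<^bsub>M\<^esub>}" by auto
  qed
  show "ld R M = ld R N"
  proof (cases "carrier M = {\<zero>\<^bsub>M\<^esub>}")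
    case True thus ?thesis using zero by (simp add: ld_def)
  next
    case False
    hence nz: "carrier N \<noteq> {\<zero>\<^bsub>N\<^esub>}" using zero by simp
    obtain F :: "nat \<Rightarrow> ('a, nat \<Rightarrow> 'a) module" and d \<epsilon> where F: "minimal_free_resolution R M F d \<epsilon>"
      using minimal_free_resolution_exists[OF M fg] by blast
    note F' = minimal_free_resolution_iso[OF M N F \<theta>]
    show ?thesis
      by (rule enat_eqI_le) (simp add: ld_le_iff[OF M fg False F] ld_le_iff[OF N fgN nz F'])
  qed
qed

lemma transport_module:
  fixes M :: "('a, 'm) module" and \<psi> :: "'m \<Rightarrow> 'n"
  assumes M: "module R M" and inj: "inj_on \<psi> (carrier M)"
  shows "\<exists>N :: ('a, 'n) module. module R N \<and> \<psi> \<in> module_hom R M N \<and> bij_betw \<psi> (carrier M) (carrier N)"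
proof -
  interpret M: module R M by fact
  let ?i = "the_inv_into (carrier M) \<psi>"
  have i: "?i (\<psi> x) = x" if "x \<in> carrier M" for x by (rule the_inv_into_f_f[OF inj that])
  define N :: "('a, 'n) module" where "N = \<lparr>carrier = \<psi> ` carrier M, monoid.mult = undefined, one = undefined,
    zero = \<psi> \<zero>\<^bsub>M\<^esub>, add = (\<lambda>x y. \<psi> (?i x \<oplus>\<^bsub>M\<^esub> ?i y)), smult = (\<lambda>r x. \<psi> (r \<odot>\<^bsub>M\<^esub> ?i x))\<rparr>"
  have simps: "carrier N = \<psi> ` carrier M" "\<zero>\<^bsub>N\<^esub> = \<psi> \<zero>\<^bsub>M\<^esub>"
    "\<And>x y. x \<in> carrier M \<Longrightarrow> y \<in> carrier M \<Longrightarrow> \<psi> x \<oplus>\<^bsub>N\<^esub> \<psi> y = \<psi> (x \<oplus>\<^bsub>M\<^esub> y)"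
    "\<And>r x. x \<in> carrier M \<Longrightarrow> r \<odot>\<^bsub>N\<^esub> \<psi> x = \<psi> (r \<odot>\<^bsub>M\<^esub> x)"
    by (simp_all add: N_def i)
  have "abelian_group N"
  proof (rule abelian_groupI)
    fix x assume "x \<in> carrier N"
    then obtain a where a: "a \<in> carrier M" "x = \<psi> a" by (auto simp: simps)
    show "\<exists>y\<in>carrier N. y \<oplus>\<^bsub>N\<^esub> x = \<zero>\<^bsub>N\<^esub>"
      using a by (intro bexI[of _ "\<psi> (\<ominus>\<^bsub>M\<^esub> a)"]) (auto simp: simps M.l_neg)
  qed (auto simp: simps M.a_ac)
  hence "module R N"
    by (rule moduleI[OF is_cring]) (auto simp: simps M.smult_l_distr M.smult_r_distr M.smult_assoc1)
  moreover have "\<psi> \<in> module_hom R M N" by (rule homI) (auto simp: simps)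
  moreover have "bij_betw \<psi> (carrier M) (carrier N)" using inj by (simp add: bij_betw_def simps)
  ultimately show ?thesis by blast
qed

text \<open>The fibres of a finite free cover serve as names for the elements of the module; this gives a copy on
  the carrier type over which \<^const>\<open>gl_ld\<close> and \<^const>\<open>absolutely_koszul\<close> range.\<close>

lemma isomorphic_copy:
  assumes M: "module R M" and fg: "finitely_generated R M"
  shows "\<exists>N :: ('a, (nat \<Rightarrow> 'a) set) module. module R N \<and> finitely_generated R N \<and> ld R N = ld R M"
proof -
  obtain F :: "('a, nat \<Rightarrow> 'a) module" and \<epsilon> where F: "\<epsilon> ` carrier F = carrier M"
    using minimal_cover[OF M fg] by blast
  define \<psi> where "\<psi> m = {x \<in> carrier F. \<epsilon> x = m}" for m
  have "inj_on \<psi> (carrier M)"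
  proof (rule inj_onI)
    fix m m' assume m: "m \<in> carrier M" "\<psi> m = \<psi> m'"
    have "m \<in> \<epsilon> ` carrier F" using m(1) F by simp
    then obtain x where x: "x \<in> carrier F" "m = \<epsilon> x" by (rule imageE)
    hence "x \<in> \<psi> m" by (simp add: \<psi>_def)
    thus "m = m'" unfolding m(2) using x by (simp add: \<psi>_def)
  qed
  from transport_module[OF M this] obtain N :: "('a, (nat \<Rightarrow> 'a) set) module"
    where N: "module R N" "\<psi> \<in> module_hom R M N" "bij_betw \<psi> (carrier M) (carrier N)" by blast
  show ?thesis using ld_iso[OF M N(1) fg N(2,3)] N(1) by auto
qed

end

section \<open>Change of rings along a surjection\<close>

lemma restrict_scalars_simps [simp]:
  "carrier (restrict_scalars \<phi> M) = carrier M" "\<zero>\<^bsub>restrict_scalars \<phi> M\<^esub> = \<zero>\<^bsub>M\<^esub>"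
  "x \<oplus>\<^bsub>restrict_scalars \<phi> M\<^esub> y = x \<oplus>\<^bsub>M\<^esub> y" "r \<odot>\<^bsub>restrict_scalars \<phi> M\<^esub> x = \<phi> r \<odot>\<^bsub>M\<^esub> x"
  by (simp_all add: restrict_scalars_def)

lemma restrict_scalars_carrier_update:
  "(restrict_scalars \<phi> M)\<lparr>carrier := K\<rparr> = restrict_scalars \<phi> (M\<lparr>carrier := K\<rparr>)"
  by (simp add: restrict_scalars_def)

lemma restrict_scalars_power:
  "restrict_scalars \<phi> (power_module J M) = power_module J (restrict_scalars \<phi> M)"
  by (simp add: restrict_scalars_def power_module_def)

lemma a_kernel_restrict_scalars:
  "a_kernel (restrict_scalars \<phi> M) (restrict_scalars \<phi> N) f = a_kernel M N f"
  by (auto simp: a_kernel_iff)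

locale local_surjection = R: noetherian_local_ring R + S: noetherian_local_ring S
  for R :: "('a, 'r) ring_scheme" and S :: "('b, 's) ring_scheme" +
  fixes \<phi> :: "'a \<Rightarrow> 'b"
  assumes \<phi>_hom: "\<phi> \<in> ring_hom R S" and \<phi>_surj: "\<phi> ` carrier R = carrier S"
begin

lemmas \<phi>_simps = ring_hom_closed[OF \<phi>_hom] ring_hom_mult[OF \<phi>_hom] ring_hom_add[OF \<phi>_hom] ring_hom_one[OF \<phi>_hom]

text \<open>The preimage of the maximal ideal of \<open>S\<close> is a proper ideal, hence lies in that of \<open>R\<close>. Conversely, if
  \<open>a\<close> in the maximal ideal of \<open>R\<close> had an image with inverse \<open>\<phi> b\<close>, then \<open>1 - a b\<close> would be in the kernel of
  \<open>\<phi>\<close>, hence in the maximal ideal, and so would 1.\<close>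

lemma \<phi>_max_ideal: "\<phi> ` max_ideal R = max_ideal S"
proof -
  interpret \<phi>: ring_hom_ring R S \<phi>
    using \<phi>_hom by (intro ring_hom_ringI2) unfold_locales
  interpret n: ideal "max_ideal S" S by (rule S.max_ideal_ideal)
  let ?I = "{r \<in> carrier R. \<phi> r \<in> max_ideal S}"
  have one: "\<one>\<^bsub>S\<^esub> \<notin> max_ideal S"
    using maximalideal.I_notcarr[OF S.max_ideal_maximal] n.one_imp_carrier by auto
  have "ideal ?I R"
  proof (rule idealI)
    show "ring R" by unfold_locales
    show "subgroup ?I (add_monoid R)"
      by (rule R.add.subgroupI) (auto intro: n.a_closed n.a_inv_closed simp: n.zero_closed)
    show "x \<otimes>\<^bsub>R\<^esub> a \<in> ?I" "a \<otimes>\<^bsub>R\<^esub> x \<in> ?I" if "a \<in> ?I" "x \<in> carrier R" for a x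
      using that by (auto intro: n.I_l_closed n.I_r_closed)
  qed
  moreover have "\<one>\<^bsub>R\<^esub> \<notin> ?I" using one by simp
  hence "?I \<noteq> carrier R" using R.one_closed by blast
  ultimately have I: "?I \<subseteq> max_ideal R" by (rule R.proper_ideal_subset)
  show ?thesis
  proof
    show "max_ideal S \<subseteq> \<phi> ` max_ideal R"
    proof
      fix s assume s: "s \<in> max_ideal S"
      hence "s \<in> \<phi> ` carrier R" unfolding \<phi>_surj by (rule S.max_ideal_carrier)
      thus "s \<in> \<phi> ` max_ideal R" using I s by auto
    qed
    show "\<phi> ` max_ideal R \<subseteq> max_ideal S"
    proof (rule image_subsetI, rule ccontr)
      fix a assume a: "a \<in> max_ideal R" "\<phi> a \<notin> max_ideal S"
      note ac = R.max_ideal_carrier[OF a(1)]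
      interpret m: ideal "max_ideal R" R by (rule R.max_ideal_ideal)
      have "\<phi> a \<in> Units S" using S.Units_outside_max_ideal a ac by auto
      hence "inv\<^bsub>S\<^esub> (\<phi> a) \<in> \<phi> ` carrier R" "\<phi> a \<otimes>\<^bsub>S\<^esub> inv\<^bsub>S\<^esub> (\<phi> a) = \<one>\<^bsub>S\<^esub>"
        unfolding \<phi>_surj by auto
      then obtain b where b: "b \<in> carrier R" "\<phi> a \<otimes>\<^bsub>S\<^esub> \<phi> b = \<one>\<^bsub>S\<^esub>" by auto
      have ab: "a \<otimes>\<^bsub>R\<^esub> b \<in> max_ideal R" using a(1) b(1) by (rule m.I_r_closed)
      have abc: "a \<otimes>\<^bsub>R\<^esub> b \<in> carrier R" using ac b by simp
      have "\<phi> (\<one>\<^bsub>R\<^esub> \<ominus>\<^bsub>R\<^esub> a \<otimes>\<^bsub>R\<^esub> b) = \<zero>\<^bsub>S\<^esub>"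
        using ac b by (simp add: a_minus_def S.r_neg)
      hence "\<one>\<^bsub>R\<^esub> \<ominus>\<^bsub>R\<^esub> a \<otimes>\<^bsub>R\<^esub> b \<in> ?I" using abc n.zero_closed by simp
      hence "\<one>\<^bsub>R\<^esub> \<ominus>\<^bsub>R\<^esub> a \<otimes>\<^bsub>R\<^esub> b \<in> max_ideal R" using I by auto
      from m.a_closed[OF this ab] have "\<one>\<^bsub>R\<^esub> \<in> max_ideal R"
        using abc R.minus_minus_cancel(3)[of "\<one>\<^bsub>R\<^esub>" "a \<otimes>\<^bsub>R\<^esub> b"] by simp
      thus False using maximalideal.I_notcarr[OF R.max_ideal_maximal] m.one_imp_carrier by auto
    qed
  qed
qed

lemma restrict_module:
  assumes M: "module S M"
  shows "module R (restrict_scalars \<phi> M)"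
proof -
  interpret M: module S M by fact
  have "abelian_group (restrict_scalars \<phi> M)"
  proof (rule abelian_groupI)
    fix x assume x: "x \<in> carrier (restrict_scalars \<phi> M)"
    show "\<exists>y\<in>carrier (restrict_scalars \<phi> M). y \<oplus>\<^bsub>restrict_scalars \<phi> M\<^esub> x = \<zero>\<^bsub>restrict_scalars \<phi> M\<^esub>"
      using x by (intro bexI[of _ "\<ominus>\<^bsub>M\<^esub> x"]) (auto simp: M.l_neg)
  qed (auto simp: M.a_ac)
  thus ?thesis
    by (rule moduleI[OF R.is_cring])
       (auto simp: \<phi>_simps M.smult_l_distr M.smult_r_distr M.smult_assoc1)
qed

lemma restrict_mpow:
  assumes M: "module S M"
  shows "mpow R q (restrict_scalars \<phi> M) = mpow S q M"
proof (induction q)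
  case 0 thus ?case by (simp add: R.mpow_0[OF restrict_module[OF M]] S.mpow_0[OF M])
next
  case (Suc q)
  show ?case
  proof
    show "mpow R (Suc q) (restrict_scalars \<phi> M) \<subseteq> mpow S (Suc q) M"
    proof (rule R.mpow_Suc_subset[OF restrict_module[OF M]])
      show "x \<oplus>\<^bsub>restrict_scalars \<phi> M\<^esub> y \<in> mpow S (Suc q) M"
        if "x \<in> mpow S (Suc q) M" "y \<in> mpow S (Suc q) M" for x y
        using S.mpowD(5)[OF M that] by simp
      show "a \<odot>\<^bsub>restrict_scalars \<phi> M\<^esub> x \<in> mpow S (Suc q) M"
        if "a \<in> max_ideal R" "x \<in> mpow R q (restrict_scalars \<phi> M)" for a x
        using that S.mpow_SucI[OF M, of "\<phi> a" x q] \<phi>_max_ideal Suc.IH by auto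
    qed
    show "mpow S (Suc q) M \<subseteq> mpow R (Suc q) (restrict_scalars \<phi> M)"
    proof (rule S.mpow_Suc_subset[OF M])
      show "x \<oplus>\<^bsub>M\<^esub> y \<in> mpow R (Suc q) (restrict_scalars \<phi> M)"
        if "x \<in> mpow R (Suc q) (restrict_scalars \<phi> M)" "y \<in> mpow R (Suc q) (restrict_scalars \<phi> M)" for x y
        using R.mpowD(5)[OF restrict_module[OF M] that] by simp
      show "b \<odot>\<^bsub>M\<^esub> x \<in> mpow R (Suc q) (restrict_scalars \<phi> M)"
        if b: "b \<in> max_ideal S" and x: "x \<in> mpow S q M" for b x
      proof -
        obtain a where a: "a \<in> max_ideal R" "b = \<phi> a" using b unfolding \<phi>_max_ideal[symmetric] by auto
        show ?thesis
          using R.mpow_SucI[OF restrict_module[OF M] a(1), of x q] x Suc.IH by (simp add: a(2))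
      qed
    qed
  qed
qed

lemma restrict_hom:
  "f \<in> module_hom S M N \<Longrightarrow> f \<in> module_hom R (restrict_scalars \<phi> M) (restrict_scalars \<phi> N)"
  using homD[of f S M N] \<phi>_simps(1) by (intro homI) auto

lemma restrict_submodule:
  assumes M: "module S M" and K: "submodule K S M"
  shows "submodule K R (restrict_scalars \<phi> M)"
  using submoduleD[OF M K] \<phi>_simps(1) by (intro submodule_closedI[OF restrict_module[OF M]]) auto

lemma restrict_finitely_generated:
  assumes M: "module S M" and fg: "finitely_generated S M"
  shows "finitely_generated R (restrict_scalars \<phi> M)"
proof -
  obtain A where A: "finite A" "A \<subseteq> carrier M" "lspan S M A = carrier M"
    using fg finitely_generated_iff_lspan[OF M] by auto
  let ?M = "restrict_scalars \<phi> M"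
  have "x \<in> lspan R ?M A" if "x \<in> lspan S M A" for x
    using that
  proof induct
    case zero show ?case using lspan.zero[of ?M R A] by simp
  next
    case (gen a) thus ?case by (rule lspan.gen)
  next
    case (add x y) thus ?case using lspan.add[of x R ?M A y] by simp
  next
    case (smult s x)
    then obtain r where "r \<in> carrier R" "s = \<phi> r" using \<phi>_surj by auto
    thus ?case using smult lspan.smult[of r R x ?M A] by simp
  qed
  moreover have "lspan R ?M A \<subseteq> carrier ?M"
    using submoduleD(1)[OF restrict_module[OF M] lspan_submodule[OF restrict_module[OF M]], of A] A(2) by simp
  ultimately show ?thesis
    unfolding finitely_generated_iff_lspan[OF restrict_module[OF M]] using A by auto
qed

context
  assumes ld_S: "ld R (restrict_scalars \<phi> (ring_as_module S)) = 0"
begin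

text \<open>Finite free \<open>S\<close>-modules inherit vanishing linearity defect over \<open>R\<close>, as finite powers of \<open>S\<close>.\<close>

lemma free_module_resolution:
  fixes L :: "('b, 'f) module"
  assumes L: "module S L" "free_of_finite_rank S L"
  shows "\<exists>(G :: nat \<Rightarrow> ('a, 'f \<Rightarrow> nat \<Rightarrow> 'a) module) \<delta> \<eta>.
    minimal_free_resolution R (restrict_scalars \<phi> L) G \<delta> \<eta> \<and> (\<forall>i. R.tor_maps_zero G \<delta> (Suc i))"
proof -
  let ?S = "ring_as_module S" and ?SR = "restrict_scalars \<phi> (ring_as_module S)"
  note mS = ring_as_module_module[OF S.is_cring] and mSR = restrict_module[OF ring_as_module_module[OF S.is_cring]]
  have fg: "finitely_generated R ?SR"
    by (rule restrict_finitely_generated[OF mS free_finitely_generated[OF mS S.ring_as_module_free]])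
  have nz: "carrier ?SR \<noteq> {\<zero>\<^bsub>?SR\<^esub>}"
    using S.one_not_zero S.one_closed by (auto simp: ring_as_module_simps)
  obtain F :: "nat \<Rightarrow> ('a, nat \<Rightarrow> 'a) module" and d \<epsilon> where F: "minimal_free_resolution R ?SR F d \<epsilon>"
    using R.minimal_free_resolution_exists[OF mSR fg] by blast
  have "ld R ?SR \<le> enat 0" using ld_S by (simp add: zero_enat_def)
  hence "\<forall>i>0. R.tor_maps_zero F d i" by (rule R.ld_le_iff[OF mSR fg nz F, THEN iffD1])
  hence T: "R.tor_maps_zero F d (Suc i)" for i by simp
  obtain B \<theta> where B: "finite B" "B \<subseteq> carrier L" and \<theta>: "\<theta> \<in> module_hom S (power_module B ?S) L"
    "bij_betw \<theta> (carrier (power_module B ?S)) (carrier L)"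
    by (rule free_iso_free_module[OF L, unfolded free_module_def]) (rule that)
  note B = B(1)
  have \<theta>R: "\<theta> \<in> module_hom R (power_module B ?SR) (restrict_scalars \<phi> L)"
    using restrict_hom[OF \<theta>(1)] by (simp add: restrict_scalars_power)
  have \<theta>b: "bij_betw \<theta> (carrier (power_module B ?SR)) (carrier (restrict_scalars \<phi> L))"
    using \<theta>(2) by (simp add: power_module_simps)
  from R.minimal_free_resolution_iso[OF power_module_module[OF mSR] restrict_module[OF L(1)]
      R.power_resolution[OF mSR F B] \<theta>R \<theta>b]
  show ?thesis by (intro exI conjI allI) (assumption, rule R.power_tor_maps_zero[OF mSR F B T])
qed

text \<open>One step of dimension shifting over both rings: \<open>N\<close> is replaced by its first syzygy over \<open>S\<close>.\<close>

lemma syzygy_step: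
  fixes N :: "('b, 'n) module" and D :: "nat \<Rightarrow> ('b, 'f) module"
    and P :: "nat \<Rightarrow> ('a, 'p) module" and P' :: "nat \<Rightarrow> ('a, 'q) module"
  assumes N: "module S N" and D: "minimal_free_resolution S N D d \<epsilon>"
    and P: "minimal_free_resolution R (restrict_scalars \<phi> N) P \<delta> \<eta>"
    and P': "minimal_free_resolution R
      (restrict_scalars \<phi> ((D 0)\<lparr>carrier := d (Suc 0) ` carrier (D (Suc 0))\<rparr>)) P' \<delta>' \<eta>'"
  shows "R.tor_maps_zero P \<delta> (Suc 0) \<longleftrightarrow> S.tor_maps_zero D d (Suc 0)"
    "R.tor_maps_zero P \<delta> (Suc (Suc i)) \<longleftrightarrow> R.tor_maps_zero P' \<delta>' (Suc i)"
proof -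
  note f = S.minimal_free_resolutionD[OF D N] and syz = S.first_syzygy[OF N D]
  let ?K = "d (Suc 0) ` carrier (D (Suc 0))" and ?L = "restrict_scalars \<phi> (D 0)"
  obtain G :: "nat \<Rightarrow> ('a, 'f \<Rightarrow> nat \<Rightarrow> 'a) module" and \<gamma> \<kappa>
    where G: "minimal_free_resolution R ?L G \<gamma> \<kappa>" and T: "\<And>i. R.tor_maps_zero G \<gamma> (Suc i)"
    using free_module_resolution[OF f(1,2)] by blast
  have L: "module R ?L" and NR: "module R (restrict_scalars \<phi> N)"
    using restrict_module f(1) N by auto
  have K: "submodule ?K R ?L" by (rule restrict_submodule[OF f(1) syz(1)])
  have Km: "?K \<subseteq> mpow R (Suc 0) ?L" using syz(2) by (simp add: restrict_mpow[OF f(1)])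
  have \<epsilon>: "\<epsilon> \<in> module_hom R ?L (restrict_scalars \<phi> N)" by (rule restrict_hom[OF f(4)])
  have \<epsilon>_surj: "\<epsilon> ` carrier ?L = carrier (restrict_scalars \<phi> N)" using f(5) by simp
  have \<epsilon>_ker: "a_kernel ?L (restrict_scalars \<phi> N) \<epsilon> = ?K" using syz(3) by (simp add: a_kernel_restrict_scalars)
  have P'': "minimal_free_resolution R (?L\<lparr>carrier := ?K\<rparr>) P' \<delta>' \<eta>'"
    using P' by (simp add: restrict_scalars_carrier_update)
  obtain C :: "nat \<Rightarrow> ('a, 'q \<times> ('f \<Rightarrow> nat \<Rightarrow> 'a)) module" and c e
    where C: "minimal_free_resolution R (restrict_scalars \<phi> N) C c e"
      and C_Suc: "\<And>i. R.tor_maps_zero C c (Suc (Suc i)) \<longleftrightarrow> R.tor_maps_zero P' \<delta>' (Suc i)"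
      and C_1: "R.tor_maps_zero C c (Suc 0) \<longleftrightarrow>
        (\<forall>q. ?K \<inter> mpow R (Suc q) ?L \<subseteq> mpow R q (?L\<lparr>carrier := ?K\<rparr>))"
    using R.resolution_of_quotient[OF L NR K Km \<epsilon> \<epsilon>_surj \<epsilon>_ker P'' G T] by blast
  have mK: "module S ((D 0)\<lparr>carrier := ?K\<rparr>)" by (rule submodule.submodule_is_module[OF syz(1) f(1)])
  show "R.tor_maps_zero P \<delta> (Suc 0) \<longleftrightarrow> S.tor_maps_zero D d (Suc 0)"
    using R.tor_maps_zero_independent[OF NR P C, of 0] C_1 syz(6)
    by (simp add: restrict_mpow[OF f(1)] restrict_scalars_carrier_update restrict_mpow[OF mK])
  show "R.tor_maps_zero P \<delta> (Suc (Suc i)) \<longleftrightarrow> R.tor_maps_zero P' \<delta>' (Suc i)"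
    using R.tor_maps_zero_independent[OF NR P C] C_Suc by simp
qed

lemma syzygy_resolution:
  fixes N :: "('b, 'n) module" and D :: "nat \<Rightarrow> ('b, 'f) module"
  assumes N: "module S N" and D: "minimal_free_resolution S N D d \<epsilon>"
  shows "\<exists>(P :: nat \<Rightarrow> ('a, nat \<Rightarrow> 'a) module) \<delta> \<eta>. minimal_free_resolution R
      (restrict_scalars \<phi> ((D 0)\<lparr>carrier := d (Suc 0) ` carrier (D (Suc 0))\<rparr>)) P \<delta> \<eta>"
    "module S ((D 0)\<lparr>carrier := d (Suc 0) ` carrier (D (Suc 0))\<rparr>)"
proof -
  note f = S.minimal_free_resolutionD[OF D N] and syz = S.first_syzygy[OF N D]
  show m: "module S ((D 0)\<lparr>carrier := d (Suc 0) ` carrier (D (Suc 0))\<rparr>)"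
    by (rule submodule.submodule_is_module[OF syz(1) f(1)])
  show "\<exists>(P :: nat \<Rightarrow> ('a, nat \<Rightarrow> 'a) module) \<delta> \<eta>. minimal_free_resolution R
      (restrict_scalars \<phi> ((D 0)\<lparr>carrier := d (Suc 0) ` carrier (D (Suc 0))\<rparr>)) P \<delta> \<eta>"
    by (rule R.minimal_free_resolution_exists[OF restrict_module[OF m] restrict_finitely_generated[OF m syz(5)]])
qed

text \<open>The induction passes from \<open>N\<close> to a submodule of \<open>D 0\<close>, so that the elements of \<open>N\<close> and of \<open>D 0\<close> have
  the same type here. One more step of dimension shifting leads to this case from a module \<open>N\<close> on any type.\<close>

lemma tor_maps_zero_restrict_aux:
  fixes N :: "('b, 'f) module" and D :: "nat \<Rightarrow> ('b, 'f) module" and P :: "nat \<Rightarrow> ('a, nat \<Rightarrow> 'a) module"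
  assumes "module S N" "minimal_free_resolution S N D d \<epsilon>"
    "minimal_free_resolution R (restrict_scalars \<phi> N) P \<delta> \<eta>"
  shows "R.tor_maps_zero P \<delta> (Suc i) \<longleftrightarrow> S.tor_maps_zero D d (Suc i)"
  using assms
proof (induction i arbitrary: N D d \<epsilon> P \<delta> \<eta>)
  case 0
  obtain P' :: "nat \<Rightarrow> ('a, nat \<Rightarrow> 'a) module" and \<delta>' \<eta>' where P': "minimal_free_resolution R
      (restrict_scalars \<phi> ((D 0)\<lparr>carrier := d (Suc 0) ` carrier (D (Suc 0))\<rparr>)) P' \<delta>' \<eta>'"
    using syzygy_resolution(1)[OF 0(1,2)] by blast
  show ?case by (rule syzygy_step(1)[OF 0 P'])
next
  case (Suc i)
  obtain P' :: "nat \<Rightarrow> ('a, nat \<Rightarrow> 'a) module" and \<delta>' \<eta>' where P': "minimal_free_resolution R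
      (restrict_scalars \<phi> ((D 0)\<lparr>carrier := d (Suc 0) ` carrier (D (Suc 0))\<rparr>)) P' \<delta>' \<eta>'"
    using syzygy_resolution(1)[OF Suc.prems(1,2)] by blast
  have "R.tor_maps_zero P' \<delta>' (Suc i) \<longleftrightarrow> S.tor_maps_zero (\<lambda>i. D (Suc i)) (\<lambda>i. d (Suc i)) (Suc i)"
    by (rule Suc.IH[OF syzygy_resolution(2)[OF Suc.prems(1,2)] S.first_syzygy(4)[OF Suc.prems(1,2)] P'])
  thus ?case using syzygy_step(2)[OF Suc.prems P', of i] by (simp only: S.tor_maps_zero_shift)
qed

lemma tor_maps_zero_restrict:
  fixes N :: "('b, 'n) module" and D :: "nat \<Rightarrow> ('b, 'f) module" and P :: "nat \<Rightarrow> ('a, 'p) module"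
  assumes N: "module S N" and D: "minimal_free_resolution S N D d \<epsilon>"
    and P: "minimal_free_resolution R (restrict_scalars \<phi> N) P \<delta> \<eta>"
  shows "R.tor_maps_zero P \<delta> (Suc i) \<longleftrightarrow> S.tor_maps_zero D d (Suc i)"
proof -
  obtain P' :: "nat \<Rightarrow> ('a, nat \<Rightarrow> 'a) module" and \<delta>' \<eta>' where P': "minimal_free_resolution R
      (restrict_scalars \<phi> ((D 0)\<lparr>carrier := d (Suc 0) ` carrier (D (Suc 0))\<rparr>)) P' \<delta>' \<eta>'"
    using syzygy_resolution(1)[OF N D] by blast
  show ?thesis
  proof (cases i)
    case 0 thus ?thesis using syzygy_step(1)[OF N D P P'] by simp
  next
    case (Suc j)
    have "R.tor_maps_zero P' \<delta>' (Suc j) \<longleftrightarrow> S.tor_maps_zero (\<lambda>i. D (Suc i)) (\<lambda>i. d (Suc i)) (Suc j)"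
      by (rule tor_maps_zero_restrict_aux[OF syzygy_resolution(2)[OF N D] S.first_syzygy(4)[OF N D] P'])
    thus ?thesis unfolding Suc using syzygy_step(2)[OF N D P P', of j] by (simp only: S.tor_maps_zero_shift)
  qed
qed

lemma ld_restrict:
  assumes N: "module S N" and fg: "finitely_generated S N"
  shows "ld R (restrict_scalars \<phi> N) = ld S N"
proof (cases "carrier N = {\<zero>\<^bsub>N\<^esub>}")
  case True thus ?thesis by (simp add: ld_def)
next
  case False
  note NR = restrict_module[OF N] restrict_finitely_generated[OF N fg]
  have False': "carrier (restrict_scalars \<phi> N) \<noteq> {\<zero>\<^bsub>restrict_scalars \<phi> N\<^esub>}" using False by simp
  obtain D :: "nat \<Rightarrow> ('b, nat \<Rightarrow> 'b) module" and d \<epsilon> where D: "minimal_free_resolution S N D d \<epsilon>"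
    using S.minimal_free_resolution_exists[OF N fg] by blast
  obtain P :: "nat \<Rightarrow> ('a, nat \<Rightarrow> 'a) module" and \<delta> \<eta>
    where P: "minimal_free_resolution R (restrict_scalars \<phi> N) P \<delta> \<eta>"
    using R.minimal_free_resolution_exists[OF NR] by blast
  have "R.tor_maps_zero P \<delta> i \<longleftrightarrow> S.tor_maps_zero D d i" if "i > e" for i e :: nat
    using tor_maps_zero_restrict[OF N D P, of "i - 1"] that by (cases i) auto
  thus ?thesis
    by (intro enat_eqI_le)
       (simp add: R.ld_le_iff[OF NR False' P] S.ld_le_iff[OF N fg False D])
qed

lemma ld_realized_over_R:
  fixes N :: "('b, 'n) module"
  assumes N: "module S N" and fg: "finitely_generated S N"
  shows "\<exists>M :: ('a, (nat \<Rightarrow> 'a) set) module. module R M \<and> finitely_generated R M \<and> ld R M = ld S N"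
  using R.isomorphic_copy[OF restrict_module[OF N] restrict_finitely_generated[OF N fg]]
  unfolding ld_restrict[OF N fg] .

lemma gl_ld_le: "gl_ld S \<le> gl_ld R"
  unfolding gl_ld_def
proof (rule Sup_least)
  fix x assume "x \<in> {ld S M | M :: ('b, (nat \<Rightarrow> 'b) set) module. module S M \<and> finitely_generated S M}"
  then obtain N :: "('b, (nat \<Rightarrow> 'b) set) module" where N: "module S N" "finitely_generated S N" "x = ld S N"
    by auto
  from ld_realized_over_R[OF N(1,2)]
  show "x \<le> Sup {ld R M | M :: ('a, (nat \<Rightarrow> 'a) set) module. module R M \<and> finitely_generated R M}"
    unfolding N(3) by (metis (mono_tags, lifting) Sup_upper mem_Collect_eq)
qed

lemma absolutely_koszul_descends: "absolutely_koszul R \<Longrightarrow> absolutely_koszul S"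
  unfolding absolutely_koszul_def
proof (intro allI impI)
  fix N :: "('b, (nat \<Rightarrow> 'b) set) module"
  assume R: "\<forall>M :: ('a, (nat \<Rightarrow> 'a) set) module. module R M \<and> finitely_generated R M \<longrightarrow> ld R M < \<infinity>"
    and N: "module S N \<and> finitely_generated S N"
  from ld_realized_over_R[of N] N obtain M :: "('a, (nat \<Rightarrow> 'a) set) module"
    where "module R M" "finitely_generated R M" "ld R M = ld S N" by blast
  thus "ld S N < \<infinity>" using R by metis
qed

end

end

theorem theorem5p2:
  fixes R :: "('a, 'r) ring_scheme" and S :: "('b, 's) ring_scheme" and \<phi> :: "'a \<Rightarrow> 'b"
  assumes "noetherian_local_ring R" and "noetherian_local_ring S"
    and "\<phi> \<in> ring_hom R S" and "\<phi> ` carrier R = carrier S"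
    and "ld R (restrict_scalars \<phi> (ring_as_module S)) = 0"
  shows "(\<forall>N :: ('b, 'n) module. module S N \<and> finitely_generated S N \<longrightarrow>
            ld R (restrict_scalars \<phi> N) = ld S N) \<and>
         gl_ld S \<le> gl_ld R \<and>
         (absolutely_koszul R \<longrightarrow> absolutely_koszul S)"
proof -
  interpret local_surjection R S \<phi>
    using assms by (intro local_surjection.intro local_surjection_axioms.intro)
  show ?thesis
    using ld_restrict[OF assms(5)] gl_ld_le[OF assms(5)] absolutely_koszul_descends[OF assms(5)] by blast
qed

end
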